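(* Let $T$ be an additive ternary $\Gamma$-ring. For every commutative unital $\mathbb Z$-algebra $S$, scalar extension induces natural isomorphisms $$\mathcal O(T,\Gamma)\otimes_{\mathbb Z}S\cong\mathcal O_S(T_S,\Gamma_S),\qquad \mathcal A(T,\Gamma)\otimes_{\mathbb Z}S\cong\mathcal A_S(T_S,\Gamma_S)$$ of $S$-rngs and of unital $S$-algebras, respectively.
   Context: A rng is an associative ring, not necessarily unital; an $S$-rng is a not necessarily unital associative $S$-algebra. An additive ternary $\Gamma$-ring consists of abelian groups $(T,+)$, $(\Gamma,+)$ and a map $T\times\Gamma\times T\times\Gamma\times T\to T$, $(x,\alpha,y,\beta,z)\mapsto x\alpha y\beta z$, additive in each of the five variables, with $(x\alpha y\beta z)\gamma u\delta v=x\alpha(y\beta z\gamma u)\delta v=x\alpha y\beta(z\gamma u\delta v)$. Let $F(T,\Gamma)=T\otimes_{\mathbb Z}\Gamma\otimes_{\mathbb Z}T\otimes_{\mathbb Z}\Gamma$ with the associative bilinear multiplication $(a\otimes\alpha\otimes b\otimes\beta)(c\otimes\gamma\otimes d\otimes\delta)=(a\alpha b\beta c)\otimes\gamma\otimes d\otimes\delta$, let $J(T,\Gamma)$ be the two-sided ideal generated by all middle relations $(a\alpha b\beta c)\otimes\gamma\otimes d\otimes\delta-a\otimes\alpha\otimes(b\beta c\gamma d)\otimes\delta$, and let $\mathcal O(T,\Gamma)=F(T,\Gamma)/J(T,\Gamma)$. The ring $\mathcal A(T,\Gamma)=\mathbb Z\ltimes\mathcal O(T,\Gamma)$ is $\mathbb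 Z\oplus\mathcal O(T,\Gamma)$ with $(n,r)(m,s)=(nm,ns+mr+rs)$. For a commutative unital $\mathbb Z$-algebra $S$ put $T_S=T\otimes_{\mathbb Z}S$ and $\Gamma_S=\Gamma\otimes_{\mathbb Z}S$, and extend the ternary product $S$-multilinearly. $\mathcal O_S(T_S,\Gamma_S)$ is the quotient of $T_S\otimes_S\Gamma_S\otimes_ST_S\otimes_S\Gamma_S$, with multiplication given by the same formula, by the two-sided ideal generated by the same middle relations (with entries in $T_S$ and $\Gamma_S$). $\mathcal A_S(T_S,\Gamma_S)=S\ltimes\mathcal O_S(T_S,\Gamma_S)$ is $S\oplus\mathcal O_S(T_S,\Gamma_S)$ with $(n,r)(m,s)=(nm,ns+mr+rs)$, $n,m\in S$. *)

theory Defs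
  imports "HOL-Algebra.Module" "HOL-Algebra.IntRing"
begin

section \<open>Linear maps, quotients and tensor products\<close>

text \<open>
  Modules are records of \<^typ>\<open>('r, 'm) module\<close>. As usual in HOL-Algebra the multiplication and
  the unit of the record carry no information when the record is only used as a module; the unit
  carries no information when it is used as a rng. Abelian groups are modules over \<^term>\<open>\<Z>\<close>.
\<close>

definition zmod :: "('a, 'x) ring_scheme \<Rightarrow> (int, 'a) module" where
  "zmod A = \<lparr>carrier = carrier A, monoid.mult = monoid.mult A, one = one A, zero = zero A, add = add A,
     smult = (\<lambda>k x. add_pow A k x)\<rparr>"

definition semilinear ::
  "('r, 'x) ring_scheme \<Rightarrow> ('r \<Rightarrow> 's) \<Rightarrow> ('r, 'm) module \<Rightarrow> ('s, 'n) module \<Rightarrow> ('m \<Rightarrow> 'n) set" where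
  "semilinear R h M N = {f \<in> hom (add_monoid M) (add_monoid N).
     \<forall>r\<in>carrier R. \<forall>x\<in>carrier M. f (r \<odot>\<^bsub>M\<^esub> x) = h r \<odot>\<^bsub>N\<^esub> f x}"

abbreviation linear_maps ::
  "('r, 'x) ring_scheme \<Rightarrow> ('r, 'm) module \<Rightarrow> ('r, 'n) module \<Rightarrow> ('m \<Rightarrow> 'n) set" where
  "linear_maps R \<equiv> semilinear R (\<lambda>r. r)"

definition bilinear_map ::
  "('r, 'x) ring_scheme \<Rightarrow> ('r, 'm) module \<Rightarrow> ('r, 'n) module \<Rightarrow> ('r, 'p) module
    \<Rightarrow> ('m \<Rightarrow> 'n \<Rightarrow> 'p) \<Rightarrow> bool" where
  "bilinear_map R M N P b \<longleftrightarrow>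
     (\<forall>x\<in>carrier M. b x \<in> linear_maps R N P) \<and>
     (\<forall>y\<in>carrier N. (\<lambda>x. b x y) \<in> linear_maps R M P)"

text \<open>The operations on cosets are the usual ones on representatives (written, as in
  \<^const>\<open>rcoset_mult\<close>, as unions over all representatives).\<close>

definition quot :: "('r, 'm) module \<Rightarrow> 'm set \<Rightarrow> ('r, 'm set) module" where
  "quot M I = \<lparr>carrier = a_rcosets\<^bsub>M\<^esub> I, monoid.mult = rcoset_mult M I, one = I +>\<^bsub>M\<^esub> \<one>\<^bsub>M\<^esub>,
     zero = I, add = set_add M, smult = (\<lambda>r X. \<Union>x\<in>X. I +>\<^bsub>M\<^esub> (r \<odot>\<^bsub>M\<^esub> x))\<rparr>"

definition free_module :: "('r, 'x) ring_scheme \<Rightarrow> 'b set \<Rightarrow> ('r, 'b \<Rightarrow> 'r) module" where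
  "free_module R B = \<lparr>
     carrier = {p. p ` B \<subseteq> carrier R \<and> (\<forall>b. b \<notin> B \<longrightarrow> p b = \<zero>\<^bsub>R\<^esub>) \<and> finite {b \<in> B. p b \<noteq> \<zero>\<^bsub>R\<^esub>}},
     monoid.mult = undefined, one = undefined,
     zero = (\<lambda>b. \<zero>\<^bsub>R\<^esub>), add = (\<lambda>p q b. p b \<oplus>\<^bsub>R\<^esub> q b),
     smult = (\<lambda>r p b. r \<otimes>\<^bsub>R\<^esub> p b)\<rparr>"

definition basis_elem :: "('r, 'x) ring_scheme \<Rightarrow> 'b \<Rightarrow> 'b \<Rightarrow> 'r" where
  "basis_elem R b = (\<lambda>c. if c = b then \<one>\<^bsub>R\<^esub> else \<zero>\<^bsub>R\<^esub>)"

definition span_of :: "('r, 'x) ring_scheme \<Rightarrow> ('r, 'm) module \<Rightarrow> 'm set \<Rightarrow> 'm set" where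
  "span_of R M X = \<Inter>{H. submodule H R M \<and> X \<subseteq> H}"

definition tensor_relations ::
  "('r, 'x) ring_scheme \<Rightarrow> ('r, 'm) module \<Rightarrow> ('r, 'n) module \<Rightarrow> ('m \<times> 'n \<Rightarrow> 'r) set" where
  "tensor_relations R M N =
    (let L = free_module R (carrier M \<times> carrier N); e = (\<lambda>x y. basis_elem R (x, y)) in
      {e (x \<oplus>\<^bsub>M\<^esub> x') y \<ominus>\<^bsub>L\<^esub> (e x y \<oplus>\<^bsub>L\<^esub> e x' y) | x x' y.
         x \<in> carrier M \<and> x' \<in> carrier M \<and> y \<in> carrier N} \<union>
      {e x (y \<oplus>\<^bsub>N\<^esub> y') \<ominus>\<^bsub>L\<^esub> (e x y \<oplus>\<^bsub>L\<^esub> e x y') | x y y'.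
         x \<in> carrier M \<and> y \<in> carrier N \<and> y' \<in> carrier N} \<union>
      {e (r \<odot>\<^bsub>M\<^esub> x) y \<ominus>\<^bsub>L\<^esub> (r \<odot>\<^bsub>L\<^esub> e x y) | r x y.
         r \<in> carrier R \<and> x \<in> carrier M \<and> y \<in> carrier N} \<union>
      {e x (r \<odot>\<^bsub>N\<^esub> y) \<ominus>\<^bsub>L\<^esub> (r \<odot>\<^bsub>L\<^esub> e x y) | r x y.
         r \<in> carrier R \<and> x \<in> carrier M \<and> y \<in> carrier N})"

definition tensor_kernel ::
  "('r, 'x) ring_scheme \<Rightarrow> ('r, 'm) module \<Rightarrow> ('r, 'n) module \<Rightarrow> ('m \<times> 'n \<Rightarrow> 'r) set" where
  "tensor_kernel R M N =
     span_of R (free_module R (carrier M \<times> carrier N)) (tensor_relations R M N)"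

definition tensor ::
  "('r, 'x) ring_scheme \<Rightarrow> ('r, 'm) module \<Rightarrow> ('r, 'n) module \<Rightarrow> ('r, ('m \<times> 'n \<Rightarrow> 'r) set) module" where
  "tensor R M N = quot (free_module R (carrier M \<times> carrier N)) (tensor_kernel R M N)"

definition tens ::
  "('r, 'x) ring_scheme \<Rightarrow> ('r, 'm) module \<Rightarrow> ('r, 'n) module \<Rightarrow> 'm \<Rightarrow> 'n \<Rightarrow> ('m \<times> 'n \<Rightarrow> 'r) set" where
  "tens R M N x y =
     tensor_kernel R M N +>\<^bsub>free_module R (carrier M \<times> carrier N)\<^esub> basis_elem R (x, y)"

text \<open>Here and below, a map out of a tensor product is selected by its values on pure tensors
  together with (multi)linearity; these determine it on the carrier.\<close>

definition tensor_map ::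
  "('r, 'x) ring_scheme \<Rightarrow> ('r, 'm) module \<Rightarrow> ('r, 'n) module \<Rightarrow> ('r, 'm2) module \<Rightarrow> ('r, 'n2) module
    \<Rightarrow> ('m \<Rightarrow> 'm2) \<Rightarrow> ('n \<Rightarrow> 'n2) \<Rightarrow> ('m \<times> 'n \<Rightarrow> 'r) set \<Rightarrow> ('m2 \<times> 'n2 \<Rightarrow> 'r) set" where
  "tensor_map R M N M' N' f g = (SOME k. k \<in> linear_maps R (tensor R M N) (tensor R M' N') \<and>
     (\<forall>x\<in>carrier M. \<forall>y\<in>carrier N. k (tens R M N x y) = tens R M' N' (f x) (g y)))"


section \<open>Algebras that need not be unital\<close>

locale S_rng = module R A for R :: "('r, 'x) ring_scheme" and A :: "('r, 'a) module" (structure) +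
  assumes bilinear_mult: "bilinear_map R A A A (monoid.mult A)"
    and mult_assoc: "\<lbrakk>x \<in> carrier A; y \<in> carrier A; z \<in> carrier A\<rbrakk>
      \<Longrightarrow> (x \<otimes> y) \<otimes> z = x \<otimes> (y \<otimes> z)"

locale unital_algebra = S_rng R A + ring A
  for R :: "('r, 'x) ring_scheme" and A :: "('r, 'a) module" (structure)

definition S_rng_iso ::
  "('r, 'x) ring_scheme \<Rightarrow> ('r, 'a) module \<Rightarrow> ('r, 'b) module \<Rightarrow> ('a \<Rightarrow> 'b) \<Rightarrow> bool" where
  "S_rng_iso R A B f \<longleftrightarrow> S_rng R A \<and> S_rng R B \<and> f \<in> linear_maps R A B \<and>
     (\<forall>x\<in>carrier A. \<forall>y\<in>carrier A. f (x \<otimes>\<^bsub>A\<^esub> y) = f x \<otimes>\<^bsub>B\<^esub> f y) \<and>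
     bij_betw f (carrier A) (carrier B)"

definition unital_algebra_iso ::
  "('r, 'x) ring_scheme \<Rightarrow> ('r, 'a) module \<Rightarrow> ('r, 'b) module \<Rightarrow> ('a \<Rightarrow> 'b) \<Rightarrow> bool" where
  "unital_algebra_iso R A B f \<longleftrightarrow> unital_algebra R A \<and> unital_algebra R B \<and>
     S_rng_iso R A B f \<and> f \<one>\<^bsub>A\<^esub> = \<one>\<^bsub>B\<^esub>"

definition two_sided_ideal ::
  "('r, 'x) ring_scheme \<Rightarrow> ('r, 'a) module \<Rightarrow> 'a set \<Rightarrow> bool" where
  "two_sided_ideal R A I \<longleftrightarrow> submodule I R A \<and>
     (\<forall>x\<in>carrier A. \<forall>y\<in>I. x \<otimes>\<^bsub>A\<^esub> y \<in> I \<and> y \<otimes>\<^bsub>A\<^esub> x \<in> I)"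

definition ideal_gen_by ::
  "('r, 'x) ring_scheme \<Rightarrow> ('r, 'a) module \<Rightarrow> 'a set \<Rightarrow> 'a set" where
  "ideal_gen_by R A X = \<Inter>{I. two_sided_ideal R A I \<and> X \<subseteq> I}"

definition semidirect ::
  "('r, 'x) ring_scheme \<Rightarrow> ('r, 'a) module \<Rightarrow> ('r, 'r \<times> 'a) module" where
  "semidirect R A = \<lparr>carrier = carrier R \<times> carrier A,
     monoid.mult = (\<lambda>(n, r) (m, s). (n \<otimes>\<^bsub>R\<^esub> m, n \<odot>\<^bsub>A\<^esub> s \<oplus>\<^bsub>A\<^esub> m \<odot>\<^bsub>A\<^esub> r \<oplus>\<^bsub>A\<^esub> r \<otimes>\<^bsub>A\<^esub> s)),
     one = (\<one>\<^bsub>R\<^esub>, \<zero>\<^bsub>A\<^esub>), zero = (\<zero>\<^bsub>R\<^esub>, \<zero>\<^bsub>A\<^esub>),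
     add = (\<lambda>(n, r) (m, s). (n \<oplus>\<^bsub>R\<^esub> m, r \<oplus>\<^bsub>A\<^esub> s)),
     smult = (\<lambda>k (n, r). (k \<otimes>\<^bsub>R\<^esub> n, k \<odot>\<^bsub>A\<^esub> r))\<rparr>"


section \<open>Extension of scalars from the integers\<close>

definition base_change ::
  "(int, 'm) module \<Rightarrow> ('s, 'y) ring_scheme \<Rightarrow> ('s, ('m \<times> 's \<Rightarrow> int) set) module" where
  "base_change M S = \<lparr>carrier = carrier (tensor \<Z> M (zmod S)), monoid.mult = undefined, one = undefined,
     zero = \<zero>\<^bsub>tensor \<Z> M (zmod S)\<^esub>, add = add (tensor \<Z> M (zmod S)),
     smult = (\<lambda>s. tensor_map \<Z> M (zmod S) M (zmod S) (\<lambda>x. x) (\<lambda>t. s \<otimes>\<^bsub>S\<^esub> t))\<rparr>"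

abbreviation btens :: "(int, 'm) module \<Rightarrow> ('s, 'y) ring_scheme \<Rightarrow> 'm \<Rightarrow> 's \<Rightarrow> ('m \<times> 's \<Rightarrow> int) set" where
  "btens M S \<equiv> tens \<Z> M (zmod S)"

definition base_change_alg ::
  "(int, 'a) module \<Rightarrow> ('s, 'y) ring_scheme \<Rightarrow> ('s, ('a \<times> 's \<Rightarrow> int) set) module" where
  "base_change_alg A S = (base_change A S)\<lparr>
     monoid.mult := (SOME m. bilinear_map S (base_change A S) (base_change A S) (base_change A S) m \<and>
       (\<forall>x\<in>carrier A. \<forall>y\<in>carrier A. \<forall>s\<in>carrier S. \<forall>t\<in>carrier S.
          m (btens A S x s) (btens A S y t) = btens A S (x \<otimes>\<^bsub>A\<^esub> y) (s \<otimes>\<^bsub>S\<^esub> t))),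
     one := btens A S \<one>\<^bsub>A\<^esub> \<one>\<^bsub>S\<^esub>\<rparr>"

definition base_change_map ::
  "(int, 'm) module \<Rightarrow> ('s, 'y) ring_scheme \<Rightarrow> (int, 'n) module \<Rightarrow> ('t, 'z) ring_scheme
    \<Rightarrow> ('m \<Rightarrow> 'n) \<Rightarrow> ('s \<Rightarrow> 't) \<Rightarrow> ('m \<times> 's \<Rightarrow> int) set \<Rightarrow> ('n \<times> 't \<Rightarrow> int) set" where
  "base_change_map M S M' S' f h = tensor_map \<Z> M (zmod S) M' (zmod S') f h"

text \<open>The \<open>S\<close>-linear map \<open>M \<otimes> S \<rightarrow> N\<close>, \<open>x \<otimes> s \<mapsto> s (i x)\<close>, induced by an additive map \<open>i : M \<rightarrow> N\<close>.\<close>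

definition linear_extension ::
  "(int, 'm) module \<Rightarrow> ('s, 'y) ring_scheme \<Rightarrow> ('s, 'n) module \<Rightarrow> ('m \<Rightarrow> 'n)
    \<Rightarrow> ('m \<times> 's \<Rightarrow> int) set \<Rightarrow> 'n" where
  "linear_extension M S N i = (SOME k. k \<in> linear_maps S (base_change M S) N \<and>
     (\<forall>x\<in>carrier M. \<forall>s\<in>carrier S. k (btens M S x s) = s \<odot>\<^bsub>N\<^esub> i x))"


section \<open>Ternary Gamma-rings\<close>

type_synonym ('t, 'g) ternary = "'t \<Rightarrow> 'g \<Rightarrow> 't \<Rightarrow> 'g \<Rightarrow> 't \<Rightarrow> 't"

locale ternary_gamma_ring =
  T: abelian_group T + G: abelian_group G
  for T :: "('t, 'x) ring_scheme" and G :: "('g, 'y) ring_scheme" and tp :: "('t, 'g) ternary" +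
  assumes additive1: "\<lbrakk>\<alpha> \<in> carrier G; y \<in> carrier T; \<beta> \<in> carrier G; z \<in> carrier T\<rbrakk>
      \<Longrightarrow> (\<lambda>x. tp x \<alpha> y \<beta> z) \<in> hom (add_monoid T) (add_monoid T)"
    and additive2: "\<lbrakk>x \<in> carrier T; y \<in> carrier T; \<beta> \<in> carrier G; z \<in> carrier T\<rbrakk>
      \<Longrightarrow> (\<lambda>\<alpha>. tp x \<alpha> y \<beta> z) \<in> hom (add_monoid G) (add_monoid T)"
    and additive3: "\<lbrakk>x \<in> carrier T; \<alpha> \<in> carrier G; \<beta> \<in> carrier G; z \<in> carrier T\<rbrakk>
      \<Longrightarrow> (\<lambda>y. tp x \<alpha> y \<beta> z) \<in> hom (add_monoid T) (add_monoid T)"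
    and additive4: "\<lbrakk>x \<in> carrier T; \<alpha> \<in> carrier G; y \<in> carrier T; z \<in> carrier T\<rbrakk>
      \<Longrightarrow> (\<lambda>\<beta>. tp x \<alpha> y \<beta> z) \<in> hom (add_monoid G) (add_monoid T)"
    and additive5: "\<lbrakk>x \<in> carrier T; \<alpha> \<in> carrier G; y \<in> carrier T; \<beta> \<in> carrier G\<rbrakk>
      \<Longrightarrow> (\<lambda>z. tp x \<alpha> y \<beta> z) \<in> hom (add_monoid T) (add_monoid T)"
    and ternary_assoc:
      "\<lbrakk>x \<in> carrier T; \<alpha> \<in> carrier G; y \<in> carrier T; \<beta> \<in> carrier G; z \<in> carrier T;
        \<gamma> \<in> carrier G; u \<in> carrier T; \<delta> \<in> carrier G; v \<in> carrier T\<rbrakk>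
      \<Longrightarrow> tp (tp x \<alpha> y \<beta> z) \<gamma> u \<delta> v = tp x \<alpha> (tp y \<beta> z \<gamma> u) \<delta> v \<and>
          tp x \<alpha> (tp y \<beta> z \<gamma> u) \<delta> v = tp x \<alpha> y \<beta> (tp z \<gamma> u \<delta> v)"

definition ternary_gamma_hom ::
  "('t, 'x) ring_scheme \<Rightarrow> ('g, 'y) ring_scheme \<Rightarrow> ('t, 'g) ternary
    \<Rightarrow> ('t2, 'x2) ring_scheme \<Rightarrow> ('g2, 'y2) ring_scheme \<Rightarrow> ('t2, 'g2) ternary
    \<Rightarrow> ('t \<Rightarrow> 't2) \<Rightarrow> ('g \<Rightarrow> 'g2) \<Rightarrow> bool" where
  "ternary_gamma_hom T G tp T' G' tp' f g \<longleftrightarrow>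
     f \<in> hom (add_monoid T) (add_monoid T') \<and> g \<in> hom (add_monoid G) (add_monoid G') \<and>
     (\<forall>x\<in>carrier T. \<forall>\<alpha>\<in>carrier G. \<forall>y\<in>carrier T. \<forall>\<beta>\<in>carrier G. \<forall>z\<in>carrier T.
        f (tp x \<alpha> y \<beta> z) = tp' (f x) (g \<alpha>) (f y) (g \<beta>) (f z))"

definition multilinear5 ::
  "('r, 'x) ring_scheme \<Rightarrow> ('r, 't) module \<Rightarrow> ('r, 'g) module \<Rightarrow> ('t, 'g) ternary \<Rightarrow> bool" where
  "multilinear5 R T G q \<longleftrightarrow>
     (\<forall>\<alpha>\<in>carrier G. \<forall>y\<in>carrier T. \<forall>\<beta>\<in>carrier G. \<forall>z\<in>carrier T.
        (\<lambda>x. q x \<alpha> y \<beta> z) \<in> linear_maps R T T) \<and>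
     (\<forall>x\<in>carrier T. \<forall>y\<in>carrier T. \<forall>\<beta>\<in>carrier G. \<forall>z\<in>carrier T.
        (\<lambda>\<alpha>. q x \<alpha> y \<beta> z) \<in> linear_maps R G T) \<and>
     (\<forall>x\<in>carrier T. \<forall>\<alpha>\<in>carrier G. \<forall>\<beta>\<in>carrier G. \<forall>z\<in>carrier T.
        (\<lambda>y. q x \<alpha> y \<beta> z) \<in> linear_maps R T T) \<and>
     (\<forall>x\<in>carrier T. \<forall>\<alpha>\<in>carrier G. \<forall>y\<in>carrier T. \<forall>z\<in>carrier T.
        (\<lambda>\<beta>. q x \<alpha> y \<beta> z) \<in> linear_maps R G T) \<and>
     (\<forall>x\<in>carrier T. \<forall>\<alpha>\<in>carrier G. \<forall>y\<in>carrier T. \<forall>\<beta>\<in>carrier G.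
        (\<lambda>z. q x \<alpha> y \<beta> z) \<in> linear_maps R T T)"

text \<open>The \<open>S\<close>-multilinear extension of the ternary product to \<open>T \<otimes> S\<close> and \<open>G \<otimes> S\<close>.\<close>

definition ternary_ext ::
  "(int, 't) module \<Rightarrow> (int, 'g) module \<Rightarrow> ('t, 'g) ternary \<Rightarrow> ('s, 'y) ring_scheme
    \<Rightarrow> (('t \<times> 's \<Rightarrow> int) set, ('g \<times> 's \<Rightarrow> int) set) ternary" where
  "ternary_ext T G tp S = (SOME q. multilinear5 S (base_change T S) (base_change G S) q \<and>
     (\<forall>x\<in>carrier T. \<forall>\<alpha>\<in>carrier G. \<forall>y\<in>carrier T. \<forall>\<beta>\<in>carrier G. \<forall>z\<in>carrier T.
        q (btens T S x \<one>\<^bsub>S\<^esub>) (btens G S \<alpha> \<one>\<^bsub>S\<^esub>) (btens T S y \<one>\<^bsub>S\<^esub>) (btens G S \<beta> \<one>\<^bsub>S\<^esub>) (btens T S z \<one>\<^bsub>S\<^esub>)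
          = btens T S (tp x \<alpha> y \<beta> z) \<one>\<^bsub>S\<^esub>))"


section \<open>The algebras O and A\<close>

text \<open>Everything is defined for an \<open>R\<close>-multilinear ternary product \<open>tp\<close> on \<open>R\<close>-modules \<open>T\<close>, \<open>G\<close>;
  the fourfold tensor product is bracketed to the right.\<close>

definition F_module ::
  "('r, 'x) ring_scheme \<Rightarrow> ('r, 't) module \<Rightarrow> ('r, 'g) module
    \<Rightarrow> ('r, ('t \<times> ('g \<times> ('t \<times> 'g \<Rightarrow> 'r) set \<Rightarrow> 'r) set \<Rightarrow> 'r) set) module" where
  "F_module R T G = tensor R T (tensor R G (tensor R T G))"

definition tens4 ::
  "('r, 'x) ring_scheme \<Rightarrow> ('r, 't) module \<Rightarrow> ('r, 'g) module \<Rightarrow> 't \<Rightarrow> 'g \<Rightarrow> 't \<Rightarrow> 'g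
    \<Rightarrow> ('t \<times> ('g \<times> ('t \<times> 'g \<Rightarrow> 'r) set \<Rightarrow> 'r) set \<Rightarrow> 'r) set" where
  "tens4 R T G a \<alpha> b \<beta> =
     tens R T (tensor R G (tensor R T G)) a (tens R G (tensor R T G) \<alpha> (tens R T G b \<beta>))"

definition F_alg ::
  "('r, 'x) ring_scheme \<Rightarrow> ('r, 't) module \<Rightarrow> ('r, 'g) module \<Rightarrow> ('t, 'g) ternary
    \<Rightarrow> ('r, ('t \<times> ('g \<times> ('t \<times> 'g \<Rightarrow> 'r) set \<Rightarrow> 'r) set \<Rightarrow> 'r) set) module" where
  "F_alg R T G tp = (F_module R T G)\<lparr>
     monoid.mult := (SOME m. bilinear_map R (F_module R T G) (F_module R T G) (F_module R T G) m \<and>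
       (\<forall>a\<in>carrier T. \<forall>\<alpha>\<in>carrier G. \<forall>b\<in>carrier T. \<forall>\<beta>\<in>carrier G.
        \<forall>c\<in>carrier T. \<forall>\<gamma>\<in>carrier G. \<forall>d\<in>carrier T. \<forall>\<delta>\<in>carrier G.
          m (tens4 R T G a \<alpha> b \<beta>) (tens4 R T G c \<gamma> d \<delta>) = tens4 R T G (tp a \<alpha> b \<beta> c) \<gamma> d \<delta>))\<rparr>"

definition middle_relations ::
  "('r, 'x) ring_scheme \<Rightarrow> ('r, 't) module \<Rightarrow> ('r, 'g) module \<Rightarrow> ('t, 'g) ternary
    \<Rightarrow> ('t \<times> ('g \<times> ('t \<times> 'g \<Rightarrow> 'r) set \<Rightarrow> 'r) set \<Rightarrow> 'r) set set" where
  "middle_relations R T G tp =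
     {tens4 R T G (tp a \<alpha> b \<beta> c) \<gamma> d \<delta> \<ominus>\<^bsub>F_alg R T G tp\<^esub> tens4 R T G a \<alpha> (tp b \<beta> c \<gamma> d) \<delta>
      | a \<alpha> b \<beta> c \<gamma> d \<delta>.
        a \<in> carrier T \<and> \<alpha> \<in> carrier G \<and> b \<in> carrier T \<and> \<beta> \<in> carrier G \<and>
        c \<in> carrier T \<and> \<gamma> \<in> carrier G \<and> d \<in> carrier T \<and> \<delta> \<in> carrier G}"

definition J_ideal ::
  "('r, 'x) ring_scheme \<Rightarrow> ('r, 't) module \<Rightarrow> ('r, 'g) module \<Rightarrow> ('t, 'g) ternary
    \<Rightarrow> ('t \<times> ('g \<times> ('t \<times> 'g \<Rightarrow> 'r) set \<Rightarrow> 'r) set \<Rightarrow> 'r) set set" where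
  "J_ideal R T G tp = ideal_gen_by R (F_alg R T G tp) (middle_relations R T G tp)"

type_synonym ('r, 't, 'g) O_elem = "('t \<times> ('g \<times> ('t \<times> 'g \<Rightarrow> 'r) set \<Rightarrow> 'r) set \<Rightarrow> 'r) set set"

definition O_alg ::
  "('r, 'x) ring_scheme \<Rightarrow> ('r, 't) module \<Rightarrow> ('r, 'g) module \<Rightarrow> ('t, 'g) ternary
    \<Rightarrow> ('r, ('r, 't, 'g) O_elem) module" where
  "O_alg R T G tp = quot (F_alg R T G tp) (J_ideal R T G tp)"

definition O_gen ::
  "('r, 'x) ring_scheme \<Rightarrow> ('r, 't) module \<Rightarrow> ('r, 'g) module \<Rightarrow> ('t, 'g) ternary
    \<Rightarrow> 't \<Rightarrow> 'g \<Rightarrow> 't \<Rightarrow> 'g \<Rightarrow> ('r, 't, 'g) O_elem" where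
  "O_gen R T G tp a \<alpha> b \<beta> = J_ideal R T G tp +>\<^bsub>F_alg R T G tp\<^esub> tens4 R T G a \<alpha> b \<beta>"

definition A_alg ::
  "('r, 'x) ring_scheme \<Rightarrow> ('r, 't) module \<Rightarrow> ('r, 'g) module \<Rightarrow> ('t, 'g) ternary
    \<Rightarrow> ('r, 'r \<times> ('r, 't, 'g) O_elem) module" where
  "A_alg R T G tp = semidirect R (O_alg R T G tp)"

text \<open>Functoriality along a ring homomorphism \<open>h : R \<rightarrow> R'\<close> and \<open>h\<close>-semilinear maps
  \<open>f : T \<rightarrow> T'\<close>, \<open>g : G \<rightarrow> G'\<close> that preserve the ternary products.\<close>

definition O_map ::
  "('r, 'x) ring_scheme \<Rightarrow> ('r, 't) module \<Rightarrow> ('r, 'g) module \<Rightarrow> ('t, 'g) ternary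
    \<Rightarrow> ('r2, 'x2) ring_scheme \<Rightarrow> ('r2, 't2) module \<Rightarrow> ('r2, 'g2) module \<Rightarrow> ('t2, 'g2) ternary
    \<Rightarrow> ('r \<Rightarrow> 'r2) \<Rightarrow> ('t \<Rightarrow> 't2) \<Rightarrow> ('g \<Rightarrow> 'g2)
    \<Rightarrow> ('r, 't, 'g) O_elem \<Rightarrow> ('r2, 't2, 'g2) O_elem" where
  "O_map R T G tp R' T' G' tp' h f g =
     (SOME k. k \<in> semilinear R h (O_alg R T G tp) (O_alg R' T' G' tp') \<and>
       (\<forall>a\<in>carrier T. \<forall>\<alpha>\<in>carrier G. \<forall>b\<in>carrier T. \<forall>\<beta>\<in>carrier G.
          k (O_gen R T G tp a \<alpha> b \<beta>) = O_gen R' T' G' tp' (f a) (g \<alpha>) (f b) (g \<beta>)))"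

definition A_map ::
  "('r, 'x) ring_scheme \<Rightarrow> ('r, 't) module \<Rightarrow> ('r, 'g) module \<Rightarrow> ('t, 'g) ternary
    \<Rightarrow> ('r2, 'x2) ring_scheme \<Rightarrow> ('r2, 't2) module \<Rightarrow> ('r2, 'g2) module \<Rightarrow> ('t2, 'g2) ternary
    \<Rightarrow> ('r \<Rightarrow> 'r2) \<Rightarrow> ('t \<Rightarrow> 't2) \<Rightarrow> ('g \<Rightarrow> 'g2)
    \<Rightarrow> 'r \<times> ('r, 't, 'g) O_elem \<Rightarrow> 'r2 \<times> ('r2, 't2, 'g2) O_elem" where
  "A_map R T G tp R' T' G' tp' h f g = map_prod h (O_map R T G tp R' T' G' tp' h f g)"


section \<open>The integral algebras, their scalar extensions, and the comparison maps\<close>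

definition OZ :: "('t, 'x) ring_scheme \<Rightarrow> ('g, 'y) ring_scheme \<Rightarrow> ('t, 'g) ternary
    \<Rightarrow> (int, (int, 't, 'g) O_elem) module" where
  "OZ T G tp = O_alg \<Z> (zmod T) (zmod G) tp"

definition AZ :: "('t, 'x) ring_scheme \<Rightarrow> ('g, 'y) ring_scheme \<Rightarrow> ('t, 'g) ternary
    \<Rightarrow> (int, int \<times> (int, 't, 'g) O_elem) module" where
  "AZ T G tp = A_alg \<Z> (zmod T) (zmod G) tp"

type_synonym ('s, 't, 'g) OS_elem =
  "('s, ('t \<times> 's \<Rightarrow> int) set, ('g \<times> 's \<Rightarrow> int) set) O_elem"

definition OS :: "('t, 'x) ring_scheme \<Rightarrow> ('g, 'y) ring_scheme \<Rightarrow> ('t, 'g) ternary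
    \<Rightarrow> ('s, 'z) ring_scheme \<Rightarrow> ('s, ('s, 't, 'g) OS_elem) module" where
  "OS T G tp S = O_alg S (base_change (zmod T) S) (base_change (zmod G) S)
     (ternary_ext (zmod T) (zmod G) tp S)"

definition AS :: "('t, 'x) ring_scheme \<Rightarrow> ('g, 'y) ring_scheme \<Rightarrow> ('t, 'g) ternary
    \<Rightarrow> ('s, 'z) ring_scheme \<Rightarrow> ('s, 's \<times> ('s, 't, 'g) OS_elem) module" where
  "AS T G tp S = A_alg S (base_change (zmod T) S) (base_change (zmod G) S)
     (ternary_ext (zmod T) (zmod G) tp S)"

text \<open>The comparison maps are the \<open>S\<close>-linear extensions of the maps which \<open>a \<mapsto> a \<otimes> 1\<close> (on \<open>T\<close>,
  \<open>G\<close>) and \<open>\<int> \<rightarrow> S\<close> induce on the algebras.\<close>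

definition O_comparison :: "('t, 'x) ring_scheme \<Rightarrow> ('g, 'y) ring_scheme \<Rightarrow> ('t, 'g) ternary
    \<Rightarrow> ('s, 'z) ring_scheme \<Rightarrow> ((int, 't, 'g) O_elem \<times> 's \<Rightarrow> int) set \<Rightarrow> ('s, 't, 'g) OS_elem" where
  "O_comparison T G tp S = linear_extension (OZ T G tp) S (OS T G tp S)
     (O_map \<Z> (zmod T) (zmod G) tp
        S (base_change (zmod T) S) (base_change (zmod G) S) (ternary_ext (zmod T) (zmod G) tp S)
        (\<lambda>k. add_pow S k \<one>\<^bsub>S\<^esub>) (\<lambda>a. btens (zmod T) S a \<one>\<^bsub>S\<^esub>) (\<lambda>\<alpha>. btens (zmod G) S \<alpha> \<one>\<^bsub>S\<^esub>))"

definition A_comparison :: "('t, 'x) ring_scheme \<Rightarrow> ('g, 'y) ring_scheme \<Rightarrow> ('t, 'g) ternary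
    \<Rightarrow> ('s, 'z) ring_scheme \<Rightarrow> ((int \<times> (int, 't, 'g) O_elem) \<times> 's \<Rightarrow> int) set
    \<Rightarrow> 's \<times> ('s, 't, 'g) OS_elem" where
  "A_comparison T G tp S = linear_extension (AZ T G tp) S (AS T G tp S)
     (A_map \<Z> (zmod T) (zmod G) tp
        S (base_change (zmod T) S) (base_change (zmod G) S) (ternary_ext (zmod T) (zmod G) tp S)
        (\<lambda>k. add_pow S k \<one>\<^bsub>S\<^esub>) (\<lambda>a. btens (zmod T) S a \<one>\<^bsub>S\<^esub>) (\<lambda>\<alpha>. btens (zmod G) S \<alpha> \<one>\<^bsub>S\<^esub>))"

text \<open>The maps which a homomorphism \<open>(f, g)\<close> of ternary Gamma-rings and a ring homomorphism
  \<open>h : S \<rightarrow> S'\<close> induce on the two sides.\<close>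

definition OZ_base_change_map where
  "OZ_base_change_map T G tp S T' G' tp' S' f g h =
     base_change_map (OZ T G tp) S (OZ T' G' tp') S'
       (O_map \<Z> (zmod T) (zmod G) tp \<Z> (zmod T') (zmod G') tp' (\<lambda>k. k) f g) h"

definition AZ_base_change_map where
  "AZ_base_change_map T G tp S T' G' tp' S' f g h =
     base_change_map (AZ T G tp) S (AZ T' G' tp') S'
       (A_map \<Z> (zmod T) (zmod G) tp \<Z> (zmod T') (zmod G') tp' (\<lambda>k. k) f g) h"

definition OS_map where
  "OS_map T G tp S T' G' tp' S' f g h =
     O_map S (base_change (zmod T) S) (base_change (zmod G) S) (ternary_ext (zmod T) (zmod G) tp S)
       S' (base_change (zmod T') S') (base_change (zmod G') S') (ternary_ext (zmod T') (zmod G') tp' S')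
       h (base_change_map (zmod T) S (zmod T') S' f h) (base_change_map (zmod G) S (zmod G') S' g h)"

definition AS_map where
  "AS_map T G tp S T' G' tp' S' f g h =
     A_map S (base_change (zmod T) S) (base_change (zmod G) S) (ternary_ext (zmod T) (zmod G) tp S)
       S' (base_change (zmod T') S') (base_change (zmod G') S') (ternary_ext (zmod T') (zmod G') tp' S')
       h (base_change_map (zmod T) S (zmod T') S' f h) (base_change_map (zmod G) S (zmod G') S' g h)"

end

theory Submission
  imports Defs
begin

text \<open>
  Everything follows from universal properties. A linear map out of \<open>M \<otimes> S\<close> is the same as an additive
  map out of \<open>M\<close>, so multi-additive maps on \<open>T\<close> and \<open>\<Gamma>\<close> extend to \<open>S\<close>-multilinear maps on \<open>T\<^sub>S\<close>
  and \<open>\<Gamma>\<^sub>S\<close>; a linear map from \<open>O(T, \<Gamma>)\<close> to an algebra \<open>P\<close> is obtained from a 4-linear map that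
  turns the product of generators and the middle relations into identities in \<open>P\<close>, and by
  multilinearity these identities need only be checked on spanning sets. Applied to the 4-linear
  extension of \<open>(a, \<alpha>, b, \<beta>) \<mapsto> [a \<alpha> b \<beta>] \<otimes> 1\<close> this gives a map \<open>O\<^sub>S(T\<^sub>S, \<Gamma>\<^sub>S) \<rightarrow> O(T, \<Gamma>) \<otimes> S\<close>,
  and it is inverse to the comparison map because both composites fix generators. The statement for
  \<open>A\<close> follows by splitting off the unit, and both sides of a naturality square are
  semilinear maps with the same values on generators.
\<close>

section \<open>Semilinear maps and spanning sets\<close>

text \<open>A more direct route would present O(T, \<Gamma>) \<otimes> S as F(T, \<Gamma>) \<otimes>
  S modulo the image of J \<otimes> S and then compare two fourfold tensor products. No such
  presentation is used: tensor products and O are met only through generators and through maps out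
  of them, so neither exactness nor a rebracketing of tensor products is needed, and J is handled
  through kernels that contain the middle relations. What shapes the proof is that products, the
  extended ternary product and all functorial maps are choices, fixed only by multilinearity and by
  values on generators. Each choice needs a witness before it has any property at all, and its
  values are then controlled only on carriers. Existence by a lift and uniqueness on a spanning set
  therefore recur at every level. Semilinearity along a map \<open>h\<close> of scalars treats three
  situations at once: \<open>h\<close> the identity for linear maps, \<open>h\<close> the map \<int>
  \<rightarrow> S for additive maps into S-modules, and \<open>h\<close> a homomorphism S
  \<rightarrow> S' for naturality.\<close>

lemma semilinearI:
  assumes "\<And>x. x \<in> carrier M \<Longrightarrow> f x \<in> carrier N"
    and "\<And>x y. x \<in> carrier M \<Longrightarrow> y \<in> carrier M \<Longrightarrow> f (x \<oplus>\<^bsub>M\<^esub> y) = f x \<oplus>\<^bsub>N\<^esub> f y"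
    and "\<And>r x. r \<in> carrier R \<Longrightarrow> x \<in> carrier M \<Longrightarrow> f (r \<odot>\<^bsub>M\<^esub> x) = h r \<odot>\<^bsub>N\<^esub> f x"
  shows "f \<in> semilinear R h M N"
  using assms unfolding semilinear_def hom_def by auto

lemma semilinear_closed: "f \<in> semilinear R h M N \<Longrightarrow> x \<in> carrier M \<Longrightarrow> f x \<in> carrier N"
  unfolding semilinear_def hom_def by auto

lemma semilinear_add:
  "f \<in> semilinear R h M N \<Longrightarrow> x \<in> carrier M \<Longrightarrow> y \<in> carrier M \<Longrightarrow> f (x \<oplus>\<^bsub>M\<^esub> y) = f x \<oplus>\<^bsub>N\<^esub> f y"
  unfolding semilinear_def hom_def by auto

lemma semilinear_smult:
  "f \<in> semilinear R h M N \<Longrightarrow> r \<in> carrier R \<Longrightarrow> x \<in> carrier M \<Longrightarrow> f (r \<odot>\<^bsub>M\<^esub> x) = h r \<odot>\<^bsub>N\<^esub> f x"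
  unfolding semilinear_def by auto

lemma semilinear_comp:
  assumes "f \<in> semilinear R h M N" "g \<in> semilinear S h' N P" "h ` carrier R \<subseteq> carrier S"
  shows "(\<lambda>x. g (f x)) \<in> semilinear R (\<lambda>r. h' (h r)) M P"
  using assms(3)
  by (intro semilinearI)
    (auto simp: semilinear_closed[OF assms(1)] semilinear_closed[OF assms(2)] semilinear_add[OF assms(1)]
      semilinear_add[OF assms(2)] semilinear_smult[OF assms(1)] image_subset_iff
      intro: semilinear_smult[OF assms(2)])

lemma linear_comp:
  assumes "f \<in> semilinear R h M N" "g \<in> linear_maps S N P" "h ` carrier R \<subseteq> carrier S"
  shows "(\<lambda>x. g (f x)) \<in> semilinear R h M P"
  using semilinear_comp[OF assms] .

lemma semilinear_linear_comp:
  assumes "f \<in> linear_maps R M N" "g \<in> semilinear R h N P"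
  shows "(\<lambda>x. g (f x)) \<in> semilinear R h M P"
  by (rule semilinear_comp[OF assms]) simp

lemma linear_ident: "(\<lambda>x. x) \<in> linear_maps R M M"
  by (rule semilinearI) simp_all

lemma semilinear_zero:
  assumes "f \<in> semilinear R h M N" "abelian_group M" "abelian_group N"
  shows "f \<zero>\<^bsub>M\<^esub> = \<zero>\<^bsub>N\<^esub>"
proof -
  interpret M: abelian_group M by fact
  interpret N: abelian_group N by fact
  have "f \<zero>\<^bsub>M\<^esub> \<oplus>\<^bsub>N\<^esub> f \<zero>\<^bsub>M\<^esub> = f \<zero>\<^bsub>M\<^esub>"
    using semilinear_add[OF assms(1), of "\<zero>\<^bsub>M\<^esub>" "\<zero>\<^bsub>M\<^esub>"] by simp
  moreover have "f \<zero>\<^bsub>M\<^esub> \<in> carrier N" using semilinear_closed[OF assms(1)] by simp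
  ultimately show ?thesis by (simp add: N.add.r_cancel_one)
qed

lemma semilinear_a_inv:
  assumes "f \<in> semilinear R h M N" "abelian_group M" "abelian_group N" "x \<in> carrier M"
  shows "f (\<ominus>\<^bsub>M\<^esub> x) = \<ominus>\<^bsub>N\<^esub> f x"
proof -
  interpret M: abelian_group M by fact
  interpret N: abelian_group N by fact
  have "f (\<ominus>\<^bsub>M\<^esub> x) \<oplus>\<^bsub>N\<^esub> f x = \<zero>\<^bsub>N\<^esub>"
    using semilinear_add[OF assms(1), of "\<ominus>\<^bsub>M\<^esub> x" x] semilinear_zero[OF assms(1-3)] assms(4)
    by (simp add: M.l_neg)
  then show ?thesis
    using semilinear_closed[OF assms(1)] assms(4) by (simp add: N.minus_equality)
qed

lemma semilinear_minus:
  assumes "f \<in> semilinear R h M N" "abelian_group M" "abelian_group N" "x \<in> carrier M" "y \<in> carrier M"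
  shows "f (x \<ominus>\<^bsub>M\<^esub> y) = f x \<ominus>\<^bsub>N\<^esub> f y"
proof -
  interpret M: abelian_group M by fact
  show ?thesis
    unfolding a_minus_def using assms
    by (simp add: semilinear_add[OF assms(1)] semilinear_a_inv[OF assms(1-3)])
qed

text \<open>Chosen maps agree with explicit formulas on the carrier only, so semilinearity has to be
  transported along agreement there.\<close>

lemma semilinear_cong:
  assumes "f \<in> semilinear R h M N" "module R M" "\<And>x. x \<in> carrier M \<Longrightarrow> f x = g x"
  shows "g \<in> semilinear R h M N"
proof -
  interpret module R M by fact
  show ?thesis
    by (rule semilinearI)
      (simp_all add: assms(3)[symmetric] semilinear_closed[OF assms(1)] semilinear_add[OF assms(1)]
        semilinear_smult[OF assms(1)])
qed

text \<open>Serves two purposes. With \<open>H\<close> the zero submodule it makes kernels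
  submodules; with \<open>H\<close> a submodule containing some generators it shows that the
  elements sent into \<open>H\<close> form a submodule, which is how spans are propagated along
  maps.\<close>

lemma submodule_preimage:
  assumes M: "module R M" and N: "module S N" and f: "f \<in> semilinear R h M N"
    and h: "h ` carrier R \<subseteq> carrier S" and H: "submodule H S N"
  shows "submodule {x \<in> carrier M. f x \<in> H} R M"
proof -
  interpret M: module R M by fact
  interpret N: module S N by fact
  note E = N.submoduleE[OF H]
  have z: "\<zero>\<^bsub>N\<^esub> \<in> H"
    using subgroup.one_closed[OF submodule.axioms(1)[OF H]] by simp
  show ?thesis
    by (rule M.submoduleI)
      (use E h in \<open>auto simp: z semilinear_zero[OF f M.abelian_group_axioms N.abelian_group_axioms]
        semilinear_a_inv[OF f M.abelian_group_axioms N.abelian_group_axioms]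
        semilinear_add[OF f] semilinear_smult[OF f]\<close>)
qed

lemma submodule_equalizer:
  assumes M: "module R M" and N: "module S N" and f: "f \<in> semilinear R h M N" "g \<in> semilinear R h M N"
  shows "submodule {x \<in> carrier M. f x = g x} R M"
proof -
  interpret M: module R M by fact
  interpret N: module S N by fact
  note ag = M.abelian_group_axioms N.abelian_group_axioms
  show ?thesis
    by (rule M.submoduleI)
      (auto simp: semilinear_zero[OF f(1) ag] semilinear_zero[OF f(2) ag]
        semilinear_a_inv[OF f(1) ag] semilinear_a_inv[OF f(2) ag]
        semilinear_add[OF f(1)] semilinear_smult[OF f(1)]
        semilinear_add[OF f(2)] semilinear_smult[OF f(2)])
qed

lemma span_of_superset: "X \<subseteq> span_of R M X"
  unfolding span_of_def by auto

lemma span_of_least: "submodule H R M \<Longrightarrow> X \<subseteq> H \<Longrightarrow> span_of R M X \<subseteq> H"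
  unfolding span_of_def by auto

text \<open>The inclusion of \<open>X\<close> in the carrier makes the carrier one of the submodules
  intersected; over an empty family the intersection would be the whole type.\<close>

lemma submodule_span_of:
  assumes "module R M" "X \<subseteq> carrier M"
  shows "submodule (span_of R M X) R M"
proof -
  interpret module R M by fact
  show ?thesis
  proof (rule submoduleI)
    show "span_of R M X \<subseteq> carrier M"
      by (rule span_of_least[OF carrier_is_submodule assms(2)])
  next
    show "\<zero>\<^bsub>M\<^esub> \<in> span_of R M X"
      unfolding span_of_def using subgroup.one_closed[OF submodule.axioms(1)] by fastforce
  qed (auto simp: span_of_def submoduleE)
qed

lemma span_of_carrier: "module R M \<Longrightarrow> span_of R M (carrier M) = carrier M"
  by (simp add: module.carrier_is_submodule span_of_least span_of_superset subset_antisym)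

lemma span_of_carrierI:
  assumes "module R M" "X \<subseteq> carrier M" "\<And>H. submodule H R M \<Longrightarrow> X \<subseteq> H \<Longrightarrow> carrier M \<subseteq> H"
  shows "span_of R M X = carrier M"
  using assms by (meson module.carrier_is_submodule span_of_least span_of_superset submodule_span_of subset_antisym)

lemma span_of_carrierD:
  assumes "span_of R M X = carrier M" "submodule H R M" "X \<subseteq> H" "x \<in> carrier M"
  shows "x \<in> H"
  using span_of_least[OF assms(2,3)] assms by auto

text \<open>The equalizer of two maps along the same \<open>h\<close> is a submodule, hence contains
  whatever is spanned by generators on which they agree. This is the uniqueness half of the
  universal properties below.\<close>

lemma semilinear_eqI:
  assumes "span_of R M X = carrier M" "module R M" "module S N"
    and "f \<in> semilinear R h M N" "g \<in> semilinear R h M N"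
    and "\<And>x. x \<in> X \<Longrightarrow> f x = g x" "x \<in> carrier M"
  shows "f x = g x"
  using span_of_carrierD[OF assms(1) submodule_equalizer[OF assms(2-5)] _ assms(7)] assms(6)
    span_of_superset[of X R M] assms(1) by auto

text \<open>This is how multilinear maps are obtained by extending one variable at a time, without modules of
  homomorphisms: the extension depends linearly on the remaining variables.\<close>

lemma semilinear_param:
  assumes sp: "span_of R M X = carrier M" and M: "module R M" and P: "module R P" and Z: "module R0 Z"
    and h: "h ` carrier R0 \<subseteq> carrier R"
    and k: "\<And>z. z \<in> carrier Z \<Longrightarrow> k z \<in> linear_maps R M P"
    and X: "\<And>x. x \<in> X \<Longrightarrow> (\<lambda>z. k z x) \<in> semilinear R0 h Z P"
    and m: "m \<in> carrier M"
  shows "(\<lambda>z. k z m) \<in> semilinear R0 h Z P"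
proof -
  interpret M: module R M by fact
  interpret P: module R P by fact
  interpret Z: module R0 Z by fact
  note ag = M.abelian_group_axioms P.abelian_group_axioms
  let ?H = "{m \<in> carrier M. (\<lambda>z. k z m) \<in> semilinear R0 h Z P}"
  have hc: "h r \<in> carrier R" if "r \<in> carrier R0" for r using h that by auto
  have kc: "k z x \<in> carrier P" if "z \<in> carrier Z" "x \<in> carrier M" for z x
    using semilinear_closed[OF k] that by auto
  have "submodule ?H R M"
  proof (rule M.submoduleI)
    show "\<zero>\<^bsub>M\<^esub> \<in> ?H"
      by (auto intro!: semilinearI simp: semilinear_zero[OF k ag] hc)
  next
    fix a assume a: "a \<in> ?H"
    then have a': "(\<lambda>z. k z a) \<in> semilinear R0 h Z P" and aM: "a \<in> carrier M" by auto
    show "\<ominus>\<^bsub>M\<^esub> a \<in> ?H"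
      using aM
      by (auto intro!: semilinearI simp: semilinear_a_inv[OF k ag] semilinear_add[OF a'] hc kc
        semilinear_smult[OF a'] P.minus_add P.smult_r_minus)
  next
    fix a b assume a: "a \<in> ?H" and b: "b \<in> ?H"
    then have a': "(\<lambda>z. k z a) \<in> semilinear R0 h Z P" and aM: "a \<in> carrier M"
      and b': "(\<lambda>z. k z b) \<in> semilinear R0 h Z P" and bM: "b \<in> carrier M" by auto
    show "a \<oplus>\<^bsub>M\<^esub> b \<in> ?H"
      using aM bM
      by (auto intro!: semilinearI simp: semilinear_add[OF k] semilinear_add[OF a'] hc kc
        semilinear_smult[OF a'] semilinear_add[OF b'] semilinear_smult[OF b'] P.smult_r_distr P.a_ac)
  next
    \<comment> \<open>Commutativity of \<open>R\<close> enters here: scaling by \<open>r\<close> has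
      to commute with the scalars that come through \<open>h\<close>.\<close>
    fix r a assume r: "r \<in> carrier R" and a: "a \<in> ?H"
    then have a': "(\<lambda>z. k z a) \<in> semilinear R0 h Z P" and aM: "a \<in> carrier M" by auto
    show "r \<odot>\<^bsub>M\<^esub> a \<in> ?H"
      using aM r
      by (auto intro!: semilinearI simp: semilinear_smult[OF k] semilinear_add[OF a'] hc kc
        semilinear_smult[OF a'] P.smult_r_distr P.smult_assoc1[symmetric] M.m_comm)
  qed auto
  moreover have "X \<subseteq> ?H"
    using X sp span_of_superset[of X R M] by auto
  ultimately show ?thesis
    using span_of_carrierD[OF sp _ _ m] by auto
qed

text \<open>By restriction of scalars, universal properties stated for linear maps also provide semilinear maps.\<close>

definition res_scalars :: "('r \<Rightarrow> 's) \<Rightarrow> ('s, 'm) module \<Rightarrow> ('r, 'm) module" where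
  "res_scalars h M = \<lparr>carrier = carrier M, monoid.mult = monoid.mult M, one = one M, zero = zero M,
     add = add M, smult = (\<lambda>r x. h r \<odot>\<^bsub>M\<^esub> x)\<rparr>"

lemma res_scalars_simps [simp]:
  "carrier (res_scalars h M) = carrier M" "monoid.mult (res_scalars h M) = monoid.mult M"
  "one (res_scalars h M) = one M" "zero (res_scalars h M) = zero M" "add (res_scalars h M) = add M"
  "r \<odot>\<^bsub>res_scalars h M\<^esub> x = h r \<odot>\<^bsub>M\<^esub> x"
  by (auto simp: res_scalars_def)

lemma linear_maps_res_scalars [simp]: "linear_maps R M (res_scalars h N) = semilinear R h M N"
  by (auto simp: semilinear_def hom_def)

lemma abelian_group_transfer:
  assumes "abelian_group M" "carrier N = carrier M" "zero N = zero M" "add N = add M"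
  shows "abelian_group N"
proof -
  interpret abelian_group M by fact
  show ?thesis
    by (rule abelian_groupI) (use assms in \<open>auto simp: a_ac intro: l_neg\<close>)
qed

lemma ring_hom_image: "h \<in> ring_hom R S \<Longrightarrow> h ` carrier R \<subseteq> carrier S"
  by (auto simp: ring_hom_def)

lemma module_res_scalars:
  assumes "cring R" "module S M" "h \<in> ring_hom R S"
  shows "module R (res_scalars h M)"
proof -
  interpret module S M by fact
  have "abelian_group (res_scalars h M)"
    by (rule abelian_group_transfer[OF abelian_group_axioms]) auto
  then show ?thesis
    using assms(1) ring_hom_memE[OF assms(3)]
    by (intro moduleI) (auto simp: smult_l_distr smult_r_distr smult_assoc1)
qed

lemma module_cring: "module R M \<Longrightarrow> cring R" and module_abelian_group: "module R M \<Longrightarrow> abelian_group M"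
  by (auto simp: module_def)

section \<open>Quotients of modules and of algebras\<close>

lemma (in abelian_group) a_inv_zero: "\<ominus> \<zero> = \<zero>"
  by (rule minus_equality) auto

lemma (in abelian_group) minus_eq_zero_iff:
  assumes "x \<in> carrier G" "y \<in> carrier G"
  shows "x \<ominus> y = \<zero> \<longleftrightarrow> x = y"
  using assms minus_equality[of x "\<ominus> y"] by (auto simp: a_minus_def r_neg)

lemma submodule_abelian_subgroup:
  assumes "module R M" "submodule I R M"
  shows "abelian_subgroup I M"
  using assms by (intro abelian_subgroupI3 additive_subgroupI)
    (auto simp: submodule_def module_def)

context
  fixes R :: "('r, 'x) ring_scheme" and M :: "('r, 'm) module" and I
  assumes M: "module R M" and I: "submodule I R M"
begin

interpretation M: module R M by (rule M)
interpretation I: abelian_subgroup I M by (rule submodule_abelian_subgroup[OF M I])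

lemma coset_eq_iff:
  assumes "x \<in> carrier M" "y \<in> carrier M"
  shows "I +>\<^bsub>M\<^esub> x = I +>\<^bsub>M\<^esub> y \<longleftrightarrow> x \<ominus>\<^bsub>M\<^esub> y \<in> I"
proof -
  have "I +>\<^bsub>M\<^esub> x = I +>\<^bsub>M\<^esub> y \<longleftrightarrow> x \<in> I +>\<^bsub>M\<^esub> y"
    using I.a_rcos_self[OF assms(1)] M.a_repr_independence[OF _ assms(2) I.a_subgroup, of x] by auto
  also have "\<dots> \<longleftrightarrow> x \<ominus>\<^bsub>M\<^esub> y \<in> I"
    using I.a_rcos_module[OF assms(2,1)] by (simp add: a_minus_def)
  finally show ?thesis .
qed

lemma coset_mem_minus: "x \<in> carrier M \<Longrightarrow> y \<in> I +>\<^bsub>M\<^esub> x \<Longrightarrow> y \<in> carrier M \<and> y \<ominus>\<^bsub>M\<^esub> x \<in> I"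
  using I.a_rcos_module[of x y] I.a_elemrcos_carrier[of x y] by (auto simp: a_minus_def)

lemma quot_carrier: "carrier (quot M I) = (\<lambda>x. I +>\<^bsub>M\<^esub> x) ` carrier M"
  by (auto simp: quot_def A_RCOSETS_def')

lemma quot_zero: "\<zero>\<^bsub>quot M I\<^esub> = I"
  by (simp add: quot_def)

lemma quot_add:
  "x \<in> carrier M \<Longrightarrow> y \<in> carrier M \<Longrightarrow>
    (I +>\<^bsub>M\<^esub> x) \<oplus>\<^bsub>quot M I\<^esub> (I +>\<^bsub>M\<^esub> y) = I +>\<^bsub>M\<^esub> (x \<oplus>\<^bsub>M\<^esub> y)"
  by (simp add: quot_def I.a_rcos_sum)

lemma quot_smult:
  assumes "r \<in> carrier R" "x \<in> carrier M"
  shows "r \<odot>\<^bsub>quot M I\<^esub> (I +>\<^bsub>M\<^esub> x) = I +>\<^bsub>M\<^esub> (r \<odot>\<^bsub>M\<^esub> x)"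
proof -
  \<comment> \<open>Every representative yields the same coset, so the union that defines the scalar
    multiple collapses to one coset.\<close>
  have *: "I +>\<^bsub>M\<^esub> (r \<odot>\<^bsub>M\<^esub> y) = I +>\<^bsub>M\<^esub> (r \<odot>\<^bsub>M\<^esub> x)" if "y \<in> I +>\<^bsub>M\<^esub> x" for y
  proof -
    note y = coset_mem_minus[OF assms(2) that]
    then have "r \<odot>\<^bsub>M\<^esub> (y \<ominus>\<^bsub>M\<^esub> x) \<in> I" using M.submoduleE(4)[OF I] assms by auto
    moreover have "r \<odot>\<^bsub>M\<^esub> (y \<ominus>\<^bsub>M\<^esub> x) = r \<odot>\<^bsub>M\<^esub> y \<ominus>\<^bsub>M\<^esub> r \<odot>\<^bsub>M\<^esub> x"
      using y assms unfolding a_minus_def by (subst M.smult_r_distr) (simp_all add: M.smult_r_minus)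
    ultimately show ?thesis
      using coset_eq_iff[of "r \<odot>\<^bsub>M\<^esub> y" "r \<odot>\<^bsub>M\<^esub> x"] y assms by auto
  qed
  have "x \<in> I +>\<^bsub>M\<^esub> x" using I.a_rcos_self assms by auto
  then show ?thesis unfolding quot_def module.simps by (rule UN_constant_eq) (intro ballI *)
qed

lemma module_quot: "module R (quot M I)"
proof -
  have "abelian_group (quot M I)"
  proof (rule abelian_groupI)
    fix x assume "x \<in> carrier (quot M I)"
    then obtain a where a: "a \<in> carrier M" "x = I +>\<^bsub>M\<^esub> a" by (auto simp: quot_carrier)
    then have "(I +>\<^bsub>M\<^esub> (\<ominus>\<^bsub>M\<^esub> a)) \<oplus>\<^bsub>quot M I\<^esub> x = \<zero>\<^bsub>quot M I\<^esub>"
      by (simp add: quot_add M.l_neg quot_zero I.a_subset)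
    then show "\<exists>y\<in>carrier (quot M I). y \<oplus>\<^bsub>quot M I\<^esub> x = \<zero>\<^bsub>quot M I\<^esub>"
      using a by (auto simp: quot_carrier)
  next
    fix x assume "x \<in> carrier (quot M I)"
    then obtain a where a: "a \<in> carrier M" "x = I +>\<^bsub>M\<^esub> a" by (auto simp: quot_carrier)
    then show "\<zero>\<^bsub>quot M I\<^esub> \<oplus>\<^bsub>quot M I\<^esub> x = x"
      using quot_add[OF M.zero_closed a(1)] by (simp add: quot_zero I.a_subset)
  next
    show "\<zero>\<^bsub>quot M I\<^esub> \<in> carrier (quot M I)"
      using M.a_coset_add_zero[OF I.a_subset] by (auto simp: quot_carrier quot_zero)
  qed (auto simp: quot_carrier quot_add M.a_ac)
  then show ?thesis
    by (intro moduleI)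
      (auto simp: quot_carrier quot_add quot_smult M.smult_l_distr M.smult_r_distr M.smult_assoc1 M.R.cring_axioms)
qed

lemma quot_proj_linear: "(\<lambda>x. I +>\<^bsub>M\<^esub> x) \<in> linear_maps R M (quot M I)"
  by (rule semilinearI) (auto simp: quot_carrier quot_add quot_smult)

lemma quot_lift:
  assumes P: "module R P" and k: "k \<in> linear_maps R M P" and z: "\<And>x. x \<in> I \<Longrightarrow> k x = \<zero>\<^bsub>P\<^esub>"
  obtains k' where "k' \<in> linear_maps R (quot M I) P" "\<And>x. x \<in> carrier M \<Longrightarrow> k' (I +>\<^bsub>M\<^esub> x) = k x"
proof -
  interpret P: module R P by (rule P)
  \<comment> \<open>Any representative will do: two of them differ by an element of
    \<open>I\<close>, where \<open>k\<close> vanishes.\<close>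
  define k' where "k' X = k (SOME x. x \<in> carrier M \<and> X = I +>\<^bsub>M\<^esub> x)" for X
  have k': "k' (I +>\<^bsub>M\<^esub> x) = k x" if x: "x \<in> carrier M" for x
  proof -
    let ?y = "SOME y. y \<in> carrier M \<and> I +>\<^bsub>M\<^esub> x = I +>\<^bsub>M\<^esub> y"
    have y: "?y \<in> carrier M \<and> I +>\<^bsub>M\<^esub> x = I +>\<^bsub>M\<^esub> ?y"
      by (rule someI[of _ x]) (simp add: x)
    then have "x \<ominus>\<^bsub>M\<^esub> ?y \<in> I" using coset_eq_iff x by auto
    then have "k x \<ominus>\<^bsub>P\<^esub> k ?y = \<zero>\<^bsub>P\<^esub>"
      using z y x semilinear_minus[OF k M.abelian_group_axioms P.abelian_group_axioms, of x ?y] by auto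
    then have "k x = k ?y"
      using semilinear_closed[OF k] x y P.minus_eq_zero_iff by blast
    then show ?thesis unfolding k'_def by simp
  qed
  have "k' \<in> linear_maps R (quot M I) P"
    by (rule semilinearI)
      (auto simp: quot_carrier quot_add quot_smult k' semilinear_closed[OF k] semilinear_add[OF k]
        semilinear_smult[OF k])
  then show ?thesis using that k' by blast
qed

lemma span_of_quot:
  assumes "span_of R M X = carrier M"
  shows "span_of R (quot M I) ((\<lambda>x. I +>\<^bsub>M\<^esub> x) ` X) = carrier (quot M I)"
proof (rule span_of_carrierI[OF module_quot])
  have XM: "X \<subseteq> carrier M" using span_of_superset[of X R M] assms by simp
  then show "(\<lambda>x. I +>\<^bsub>M\<^esub> x) ` X \<subseteq> carrier (quot M I)" by (auto simp: quot_carrier)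
  fix H assume H: "submodule H R (quot M I)" "(\<lambda>x. I +>\<^bsub>M\<^esub> x) ` X \<subseteq> H"
  have "submodule {x \<in> carrier M. I +>\<^bsub>M\<^esub> x \<in> H} R M"
    by (rule submodule_preimage[OF M module_quot quot_proj_linear _ H(1)]) auto
  moreover have "X \<subseteq> {x \<in> carrier M. I +>\<^bsub>M\<^esub> x \<in> H}" using XM H(2) by auto
  ultimately show "carrier (quot M I) \<subseteq> H"
    using span_of_carrierD[OF assms] by (auto simp: quot_carrier)
qed

end

section \<open>Bilinear maps, S-rngs and their quotients by two-sided ideals\<close>

lemma bilinear_mapI:
  assumes "\<And>x. x \<in> carrier M \<Longrightarrow> b x \<in> linear_maps R N P"
    and "\<And>y. y \<in> carrier N \<Longrightarrow> (\<lambda>x. b x y) \<in> linear_maps R M P"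
  shows "bilinear_map R M N P b"
  using assms by (auto simp: bilinear_map_def)

lemma bilinear_mapD:
  assumes "bilinear_map R M N P b"
  shows "x \<in> carrier M \<Longrightarrow> b x \<in> linear_maps R N P"
    and "y \<in> carrier N \<Longrightarrow> (\<lambda>x. b x y) \<in> linear_maps R M P"
  using assms by (auto simp: bilinear_map_def)

lemma S_rngI:
  assumes "module R A" "bilinear_map R A A A (monoid.mult A)"
    and "\<And>x y z. x \<in> carrier A \<Longrightarrow> y \<in> carrier A \<Longrightarrow> z \<in> carrier A \<Longrightarrow>
      (x \<otimes>\<^bsub>A\<^esub> y) \<otimes>\<^bsub>A\<^esub> z = x \<otimes>\<^bsub>A\<^esub> (y \<otimes>\<^bsub>A\<^esub> z)"
  shows "S_rng R A"
  using assms by (simp add: S_rng_def S_rng_axioms_def)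

lemma S_rng_module: "S_rng R A \<Longrightarrow> module R A"
  by (simp add: S_rng_def)

context S_rng
begin

lemma rng_m_closed [simp, intro]: "x \<in> carrier A \<Longrightarrow> y \<in> carrier A \<Longrightarrow> x \<otimes> y \<in> carrier A"
  using bilinear_mapD(1)[OF bilinear_mult] semilinear_closed by fastforce

lemma rng_l_distr:
  "x \<in> carrier A \<Longrightarrow> y \<in> carrier A \<Longrightarrow> z \<in> carrier A \<Longrightarrow> (x \<oplus> y) \<otimes> z = x \<otimes> z \<oplus> y \<otimes> z"
  using semilinear_add[OF bilinear_mapD(2)[OF bilinear_mult, of z]] by auto

lemma rng_r_distr:
  "x \<in> carrier A \<Longrightarrow> y \<in> carrier A \<Longrightarrow> z \<in> carrier A \<Longrightarrow> z \<otimes> (x \<oplus> y) = z \<otimes> x \<oplus> z \<otimes> y"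
  using semilinear_add[OF bilinear_mapD(1)[OF bilinear_mult, of z]] by auto

lemma rng_smult_l:
  "r \<in> carrier R \<Longrightarrow> x \<in> carrier A \<Longrightarrow> y \<in> carrier A \<Longrightarrow> (r \<odot> x) \<otimes> y = r \<odot> (x \<otimes> y)"
  using semilinear_smult[OF bilinear_mapD(2)[OF bilinear_mult, of y]] by auto

lemma rng_smult_r:
  "r \<in> carrier R \<Longrightarrow> x \<in> carrier A \<Longrightarrow> y \<in> carrier A \<Longrightarrow> x \<otimes> (r \<odot> y) = r \<odot> (x \<otimes> y)"
  using semilinear_smult[OF bilinear_mapD(1)[OF bilinear_mult, of x]] by auto

lemma rng_l_null: "x \<in> carrier A \<Longrightarrow> \<zero>\<^bsub>A\<^esub> \<otimes> x = \<zero>\<^bsub>A\<^esub>"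
  using semilinear_zero[OF bilinear_mapD(2)[OF bilinear_mult], of x] abelian_group_axioms by simp

lemma rng_r_null: "x \<in> carrier A \<Longrightarrow> x \<otimes> \<zero>\<^bsub>A\<^esub> = \<zero>\<^bsub>A\<^esub>"
  using semilinear_zero[OF bilinear_mapD(1)[OF bilinear_mult], of x] abelian_group_axioms by simp

lemma rng_minus_l:
  "x \<in> carrier A \<Longrightarrow> y \<in> carrier A \<Longrightarrow> z \<in> carrier A \<Longrightarrow>
    (x \<ominus>\<^bsub>A\<^esub> y) \<otimes> z = x \<otimes> z \<ominus>\<^bsub>A\<^esub> y \<otimes> z"
  using semilinear_minus[OF bilinear_mapD(2)[OF bilinear_mult]] abelian_group_axioms by simp

lemma rng_minus_r:
  "x \<in> carrier A \<Longrightarrow> y \<in> carrier A \<Longrightarrow> z \<in> carrier A \<Longrightarrow>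
    z \<otimes> (x \<ominus>\<^bsub>A\<^esub> y) = z \<otimes> x \<ominus>\<^bsub>A\<^esub> z \<otimes> y"
  using semilinear_minus[OF bilinear_mapD(1)[OF bilinear_mult]] abelian_group_axioms by simp

lemma ideal_gen_by_ideal:
  assumes "X \<subseteq> carrier A"
  shows "two_sided_ideal R A (ideal_gen_by R A X)"
proof -
  have top: "two_sided_ideal R A (carrier A)"
    by (auto simp: two_sided_ideal_def carrier_is_submodule)
  have "submodule (ideal_gen_by R A X) R A"
  proof (rule submoduleI)
    show "ideal_gen_by R A X \<subseteq> carrier A"
      using top assms by (auto simp: ideal_gen_by_def)
  next
    show "\<zero>\<^bsub>A\<^esub> \<in> ideal_gen_by R A X"
      unfolding ideal_gen_by_def two_sided_ideal_def
      using subgroup.one_closed[OF submodule.axioms(1)] by fastforce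
  qed (auto simp: ideal_gen_by_def two_sided_ideal_def submoduleE)
  then show ?thesis
    by (auto simp: two_sided_ideal_def ideal_gen_by_def)
qed

lemma quot_mult:
  assumes I: "two_sided_ideal R A I" and x: "x \<in> carrier A" and y: "y \<in> carrier A"
  shows "(I +>\<^bsub>A\<^esub> x) \<otimes>\<^bsub>quot A I\<^esub> (I +>\<^bsub>A\<^esub> y) = I +>\<^bsub>A\<^esub> (x \<otimes> y)"
proof -
  have sub: "submodule I R A" using I by (simp add: two_sided_ideal_def)
  interpret I: abelian_subgroup I A by (rule submodule_abelian_subgroup[OF module_axioms sub])
  have *: "I +>\<^bsub>A\<^esub> (a \<otimes> b) = I +>\<^bsub>A\<^esub> (x \<otimes> y)" if a: "a \<in> I +>\<^bsub>A\<^esub> x" and b: "b \<in> I +>\<^bsub>A\<^esub> y" for a b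
  proof -
    note a = coset_mem_minus[OF module_axioms sub x a] and b = coset_mem_minus[OF module_axioms sub y b]
    \<comment> \<open>The factors are changed one at a time: a b - x b = (a - x) b and x b - x y = x
      (b - y), and each difference lies in the ideal.\<close>
    have "(a \<ominus>\<^bsub>A\<^esub> x) \<otimes> b \<in> I" "x \<otimes> (b \<ominus>\<^bsub>A\<^esub> y) \<in> I"
      using I a b x by (auto simp: two_sided_ideal_def)
    then have "I +>\<^bsub>A\<^esub> (a \<otimes> b) = I +>\<^bsub>A\<^esub> (x \<otimes> b)" "I +>\<^bsub>A\<^esub> (x \<otimes> b) = I +>\<^bsub>A\<^esub> (x \<otimes> y)"
      using a b x y rng_minus_l[of a x b] rng_minus_r[of b y x]
        coset_eq_iff[OF module_axioms sub, of "a \<otimes> b" "x \<otimes> b"]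
        coset_eq_iff[OF module_axioms sub, of "x \<otimes> b" "x \<otimes> y"] by auto
    then show ?thesis by simp
  qed
  have xy: "x \<in> I +>\<^bsub>A\<^esub> x" "y \<in> I +>\<^bsub>A\<^esub> y" using I.a_rcos_self x y by auto
  show ?thesis
    unfolding quot_def rcoset_mult_def monoid.simps ring.simps by (intro UN_constant_eq[OF xy(1)] UN_constant_eq[OF xy(2)] ballI *)
qed

lemma S_rng_quot:
  assumes I: "two_sided_ideal R A I"
  shows "S_rng R (quot A I)"
proof -
  have sub: "submodule I R A" using I by (simp add: two_sided_ideal_def)
  note s = quot_carrier[OF module_axioms sub] quot_add[OF module_axioms sub] quot_smult[OF module_axioms sub]
    quot_mult[OF I]
  show ?thesis
    by (intro S_rngI bilinear_mapI semilinearI module_quot[OF module_axioms sub])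
      (auto simp: s rng_l_distr rng_r_distr rng_smult_l rng_smult_r mult_assoc)
qed

end

lemma S_rng_res_scalars:
  assumes "cring R" "S_rng S A" "h \<in> ring_hom R S"
  shows "S_rng R (res_scalars h A)"
proof -
  interpret S_rng S A by fact
  have h: "h r \<in> carrier S" if "r \<in> carrier R" for r using ring_hom_image[OF assms(3)] that by auto
  show ?thesis
    by (intro S_rngI bilinear_mapI semilinearI module_res_scalars[OF assms(1) module_axioms assms(3)])
      (auto simp: rng_l_distr rng_r_distr rng_smult_l rng_smult_r mult_assoc h)
qed

section \<open>Free modules and tensor products\<close>

lemma free_module_simps [simp]:
  "\<zero>\<^bsub>free_module R B\<^esub> = (\<lambda>b. \<zero>\<^bsub>R\<^esub>)"
  "p \<oplus>\<^bsub>free_module R B\<^esub> q = (\<lambda>b. p b \<oplus>\<^bsub>R\<^esub> q b)"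
  "r \<odot>\<^bsub>free_module R B\<^esub> p = (\<lambda>b. r \<otimes>\<^bsub>R\<^esub> p b)"
  by (auto simp: free_module_def)

lemma free_module_carrier:
  "p \<in> carrier (free_module R B) \<longleftrightarrow>
    (\<forall>b\<in>B. p b \<in> carrier R) \<and> (\<forall>b. b \<notin> B \<longrightarrow> p b = \<zero>\<^bsub>R\<^esub>) \<and> finite {b \<in> B. p b \<noteq> \<zero>\<^bsub>R\<^esub>}"
  by (auto simp: free_module_def)

context cring
begin

lemma free_module_closed: "p \<in> carrier (free_module R B) \<Longrightarrow> p b \<in> carrier R"
  by (cases "b \<in> B") (auto simp: free_module_carrier)

lemma free_module_module: "module R (free_module R B)"
proof -
  let ?F = "free_module R B"
  have add: "(\<lambda>b. p b \<oplus> q b) \<in> carrier ?F" if "p \<in> carrier ?F" "q \<in> carrier ?F" for p q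
  proof -
    have "{b \<in> B. p b \<oplus> q b \<noteq> \<zero>} \<subseteq> {b \<in> B. p b \<noteq> \<zero>} \<union> {b \<in> B. q b \<noteq> \<zero>}" by auto
    then show ?thesis
      using that finite_subset[of "{b \<in> B. p b \<oplus> q b \<noteq> \<zero>}"] by (auto simp: free_module_carrier)
  qed
  have smult: "(\<lambda>b. r \<otimes> p b) \<in> carrier ?F" if "r \<in> carrier R" "p \<in> carrier ?F" for r p
  proof -
    have "{b \<in> B. r \<otimes> p b \<noteq> \<zero>} \<subseteq> {b \<in> B. p b \<noteq> \<zero>}" using that by auto
    then show ?thesis
      using that finite_subset[of "{b \<in> B. r \<otimes> p b \<noteq> \<zero>}"] by (auto simp: free_module_carrier)
  qed
  note c = free_module_closed
  have "abelian_group ?F"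
  proof (rule abelian_groupI)
    fix p assume p: "p \<in> carrier ?F"
    have "{b \<in> B. \<ominus> p b \<noteq> \<zero>} \<subseteq> {b \<in> B. p b \<noteq> \<zero>}" by auto
    then have "(\<lambda>b. \<ominus> p b) \<in> carrier ?F"
      using p finite_subset[of "{b \<in> B. \<ominus> p b \<noteq> \<zero>}"] by (auto simp: free_module_carrier)
    then show "\<exists>q\<in>carrier ?F. q \<oplus>\<^bsub>?F\<^esub> p = \<zero>\<^bsub>?F\<^esub>"
      by (rule bexI[rotated]) (simp add: c[OF p] l_neg)
  next
    show "\<zero>\<^bsub>?F\<^esub> \<in> carrier ?F" by (simp add: free_module_carrier)
  qed (auto simp: add a_ac c)
  then show ?thesis
    by (intro moduleI is_cring) (auto simp: smult c l_distr r_distr m_assoc)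
qed

lemma basis_elem_closed: "b \<in> B \<Longrightarrow> basis_elem R b \<in> carrier (free_module R B)"
  by (auto simp: free_module_carrier basis_elem_def)

lemma span_of_basis_elems: "span_of R (free_module R B) (basis_elem R ` B) = carrier (free_module R B)"
proof (rule span_of_carrierI[OF free_module_module])
  let ?F = "free_module R B"
  interpret F: module R ?F by (rule free_module_module)
  show "basis_elem R ` B \<subseteq> carrier ?F" using basis_elem_closed by auto
  fix H assume H: "submodule H R ?F" "basis_elem R ` B \<subseteq> H"
  have zero: "(\<lambda>b. \<zero>) \<in> H" using subgroup.one_closed[OF submodule.axioms(1)[OF H(1)]] by simp
  \<comment> \<open>\<open>E\<close> need only contain the support of \<open>p\<close>, so the
    induction may delete any point of \<open>E\<close>: inside \<open>B\<close> a multiple of a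
    basis element is split off, outside \<open>B\<close> nothing changes.\<close>
  have "p \<in> H" if "finite E" "p \<in> carrier ?F" "{b \<in> B. p b \<noteq> \<zero>} \<subseteq> E" for p E
    using that
  proof (induction E arbitrary: p rule: finite_induct)
    case empty
    then have "p = (\<lambda>b. \<zero>)" by (auto simp: free_module_carrier)
    then show ?case using zero by simp
  next
    case (insert a E)
    let ?q = "p(a := \<zero>)"
    have "{b \<in> B. ?q b \<noteq> \<zero>} \<subseteq> {b \<in> B. p b \<noteq> \<zero>}" by auto
    then have q: "?q \<in> carrier ?F"
      using insert.prems finite_subset[of "{b \<in> B. ?q b \<noteq> \<zero>}"] by (auto simp: free_module_carrier)
    have "{b \<in> B. ?q b \<noteq> \<zero>} \<subseteq> E" using insert.prems by auto
    then have qH: "?q \<in> H" by (rule insert.IH[OF q])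
    show ?case
    proof (cases "a \<in> B")
      case True
      have "p = ?q \<oplus>\<^bsub>?F\<^esub> p a \<odot>\<^bsub>?F\<^esub> basis_elem R a"
        using free_module_closed[OF insert.prems(1)] by (auto simp: basis_elem_def)
      moreover have "p a \<odot>\<^bsub>?F\<^esub> basis_elem R a \<in> H"
        using H True free_module_closed[OF insert.prems(1)] F.submoduleE(4)[OF H(1)] by blast
      ultimately show ?thesis using F.submoduleE(5)[OF H(1) qH] by metis
    next
      case False
      then have "?q = p" using insert.prems by (auto simp: free_module_carrier)
      then show ?thesis using qH by simp
    qed
  qed
  then show "carrier ?F \<subseteq> H" by (auto simp: free_module_carrier)
qed

lemma free_module_lift:
  assumes P: "module R P" and \<phi>: "\<And>b. b \<in> B \<Longrightarrow> \<phi> b \<in> carrier P"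
  obtains k where "k \<in> linear_maps R (free_module R B) P" "\<And>b. b \<in> B \<Longrightarrow> k (basis_elem R b) = \<phi> b"
proof -
  let ?F = "free_module R B"
  interpret P: module R P by (rule P)
  let ?s = "\<lambda>p. {b \<in> B. p b \<noteq> \<zero>}"
  define k where "k p = (\<Oplus>\<^bsub>P\<^esub>b\<in>?s p. p b \<odot>\<^bsub>P\<^esub> \<phi> b)" for p
  note c = free_module_closed
  \<comment> \<open>The support varies with \<open>p\<close>, while additivity compares sums over
    one index set. Enlarging the index set only adds terms with coefficient zero.\<close>
  have k: "k p = (\<Oplus>\<^bsub>P\<^esub>b\<in>E. p b \<odot>\<^bsub>P\<^esub> \<phi> b)" if "p \<in> carrier ?F" "finite E" "?s p \<subseteq> E" "E \<subseteq> B" for p E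
    unfolding k_def
    by (rule P.add.finprod_mono_neutral_cong_left) (use that(2-) \<phi> c[OF that(1)] in \<open>auto intro!: P.smult_closed\<close>)
  have kc: "k p \<in> carrier P" if "p \<in> carrier ?F" for p
    unfolding k_def by (rule P.finsum_closed) (use \<phi> c[OF that] in auto)
  interpret F: module R ?F by (rule free_module_module)
  have fin: "finite (?s p)" if "p \<in> carrier ?F" for p using that by (auto simp: free_module_carrier)
  have "k \<in> linear_maps R ?F P"
  proof (rule semilinearI)
    fix p q assume p: "p \<in> carrier ?F" and q: "q \<in> carrier ?F"
    let ?E = "?s p \<union> ?s q"
    have E: "finite ?E" "?E \<subseteq> B" using fin p q by auto
    have "k (p \<oplus>\<^bsub>?F\<^esub> q) = (\<Oplus>\<^bsub>P\<^esub>b\<in>?E. (p b \<oplus> q b) \<odot>\<^bsub>P\<^esub> \<phi> b)"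
      using k[OF F.a_closed[OF p q] E(1) _ E(2)] c p q by fastforce
    also have "\<dots> = (\<Oplus>\<^bsub>P\<^esub>b\<in>?E. p b \<odot>\<^bsub>P\<^esub> \<phi> b \<oplus>\<^bsub>P\<^esub> q b \<odot>\<^bsub>P\<^esub> \<phi> b)"
      by (rule P.finsum_cong') (use c[OF p] c[OF q] \<phi> in \<open>auto simp: P.smult_l_distr\<close>)
    also have "\<dots> = k p \<oplus>\<^bsub>P\<^esub> k q"
      unfolding k[OF p E(1) Un_upper1 E(2)] k[OF q E(1) Un_upper2 E(2)]
      by (rule P.finsum_addf) (use c[OF p] c[OF q] \<phi> in auto)
    finally show "k (p \<oplus>\<^bsub>?F\<^esub> q) = k p \<oplus>\<^bsub>P\<^esub> k q" .
  next
    fix r p assume r: "r \<in> carrier R" and p: "p \<in> carrier ?F"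
    have "k (r \<odot>\<^bsub>?F\<^esub> p) = (\<Oplus>\<^bsub>P\<^esub>b\<in>?s p. (r \<otimes> p b) \<odot>\<^bsub>P\<^esub> \<phi> b)"
      using k[OF F.smult_closed[OF r p] fin[OF p]] r by fastforce
    also have "\<dots> = (\<Oplus>\<^bsub>P\<^esub>b\<in>?s p. r \<odot>\<^bsub>P\<^esub> (p b \<odot>\<^bsub>P\<^esub> \<phi> b))"
      by (rule P.finsum_cong') (use c[OF p] r \<phi> in \<open>auto simp: P.smult_assoc1\<close>)
    also have "\<dots> = r \<odot>\<^bsub>P\<^esub> k p"
      unfolding k_def by (rule P.finsum_smult_ldistr[symmetric]) (use c[OF p] r \<phi> fin[OF p] in auto)
    finally show "k (r \<odot>\<^bsub>?F\<^esub> p) = r \<odot>\<^bsub>P\<^esub> k p" .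
  qed (rule kc)
  moreover have "k (basis_elem R b) = \<phi> b" if b: "b \<in> B" for b
  proof -
    have "k (basis_elem R b) = (\<Oplus>\<^bsub>P\<^esub>b'\<in>{b}. basis_elem R b b' \<odot>\<^bsub>P\<^esub> \<phi> b')"
      by (rule k[OF basis_elem_closed[OF b]]) (use b in \<open>auto simp: basis_elem_def\<close>)
    also have "\<dots> = \<phi> b"
      using \<phi>[OF b] by (simp add: basis_elem_def)
    finally show ?thesis .
  qed
  ultimately show ?thesis using that by blast
qed

end

context
  fixes R :: "('r, 'x) ring_scheme" and M :: "('r, 'm) module" and N :: "('r, 'n) module"
  assumes M: "module R M" and N: "module R N"
begin

interpretation M: module R M by (rule M)
interpretation N: module R N by (rule N)

private abbreviation (input) "L \<equiv> free_module R (carrier M \<times> carrier N)"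

interpretation L: module R L by (rule M.free_module_module)

lemma tensor_relations_closed: "tensor_relations R M N \<subseteq> carrier L"
  unfolding tensor_relations_def Let_def
  by (intro Un_least subsetI; elim CollectE exE conjE; hypsubst)
    (intro L.minus_closed L.a_closed L.smult_closed M.basis_elem_closed; simp)+

lemma tensor_kernel_submodule: "submodule (tensor_kernel R M N) R L"
  unfolding tensor_kernel_def by (rule submodule_span_of[OF L.module_axioms tensor_relations_closed])

lemma module_tensor: "module R (tensor R M N)"
  unfolding tensor_def by (rule module_quot[OF L.module_axioms tensor_kernel_submodule])

lemma tens_closed: "x \<in> carrier M \<Longrightarrow> y \<in> carrier N \<Longrightarrow> tens R M N x y \<in> carrier (tensor R M N)"
  unfolding tensor_def tens_def quot_carrier[OF L.module_axioms tensor_kernel_submodule]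
  by (auto intro: M.basis_elem_closed)

lemma tensor_relation_zero:
  assumes "u \<in> carrier L" "v \<in> carrier L" "u \<ominus>\<^bsub>L\<^esub> v \<in> tensor_relations R M N"
  shows "tensor_kernel R M N +>\<^bsub>L\<^esub> u = tensor_kernel R M N +>\<^bsub>L\<^esub> v"
  using coset_eq_iff[OF L.module_axioms tensor_kernel_submodule assms(1,2)] assms(3)
    span_of_superset[of "tensor_relations R M N" R L] by (auto simp: tensor_kernel_def)

lemma tens_bilinear: "bilinear_map R M N (tensor R M N) (tens R M N)"
proof -
  note p = quot_add[OF L.module_axioms tensor_kernel_submodule, folded tensor_def, symmetric]
    quot_smult[OF L.module_axioms tensor_kernel_submodule, folded tensor_def, symmetric]
  let ?e = "\<lambda>x y. basis_elem R (x, y)"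
  note e = M.basis_elem_closed
  have 1: "tens R M N (x \<oplus>\<^bsub>M\<^esub> x') y = tens R M N x y \<oplus>\<^bsub>tensor R M N\<^esub> tens R M N x' y"
    if "x \<in> carrier M" "x' \<in> carrier M" "y \<in> carrier N" for x x' y
  proof -
    have "?e (x \<oplus>\<^bsub>M\<^esub> x') y \<ominus>\<^bsub>L\<^esub> (?e x y \<oplus>\<^bsub>L\<^esub> ?e x' y) \<in> tensor_relations R M N"
      unfolding tensor_relations_def Let_def using that by blast
    then have "tens R M N (x \<oplus>\<^bsub>M\<^esub> x') y = tensor_kernel R M N +>\<^bsub>L\<^esub> (?e x y \<oplus>\<^bsub>L\<^esub> ?e x' y)"
      unfolding tens_def by (intro tensor_relation_zero L.a_closed e) (use that in auto)
    then show ?thesis unfolding tens_def using that by (simp only: p e SigmaI)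
  qed
  have 2: "tens R M N x (y \<oplus>\<^bsub>N\<^esub> y') = tens R M N x y \<oplus>\<^bsub>tensor R M N\<^esub> tens R M N x y'"
    if "x \<in> carrier M" "y \<in> carrier N" "y' \<in> carrier N" for x y y'
  proof -
    have "?e x (y \<oplus>\<^bsub>N\<^esub> y') \<ominus>\<^bsub>L\<^esub> (?e x y \<oplus>\<^bsub>L\<^esub> ?e x y') \<in> tensor_relations R M N"
      unfolding tensor_relations_def Let_def using that by blast
    then have "tens R M N x (y \<oplus>\<^bsub>N\<^esub> y') = tensor_kernel R M N +>\<^bsub>L\<^esub> (?e x y \<oplus>\<^bsub>L\<^esub> ?e x y')"
      unfolding tens_def by (intro tensor_relation_zero L.a_closed e) (use that in auto)
    then show ?thesis unfolding tens_def using that by (simp only: p e SigmaI)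
  qed
  have 3: "tens R M N (r \<odot>\<^bsub>M\<^esub> x) y = r \<odot>\<^bsub>tensor R M N\<^esub> tens R M N x y"
    if "x \<in> carrier M" "r \<in> carrier R" "y \<in> carrier N" for x r y
  proof -
    have "?e (r \<odot>\<^bsub>M\<^esub> x) y \<ominus>\<^bsub>L\<^esub> (r \<odot>\<^bsub>L\<^esub> ?e x y) \<in> tensor_relations R M N"
      unfolding tensor_relations_def Let_def using that by blast
    then have "tens R M N (r \<odot>\<^bsub>M\<^esub> x) y = tensor_kernel R M N +>\<^bsub>L\<^esub> (r \<odot>\<^bsub>L\<^esub> ?e x y)"
      unfolding tens_def by (intro tensor_relation_zero L.smult_closed e) (use that in auto)
    then show ?thesis unfolding tens_def using that by (simp only: p e SigmaI)
  qed
  have 4: "tens R M N x (r \<odot>\<^bsub>N\<^esub> y) = r \<odot>\<^bsub>tensor R M N\<^esub> tens R M N x y"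
    if "x \<in> carrier M" "r \<in> carrier R" "y \<in> carrier N" for x r y
  proof -
    have "?e x (r \<odot>\<^bsub>N\<^esub> y) \<ominus>\<^bsub>L\<^esub> (r \<odot>\<^bsub>L\<^esub> ?e x y) \<in> tensor_relations R M N"
      unfolding tensor_relations_def Let_def using that by blast
    then have "tens R M N x (r \<odot>\<^bsub>N\<^esub> y) = tensor_kernel R M N +>\<^bsub>L\<^esub> (r \<odot>\<^bsub>L\<^esub> ?e x y)"
      unfolding tens_def by (intro tensor_relation_zero L.smult_closed e) (use that in auto)
    then show ?thesis unfolding tens_def using that by (simp only: p e SigmaI)
  qed
  show ?thesis
    by (intro bilinear_mapI semilinearI tens_closed 1 2 3 4)
qed

lemma tens_linear_left: "y \<in> carrier N \<Longrightarrow> (\<lambda>x. tens R M N x y) \<in> linear_maps R M (tensor R M N)"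
  and tens_linear_right: "x \<in> carrier M \<Longrightarrow> tens R M N x \<in> linear_maps R N (tensor R M N)"
  using tens_bilinear by (auto simp: bilinear_map_def)

text \<open>One factor is extended at a time. For fixed \<open>x\<close> in \<open>X\<close> the
  elements \<open>y\<close> whose tensor with \<open>x\<close> lies in \<open>H\<close> form a
  submodule containing \<open>Y\<close>; then the same argument runs in the first factor with
  \<open>y\<close> arbitrary.\<close>

lemma span_of_tens:
  assumes X: "span_of R M X = carrier M" and Y: "span_of R N Y = carrier N"
  shows "span_of R (tensor R M N) {tens R M N x y | x y. x \<in> X \<and> y \<in> Y} = carrier (tensor R M N)"
proof (rule span_of_carrierI[OF module_tensor])
  have XM: "X \<subseteq> carrier M" using span_of_superset[of X R M] X by simp
  have YN: "Y \<subseteq> carrier N" using span_of_superset[of Y R N] Y by simp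
  show "{tens R M N x y | x y. x \<in> X \<and> y \<in> Y} \<subseteq> carrier (tensor R M N)"
    using XM YN tens_closed by auto
  fix H assume H: "submodule H R (tensor R M N)" "{tens R M N x y | x y. x \<in> X \<and> y \<in> Y} \<subseteq> H"
  have 1: "tens R M N x y \<in> H" if x: "x \<in> X" and y: "y \<in> carrier N" for x y
  proof -
    have "submodule {y \<in> carrier N. tens R M N x y \<in> H} R N"
      by (rule submodule_preimage[OF N module_tensor tens_linear_right _ H(1)]) (use x XM in auto)
    moreover have "Y \<subseteq> {y \<in> carrier N. tens R M N x y \<in> H}" using YN H(2) x by auto
    ultimately show ?thesis using span_of_carrierD[OF Y _ _ y] by auto
  qed
  have 2: "tens R M N x y \<in> H" if x: "x \<in> carrier M" and y: "y \<in> carrier N" for x y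
  proof -
    have "submodule {x \<in> carrier M. tens R M N x y \<in> H} R M"
      by (rule submodule_preimage[OF M module_tensor tens_linear_left _ H(1)]) (use y in auto)
    moreover have "X \<subseteq> {x \<in> carrier M. tens R M N x y \<in> H}" using XM 1 y by auto
    ultimately show ?thesis using span_of_carrierD[OF X _ _ x] by auto
  qed
  \<comment> \<open>The cosets of the basis elements are the pure tensors, and they span because the
    basis spans the free module.\<close>
  have "(\<lambda>x. tensor_kernel R M N +>\<^bsub>L\<^esub> x) ` (basis_elem R ` (carrier M \<times> carrier N)) \<subseteq> H"
    using 2 by (auto simp: tens_def)
  then have "span_of R (tensor R M N)
      ((\<lambda>x. tensor_kernel R M N +>\<^bsub>L\<^esub> x) ` (basis_elem R ` (carrier M \<times> carrier N))) \<subseteq> H"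
    by (rule span_of_least[OF H(1)])
  then show "carrier (tensor R M N) \<subseteq> H"
    unfolding tensor_def
    by (simp only: span_of_quot[OF L.module_axioms tensor_kernel_submodule M.span_of_basis_elems])
qed

lemma span_of_pure_tensors:
  "span_of R (tensor R M N) {tens R M N x y | x y. x \<in> carrier M \<and> y \<in> carrier N} = carrier (tensor R M N)"
  by (intro span_of_tens span_of_carrier M N)

lemma tensor_lift:
  assumes P: "module R P" and b: "bilinear_map R M N P b"
  shows "\<exists>k. k \<in> linear_maps R (tensor R M N) P \<and>
    (\<forall>x\<in>carrier M. \<forall>y\<in>carrier N. k (tens R M N x y) = b x y)"
proof -
  interpret P: module R P by (rule P)
  note b1 = bilinear_mapD(1)[OF b] and b2 = bilinear_mapD(2)[OF b]
  have bc: "b x y \<in> carrier P" if "x \<in> carrier M" "y \<in> carrier N" for x y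
    using semilinear_closed[OF b1] that by auto
  obtain k where k: "k \<in> linear_maps R L P"
    and ke: "\<And>z. z \<in> carrier M \<times> carrier N \<Longrightarrow> k (basis_elem R z) = (\<lambda>(x, y). b x y) z"
    using M.free_module_lift[OF P, of "carrier M \<times> carrier N" "\<lambda>(x, y). b x y"] bc by auto
  note km = semilinear_minus[OF k L.abelian_group_axioms P.abelian_group_axioms]
  have zero: "k u = \<zero>\<^bsub>P\<^esub>" if "u \<in> tensor_relations R M N" for u
    using that unfolding tensor_relations_def Let_def
    by (elim UnE CollectE exE conjE; hypsubst)
      (simp_all del: free_module_simps add: km semilinear_add[OF k] semilinear_smult[OF k] M.basis_elem_closed ke P.minus_eq_zero_iff
        bc semilinear_add[OF b1] semilinear_add[OF b2] semilinear_smult[OF b1] semilinear_smult[OF b2])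
  \<comment> \<open>The kernel is written as the preimage of the zero submodule; as it contains the
    relations, it contains their span.\<close>
  have "submodule {x \<in> carrier L. k x \<in> {\<zero>\<^bsub>P\<^esub>}} R L"
    by (rule submodule_preimage[OF L.module_axioms P k])
      (auto intro!: P.submoduleI simp: P.a_inv_zero)
  then have "tensor_kernel R M N \<subseteq> {x \<in> carrier L. k x \<in> {\<zero>\<^bsub>P\<^esub>}}"
    unfolding tensor_kernel_def by (rule span_of_least) (use zero tensor_relations_closed in auto)
  then obtain k' where k': "k' \<in> linear_maps R (quot L (tensor_kernel R M N)) P"
    "\<And>x. x \<in> carrier L \<Longrightarrow> k' (tensor_kernel R M N +>\<^bsub>L\<^esub> x) = k x"
    using quot_lift[OF L.module_axioms tensor_kernel_submodule P k, of thesis] by blast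
  then show ?thesis
    by (intro exI[of _ k']) (auto simp: tensor_def tens_def M.basis_elem_closed ke)
qed

end

text \<open>A name for the lift makes it possible to speak of a family of lifts and of its
  dependence on a parameter inside \<open>b\<close>.\<close>

definition tlift ::
  "('r, 'x) ring_scheme \<Rightarrow> ('r, 'm) module \<Rightarrow> ('r, 'n) module \<Rightarrow> ('r, 'p) module
    \<Rightarrow> ('m \<Rightarrow> 'n \<Rightarrow> 'p) \<Rightarrow> ('m \<times> 'n \<Rightarrow> 'r) set \<Rightarrow> 'p" where
  "tlift R M N P b = (SOME k. k \<in> linear_maps R (tensor R M N) P \<and>
    (\<forall>x\<in>carrier M. \<forall>y\<in>carrier N. k (tens R M N x y) = b x y))"

lemma
  assumes "module R M" "module R N" "module R P" "bilinear_map R M N P b"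
  shows tlift_linear: "tlift R M N P b \<in> linear_maps R (tensor R M N) P"
    and tlift_tens: "x \<in> carrier M \<Longrightarrow> y \<in> carrier N \<Longrightarrow> tlift R M N P b (tens R M N x y) = b x y"
  using someI_ex[OF tensor_lift[OF assms]] unfolding tlift_def by auto

text \<open>On pure tensors the family of lifts is \<open>b z x y\<close>, which is semilinear in
  \<open>z\<close> by assumption; \<open>semilinear_param\<close> carries this to all tensors. It
  replaces currying into a module of homomorphisms.\<close>

lemma tlift_param:
  assumes M: "module R M" and N: "module R N" and P: "module R P" and Z: "module R0 Z"
    and h: "h ` carrier R0 \<subseteq> carrier R"
    and b: "\<And>z. z \<in> carrier Z \<Longrightarrow> bilinear_map R M N P (b z)"
    and z: "\<And>x y. x \<in> carrier M \<Longrightarrow> y \<in> carrier N \<Longrightarrow> (\<lambda>z. b z x y) \<in> semilinear R0 h Z P"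
    and X: "X \<in> carrier (tensor R M N)"
  shows "(\<lambda>z. tlift R M N P (b z) X) \<in> semilinear R0 h Z P"
  by (rule semilinear_param[OF span_of_pure_tensors[OF M N] module_tensor[OF M N] P Z h _ _ X])
    (auto intro!: tlift_linear M N P b semilinear_cong[OF z Z] simp: tlift_tens[OF M N P b])

lemma tensor_map_exists:
  assumes M: "module R M" and N: "module R N" and M': "module R M'" and N': "module R N'"
    and f: "f \<in> linear_maps R M M'" and g: "g \<in> linear_maps R N N'"
  shows "\<exists>k. k \<in> linear_maps R (tensor R M N) (tensor R M' N') \<and>
    (\<forall>x\<in>carrier M. \<forall>y\<in>carrier N. k (tens R M N x y) = tens R M' N' (f x) (g y))"
proof (rule tensor_lift[OF M N module_tensor[OF M' N']], rule bilinear_mapI)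
  fix x assume "x \<in> carrier M"
  then show "(\<lambda>y. tens R M' N' (f x) (g y)) \<in> linear_maps R N (tensor R M' N')"
    by (intro linear_comp[OF g tens_linear_right[OF M' N' semilinear_closed[OF f]]]) auto
next
  fix y assume "y \<in> carrier N"
  then show "(\<lambda>x. tens R M' N' (f x) (g y)) \<in> linear_maps R M (tensor R M' N')"
    by (intro linear_comp[OF f tens_linear_left[OF M' N' semilinear_closed[OF g]]]) auto
qed

lemma
  assumes "module R M" "module R N" "module R M'" "module R N'"
    "f \<in> linear_maps R M M'" "g \<in> linear_maps R N N'"
  shows tensor_map_linear: "tensor_map R M N M' N' f g \<in> linear_maps R (tensor R M N) (tensor R M' N')"
    and tensor_map_tens: "x \<in> carrier M \<Longrightarrow> y \<in> carrier N \<Longrightarrow>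
      tensor_map R M N M' N' f g (tens R M N x y) = tens R M' N' (f x) (g y)"
  using someI_ex[OF tensor_map_exists[OF assms]] unfolding tensor_map_def by auto

section \<open>Extension of scalars from the integers\<close>

abbreviation (input) zhom :: "('s, 'y) ring_scheme \<Rightarrow> int \<Rightarrow> 's" where
  "zhom S \<equiv> (\<lambda>k. add_pow S k \<one>\<^bsub>S\<^esub>)"

lemma (in abelian_group) add_pow_rules:
  fixes j k :: int
  assumes "x \<in> carrier G"
  shows "add_pow G k x \<in> carrier G" "add_pow G (j + k) x = add_pow G j x \<oplus> add_pow G k x"
    "add_pow G (j * k) x = add_pow G j (add_pow G k x)" "add_pow G (1 :: int) x = x"
    "add_pow G (0 :: int) x = \<zero>"
  using group.int_pow_closed[OF a_group, of x k] group.int_pow_mult[OF a_group, of x j k]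
    group.int_pow_pow[OF a_group, of x k j] group.int_pow_1[OF a_group, of x] assms
  by (simp_all add: mult.commute add_pow_def)

lemma (in abelian_group) add_pow_add:
  fixes k :: int
  assumes "x \<in> carrier G" "y \<in> carrier G"
  shows "add_pow G k (x \<oplus> y) = add_pow G k x \<oplus> add_pow G k y"
  using comm_group.int_pow_distrib[OF a_comm_group, of x y k] assms by (simp add: add_pow_def)

lemma zmod_simps [simp]:
  "carrier (zmod A) = carrier A" "monoid.mult (zmod A) = monoid.mult A" "one (zmod A) = one A"
  "zero (zmod A) = zero A" "add (zmod A) = add A" "k \<odot>\<^bsub>zmod A\<^esub> x = add_pow A k x"
  by (simp_all add: zmod_def)

lemma module_zmod:
  assumes "abelian_group A"
  shows "module \<Z> (zmod A)"
proof -
  interpret abelian_group A by fact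
  show ?thesis
    by (intro moduleI int_is_cring abelian_group_transfer[OF assms])
      (auto simp: add_pow_rules add_pow_add)
qed

text \<open>The integers act on a module in only one way, so scalars coming through any ring
  homomorphism from \<int> act by iterated addition. Both the identity of \<int> and \<int>
  \<rightarrow> S are instances.\<close>

lemma zhom_smult:
  assumes "module R M" "h \<in> ring_hom \<Z> R" "x \<in> carrier M"
  shows "h k \<odot>\<^bsub>M\<^esub> x = add_pow M k x"
proof -
  interpret module R M by fact
  have hc: "h j \<in> carrier R" and ha: "h (i + j) = h i \<oplus>\<^bsub>R\<^esub> h j" and h1: "h 1 = \<one>\<^bsub>R\<^esub>" for i j
    using ring_hom_memE[OF assms(2)] by auto
  have h0: "h 0 = \<zero>\<^bsub>R\<^esub>"
    using ha[of 0 0] hc[of 0] by (metis R.add.r_cancel_one add_0)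
  show ?thesis
  proof (induction k rule: int_induct[where k = 0])
    case base
    then show ?case using assms(3) by (simp add: h0 add_pow_rules(5))
  next
    case (step1 i)
    then show ?case
      using ha[of i 1] hc assms(3) h1 by (simp add: smult_l_distr M.add_pow_rules)
  next
    \<comment> \<open>Nothing is known about \<open>h (i - 1)\<close> directly. The two sides agree
      after \<open>x\<close> is added, and then \<open>x\<close> is cancelled.\<close>
    case (step2 i)
    have "add_pow M (i - 1) x \<oplus>\<^bsub>M\<^esub> x = h (i - 1) \<odot>\<^bsub>M\<^esub> x \<oplus>\<^bsub>M\<^esub> x"
      using ha[of "i - 1" 1] hc[of "i - 1"] assms(3) h1 step2 M.add_pow_rules(2)[of x "i - 1" 1]
      by (simp add: smult_l_distr M.add_pow_rules(4))
    then show ?case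
      using hc assms(3) M.add_pow_rules(1)[OF assms(3)] by simp
  qed
qed

text \<open>By \<open>zhom_smult\<close> both scalar actions are iterated addition, which every
  additive map respects. This is how plain additive maps enter the semilinear setting.\<close>

lemma hom_semilinear_int:
  assumes "module \<Z> M" "module R N" "h \<in> ring_hom \<Z> R" "f \<in> hom (add_monoid M) (add_monoid N)"
  shows "f \<in> semilinear \<Z> h M N"
proof (rule semilinearI)
  interpret M: module \<Z> M by fact
  interpret N: module R N by fact
  have id: "(\<lambda>k. k) \<in> ring_hom \<Z> \<Z>" by (rule ring_hom_memI) auto
  fix k :: int and x assume x: "x \<in> carrier M"
  then have fx: "f x \<in> carrier N" using assms(4) by (auto simp: hom_def)
  have "f (add_pow M k x) = add_pow N k (f x)"
    unfolding add_pow_def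
    by (rule hom_int_pow[OF assms(4)]) (use x M.a_group N.a_group in auto)
  then show "f (k \<odot>\<^bsub>M\<^esub> x) = h k \<odot>\<^bsub>N\<^esub> f x"
    using zhom_smult[OF assms(1) id x] zhom_smult[OF assms(2,3) fx] by simp
qed (use assms(4) in \<open>auto simp: hom_def\<close>)

lemma zhom_ring_hom:
  assumes "cring S"
  shows "zhom S \<in> ring_hom \<Z> S"
proof -
  interpret cring S by fact
  have "add_pow S k \<one>\<^bsub>S\<^esub> \<otimes>\<^bsub>S\<^esub> x = add_pow S k x" if "x \<in> carrier S" for k :: int and x
    using add_pow_ldistr_int[of "\<one>\<^bsub>S\<^esub>" x k] that by simp
  then show ?thesis
    by (intro ring_hom_memI) (auto simp: add_pow_rules)
qed

lemma zhom_image: "cring S \<Longrightarrow> zhom S ` carrier \<Z> \<subseteq> carrier S"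
  by (rule ring_hom_image[OF zhom_ring_hom])

lemma semilinear_sum:
  assumes f: "f \<in> semilinear R h M N" and g: "g \<in> semilinear R h M N" and N: "module S N"
    and h: "h ` carrier R \<subseteq> carrier S"
  shows "(\<lambda>x. f x \<oplus>\<^bsub>N\<^esub> g x) \<in> semilinear R h M N"
proof -
  interpret N: module S N by fact
  show ?thesis
    by (rule semilinearI)
      (use h in \<open>auto simp: semilinear_closed[OF f] semilinear_closed[OF g] semilinear_add[OF f]
        semilinear_add[OF g] semilinear_smult[OF f] semilinear_smult[OF g] N.smult_r_distr N.a_ac\<close>)
qed

lemma smult_linear: "module R M \<Longrightarrow> r \<in> carrier R \<Longrightarrow> (\<lambda>x. r \<odot>\<^bsub>M\<^esub> x) \<in> linear_maps R M M"
  by (rule semilinearI) (auto simp: module.smult_closed module.smult_r_distr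
      module.smult_assoc1[symmetric] cring.cring_simprules(14) module_cring)

section \<open>Multilinear identities checked on spanning sets\<close>

lemma bilinear_eqI:
  assumes X: "span_of R M X = carrier M" and Y: "span_of R N Y = carrier N"
    and M: "module R M" and N: "module R N" and P: "module R P"
    and b: "bilinear_map R M N P b" and c: "bilinear_map R M N P c"
    and eq: "\<And>x y. x \<in> X \<Longrightarrow> y \<in> Y \<Longrightarrow> b x y = c x y"
    and x: "x \<in> carrier M" and y: "y \<in> carrier N"
  shows "b x y = c x y"
proof -
  have XM: "X \<subseteq> carrier M" using span_of_superset[of X R M] X by simp
  have "b x y = c x y" if "x \<in> X" for x
    using semilinear_eqI[OF Y N P, of "b x" _ "c x"] bilinear_mapD(1)[OF b] bilinear_mapD(1)[OF c] eq XM that y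
    by blast
  then show ?thesis
    using semilinear_eqI[OF X M P, of "\<lambda>x. b x y" _ "\<lambda>x. c x y"] bilinear_mapD(2)[OF b y] bilinear_mapD(2)[OF c y] x
    by blast
qed

lemma bilinear_comp:
  assumes "bilinear_map R M N P b" "k \<in> linear_maps R P Q"
  shows "bilinear_map R M N Q (\<lambda>x y. k (b x y))"
  by (intro bilinear_mapI linear_comp[OF bilinear_mapD(1)[OF assms(1)] assms(2)]
      linear_comp[OF bilinear_mapD(2)[OF assms(1)] assms(2)]) auto

lemma bilinear_comp2:
  assumes "bilinear_map R M N P b" "f \<in> linear_maps R M' M" "g \<in> linear_maps R N' N"
  shows "bilinear_map R M' N' P (\<lambda>x y. b (f x) (g y))"
  using semilinear_closed[OF assms(2)] semilinear_closed[OF assms(3)]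
  by (intro bilinear_mapI linear_comp[OF assms(3) bilinear_mapD(1)[OF assms(1)]]
      linear_comp[OF assms(2) bilinear_mapD(2)[OF assms(1)]]) auto

text \<open>Both bracketings are linear in each of the three factors. The first two are freed
  together with the third a generator; the third is freed last.\<close>

lemma S_rng_spanI:
  assumes A: "module R A" and m: "bilinear_map R A A A (monoid.mult A)"
    and X: "span_of R A X = carrier A"
    and assoc: "\<And>x y z. x \<in> X \<Longrightarrow> y \<in> X \<Longrightarrow> z \<in> X \<Longrightarrow>
      (x \<otimes>\<^bsub>A\<^esub> y) \<otimes>\<^bsub>A\<^esub> z = x \<otimes>\<^bsub>A\<^esub> (y \<otimes>\<^bsub>A\<^esub> z)"
  shows "S_rng R A"
proof (rule S_rngI[OF A m])
  have XA: "X \<subseteq> carrier A" using span_of_superset[of X R A] X by simp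
  fix x y z assume x: "x \<in> carrier A" and y: "y \<in> carrier A" and z: "z \<in> carrier A"
  have 1: "(x \<otimes>\<^bsub>A\<^esub> y) \<otimes>\<^bsub>A\<^esub> z = x \<otimes>\<^bsub>A\<^esub> (y \<otimes>\<^bsub>A\<^esub> z)" if z: "z \<in> X" for z
    by (rule bilinear_eqI[OF X X A A A _ _ _ x y])
      (use XA z m in \<open>auto intro!: assoc bilinear_comp[OF m bilinear_mapD(2)[OF m]]
        bilinear_comp2[OF m linear_ident bilinear_mapD(2)[OF m], simplified]\<close>)
  have xy: "x \<otimes>\<^bsub>A\<^esub> y \<in> carrier A"
    using semilinear_closed[OF bilinear_mapD(1)[OF m x]] y by auto
  show "(x \<otimes>\<^bsub>A\<^esub> y) \<otimes>\<^bsub>A\<^esub> z = x \<otimes>\<^bsub>A\<^esub> (y \<otimes>\<^bsub>A\<^esub> z)"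
    by (rule semilinear_eqI[OF X A A _ _ _ z, of _ "\<lambda>r. r"])
      (auto intro!: 1 bilinear_mapD(1)[OF m] linear_comp[OF bilinear_mapD(1)[OF m y] bilinear_mapD(1)[OF m x]] xy)
qed

text \<open>The image of a product and the product of the images are both bilinear in the two
  factors, so generators decide.\<close>

lemma multiplicative_spanI:
  assumes A: "module R A" and B: "module R B"
    and mA: "bilinear_map R A A A (monoid.mult A)" and mB: "bilinear_map R B B B (monoid.mult B)"
    and f: "f \<in> linear_maps R A B" and X: "span_of R A X = carrier A"
    and eq: "\<And>x y. x \<in> X \<Longrightarrow> y \<in> X \<Longrightarrow> f (x \<otimes>\<^bsub>A\<^esub> y) = f x \<otimes>\<^bsub>B\<^esub> f y"
    and x: "x \<in> carrier A" and y: "y \<in> carrier A"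
  shows "f (x \<otimes>\<^bsub>A\<^esub> y) = f x \<otimes>\<^bsub>B\<^esub> f y"
  by (rule bilinear_eqI[OF X X A A B bilinear_comp[OF mA f] bilinear_comp2[OF mB f f] eq x y])

lemma module_transfer:
  assumes "module R M" "carrier N = carrier M" "zero N = zero M" "add N = add M"
    "\<And>r x. r \<in> carrier R \<Longrightarrow> x \<in> carrier M \<Longrightarrow> r \<odot>\<^bsub>N\<^esub> x = r \<odot>\<^bsub>M\<^esub> x"
  shows "module R N"
proof -
  interpret module R M by fact
  show ?thesis
    by (intro moduleI is_cring abelian_group_transfer[OF abelian_group_axioms])
      (auto simp: assms smult_l_distr smult_r_distr smult_assoc1)
qed

section \<open>The S-module M \<otimes> S and its universal property\<close>

lemma base_change_simps:
  "carrier (base_change M S) = carrier (tensor \<Z> M (zmod S))"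
  "zero (base_change M S) = zero (tensor \<Z> M (zmod S))"
  "add (base_change M S) = add (tensor \<Z> M (zmod S))"
  "smult (base_change M S) s = tensor_map \<Z> M (zmod S) M (zmod S) (\<lambda>x. x) (\<lambda>t. s \<otimes>\<^bsub>S\<^esub> t)"
  by (simp_all add: base_change_def)

context
  fixes M :: "(int, 'm) module" and S :: "('s, 'y) ring_scheme"
  assumes M: "module \<Z> M" and S: "cring S"
begin

interpretation M: module \<Z> M by (rule M)
interpretation S: cring S by (rule S)

private lemma Sm: "module \<Z> (zmod S)"
  by (rule module_zmod[OF S.abelian_group_axioms])

private abbreviation (input) "B \<equiv> base_change M S"
private abbreviation (input) "TT \<equiv> tensor \<Z> M (zmod S)"

private lemma TTm: "module \<Z> TT"
  by (rule module_tensor[OF M Sm])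

private lemma mult_linear_Z: "s \<in> carrier S \<Longrightarrow> (\<lambda>t. s \<otimes>\<^bsub>S\<^esub> t) \<in> linear_maps \<Z> (zmod S) (zmod S)"
  by (rule semilinearI) (auto simp: S.r_distr S.add_pow_rdistr_int)

lemma btens_closed: "x \<in> carrier M \<Longrightarrow> s \<in> carrier S \<Longrightarrow> btens M S x s \<in> carrier B"
  using tens_closed[OF M Sm] by (simp add: base_change_simps)

lemma base_change_smult_linear_int: "s \<in> carrier S \<Longrightarrow> (\<lambda>X. s \<odot>\<^bsub>B\<^esub> X) \<in> linear_maps \<Z> TT TT"
  unfolding base_change_simps by (rule tensor_map_linear[OF M Sm M Sm linear_ident mult_linear_Z])

lemma base_change_smult_btens:
  "s \<in> carrier S \<Longrightarrow> x \<in> carrier M \<Longrightarrow> t \<in> carrier S \<Longrightarrow>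
    s \<odot>\<^bsub>B\<^esub> btens M S x t = btens M S x (s \<otimes>\<^bsub>S\<^esub> t)"
  unfolding base_change_simps by (rule tensor_map_tens[OF M Sm M Sm linear_ident mult_linear_Z]) auto

private lemma btens_add_right: "x \<in> carrier M \<Longrightarrow> s \<in> carrier S \<Longrightarrow> t \<in> carrier S \<Longrightarrow>
    btens M S x (s \<oplus>\<^bsub>S\<^esub> t) = btens M S x s \<oplus>\<^bsub>B\<^esub> btens M S x t"
  using semilinear_add[OF tens_linear_right[OF M Sm], of x s t] by (simp add: base_change_simps)

text \<open>For fixed scalars the laws on sums and products of scalars and on the unit compare two
  additive maps of M \<otimes> S, and on pure tensors they become the corresponding ring laws of
  \<open>S\<close>.\<close>

lemma module_base_change: "module S B"
proof -
  interpret TT: module \<Z> TT by (rule TTm)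
  note smc = semilinear_closed[OF base_change_smult_linear_int, folded base_change_simps(1)]
  have 0: "abelian_group B"
    by (rule abelian_group_transfer[OF TT.abelian_group_axioms]) (auto simp: base_change_simps)
  have eq: "f X = g X"
    if "f \<in> linear_maps \<Z> TT TT" "g \<in> linear_maps \<Z> TT TT" "X \<in> carrier B"
      "\<And>x t. x \<in> carrier M \<Longrightarrow> t \<in> carrier S \<Longrightarrow> f (btens M S x t) = g (btens M S x t)" for f g X
    by (rule semilinear_eqI[OF span_of_pure_tensors[OF M Sm] TTm TTm that(1,2)])
      (use that in \<open>auto simp: base_change_simps\<close>)
  show ?thesis
  proof (rule moduleI[OF S 0])
    fix r s X assume rs: "r \<in> carrier S" "s \<in> carrier S" and X: "X \<in> carrier B"
    have "(\<lambda>X. r \<odot>\<^bsub>B\<^esub> X \<oplus>\<^bsub>B\<^esub> s \<odot>\<^bsub>B\<^esub> X) \<in> linear_maps \<Z> TT TT"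
      unfolding base_change_simps(3)
      by (rule semilinear_sum[OF base_change_smult_linear_int base_change_smult_linear_int TTm]) (use rs in auto)
    then show "(r \<oplus>\<^bsub>S\<^esub> s) \<odot>\<^bsub>B\<^esub> X = r \<odot>\<^bsub>B\<^esub> X \<oplus>\<^bsub>B\<^esub> s \<odot>\<^bsub>B\<^esub> X"
      using rs by (intro eq[OF base_change_smult_linear_int _ X])
        (auto simp: base_change_smult_btens S.l_distr btens_add_right)
    show "(r \<otimes>\<^bsub>S\<^esub> s) \<odot>\<^bsub>B\<^esub> X = r \<odot>\<^bsub>B\<^esub> (s \<odot>\<^bsub>B\<^esub> X)"
      using rs by (intro eq[OF base_change_smult_linear_int _ X]
          linear_comp[OF base_change_smult_linear_int base_change_smult_linear_int])
        (auto simp: base_change_smult_btens S.m_assoc)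
  next
    fix X assume X: "X \<in> carrier B"
    show "\<one>\<^bsub>S\<^esub> \<odot>\<^bsub>B\<^esub> X = X"
      by (intro eq[OF base_change_smult_linear_int _ X] linear_ident)
        (auto simp: base_change_smult_btens)
  next
    fix r X Y assume "r \<in> carrier S" "X \<in> carrier B" "Y \<in> carrier B"
    then show "r \<odot>\<^bsub>B\<^esub> (X \<oplus>\<^bsub>B\<^esub> Y) = r \<odot>\<^bsub>B\<^esub> X \<oplus>\<^bsub>B\<^esub> r \<odot>\<^bsub>B\<^esub> Y"
      using semilinear_add[OF base_change_smult_linear_int, of r X Y] by (simp add: base_change_simps(1,3))
  qed (rule smc)
qed

lemma btens_eq_smult: "x \<in> carrier M \<Longrightarrow> s \<in> carrier S \<Longrightarrow> btens M S x s = s \<odot>\<^bsub>B\<^esub> btens M S x \<one>\<^bsub>S\<^esub>"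
  by (simp add: base_change_smult_btens)

text \<open>The bridge between the \<int>-module and the S-module on the same carrier: it turns
  additive maps into the tensor product into maps along \<int> \<rightarrow> S, and S-submodules
  into \<int>-submodules.\<close>

lemma base_change_ident_semilinear: "(\<lambda>X. X) \<in> semilinear \<Z> (zhom S) TT B"
  by (rule hom_semilinear_int[OF TTm module_base_change zhom_ring_hom[OF S]])
    (auto simp: hom_def base_change_simps)

lemma btens_semilinear: "s \<in> carrier S \<Longrightarrow> (\<lambda>x. btens M S x s) \<in> semilinear \<Z> (zhom S) M B"
  using semilinear_linear_comp[OF tens_linear_left[OF M Sm] base_change_ident_semilinear] by simp

text \<open>Since x \<otimes> s = s (x \<otimes> 1), an S-submodule that contains every x \<otimes>
  1 with \<open>x\<close> in \<open>X\<close> contains every x \<otimes> s, and these span already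
  over \<int>.\<close>

lemma span_of_base_change:
  assumes X: "span_of \<Z> M X = carrier M"
  shows "span_of S B ((\<lambda>x. btens M S x \<one>\<^bsub>S\<^esub>) ` X) = carrier B"
proof (rule span_of_carrierI[OF module_base_change])
  interpret B: module S B by (rule module_base_change)
  have XM: "X \<subseteq> carrier M" using span_of_superset[of X \<Z> M] X by simp
  then show "(\<lambda>x. btens M S x \<one>\<^bsub>S\<^esub>) ` X \<subseteq> carrier B" using btens_closed by auto
  fix H assume H: "submodule H S B" "(\<lambda>x. btens M S x \<one>\<^bsub>S\<^esub>) ` X \<subseteq> H"
  have sub: "submodule {x \<in> carrier TT. x \<in> H} \<Z> TT"
    by (rule submodule_preimage[OF TTm module_base_change base_change_ident_semilinear _ H(1)])
      (rule zhom_image[OF S])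
  have "btens M S x s \<in> H" if "x \<in> X" "s \<in> carrier S" for x s
    using that XM H B.submoduleE(4)[OF H(1)] by (subst btens_eq_smult) auto
  then have "{btens M S x s | x s. x \<in> X \<and> s \<in> carrier (zmod S)} \<subseteq> {x \<in> carrier TT. x \<in> H}"
    using XM tens_closed[OF M Sm] by auto
  from span_of_least[OF sub this] show "carrier B \<subseteq> H"
    unfolding span_of_tens[OF M Sm X span_of_carrier[OF Sm]] base_change_simps(1) by auto
qed

lemma span_of_base_change_carrier: "span_of S B ((\<lambda>x. btens M S x \<one>\<^bsub>S\<^esub>) ` carrier M) = carrier B"
  by (rule span_of_base_change[OF span_of_carrier[OF M]])

context
  fixes N :: "('s, 'n) module"
  assumes N: "module S N"
begin

interpretation N: module S N by (rule N)

text \<open>The lift is taken over \<int> with \<open>N\<close> restricted along \<int>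
  \<rightarrow> S, which makes it additive only. Compatibility with scalars from \<open>S\<close> is
  a second comparison on pure tensors, where both sides are (s t) (i x).\<close>

lemma linear_extension_exists:
  assumes i: "i \<in> semilinear \<Z> (zhom S) M N"
  shows "\<exists>k. k \<in> linear_maps S B N \<and>
    (\<forall>x\<in>carrier M. \<forall>s\<in>carrier S. k (btens M S x s) = s \<odot>\<^bsub>N\<^esub> i x)"
proof -
  let ?N = "res_scalars (zhom S) N"
  have Nm: "module \<Z> ?N" by (rule module_res_scalars[OF int_is_cring N zhom_ring_hom[OF S]])
  have "bilinear_map \<Z> M (zmod S) ?N (\<lambda>x s. s \<odot>\<^bsub>N\<^esub> i x)"
  proof (rule bilinear_mapI)
    fix s assume "s \<in> carrier (zmod S)"
    then show "(\<lambda>x. s \<odot>\<^bsub>N\<^esub> i x) \<in> linear_maps \<Z> M ?N"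
      using linear_comp[OF i smult_linear[OF N] zhom_image[OF S]] by simp
  next
    fix x assume x: "x \<in> carrier M"
    show "(\<lambda>s. s \<odot>\<^bsub>N\<^esub> i x) \<in> linear_maps \<Z> (zmod S) ?N"
      unfolding linear_maps_res_scalars
      by (rule hom_semilinear_int[OF Sm N zhom_ring_hom[OF S]])
        (auto simp: hom_def semilinear_closed[OF i x] N.smult_l_distr)
  qed
  from tensor_lift[OF M Sm Nm this] obtain k
    where k: "k \<in> semilinear \<Z> (zhom S) TT N"
      and kt: "\<And>x s. x \<in> carrier M \<Longrightarrow> s \<in> carrier S \<Longrightarrow> k (btens M S x s) = s \<odot>\<^bsub>N\<^esub> i x"
    by auto
  have "k \<in> linear_maps S B N"
  proof (rule semilinearI)
    fix s X assume s: "s \<in> carrier S" and X: "X \<in> carrier B"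
    show "k (s \<odot>\<^bsub>B\<^esub> X) = s \<odot>\<^bsub>N\<^esub> k X"
    proof (rule semilinear_eqI[OF span_of_pure_tensors[OF M Sm] TTm N])
      show "(\<lambda>X. k (s \<odot>\<^bsub>B\<^esub> X)) \<in> semilinear \<Z> (zhom S) TT N"
        by (rule semilinear_linear_comp[OF base_change_smult_linear_int[OF s] k])
      show "(\<lambda>X. s \<odot>\<^bsub>N\<^esub> k X) \<in> semilinear \<Z> (zhom S) TT N"
        by (rule linear_comp[OF k smult_linear[OF N s] zhom_image[OF S]])
      show "X \<in> carrier TT" using X by (simp add: base_change_simps)
      fix Y assume "Y \<in> {btens M S x y | x y. x \<in> carrier M \<and> y \<in> carrier (zmod S)}"
      then show "k (s \<odot>\<^bsub>B\<^esub> Y) = s \<odot>\<^bsub>N\<^esub> k Y"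
        using s by (auto simp: base_change_smult_btens kt N.smult_assoc1 semilinear_closed[OF i])
    qed
  qed (use semilinear_closed[OF k] semilinear_add[OF k] in \<open>auto simp: base_change_simps\<close>)
  then show ?thesis using kt by auto
qed

lemma
  assumes "i \<in> semilinear \<Z> (zhom S) M N"
  shows linear_extension_linear: "linear_extension M S N i \<in> linear_maps S B N"
    and linear_extension_btens: "x \<in> carrier M \<Longrightarrow> s \<in> carrier S \<Longrightarrow>
      linear_extension M S N i (btens M S x s) = s \<odot>\<^bsub>N\<^esub> i x"
  using someI_ex[OF linear_extension_exists[OF assms]] unfolding linear_extension_def by auto

lemma linear_extension_btens_one:
  assumes "i \<in> semilinear \<Z> (zhom S) M N" "x \<in> carrier M"
  shows "linear_extension M S N i (btens M S x \<one>\<^bsub>S\<^esub>) = i x"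
  using linear_extension_btens[OF assms(1,2) S.one_closed] semilinear_closed[OF assms] by simp

lemma linear_extension_param:
  assumes Z: "module R0 Z" and h: "h ` carrier R0 \<subseteq> carrier S"
    and i: "\<And>z. z \<in> carrier Z \<Longrightarrow> i z \<in> semilinear \<Z> (zhom S) M N"
    and z: "\<And>x. x \<in> carrier M \<Longrightarrow> (\<lambda>z. i z x) \<in> semilinear R0 h Z N"
    and X: "X \<in> carrier B"
  shows "(\<lambda>z. linear_extension M S N (i z) X) \<in> semilinear R0 h Z N"
  by (rule semilinear_param[OF span_of_base_change_carrier module_base_change N Z h _ _ X])
    (auto intro!: linear_extension_linear i semilinear_cong[OF z Z] simp: linear_extension_btens_one[OF i])

end

end

section \<open>Multiadditive maps extended to S-multilinear maps\<close>

definition biadditive ::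
  "('s, 'y) ring_scheme \<Rightarrow> (int, 'm) module \<Rightarrow> (int, 'n) module \<Rightarrow> ('s, 'p) module
    \<Rightarrow> ('m \<Rightarrow> 'n \<Rightarrow> 'p) \<Rightarrow> bool" where
  "biadditive S M N P b \<longleftrightarrow>
     (\<forall>x\<in>carrier M. b x \<in> semilinear \<Z> (zhom S) N P) \<and>
     (\<forall>y\<in>carrier N. (\<lambda>x. b x y) \<in> semilinear \<Z> (zhom S) M P)"

text \<open>The second variable is extended first, with \<open>x\<close> fixed in \<open>M\<close>.
  The result is still additive in \<open>x\<close> by \<open>linear_extension_param\<close>, and
  this is what permits the outer extension.\<close>

definition ext2 ::
  "('s, 'y) ring_scheme \<Rightarrow> (int, 'm) module \<Rightarrow> (int, 'n) module \<Rightarrow> ('s, 'p) module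
    \<Rightarrow> ('m \<Rightarrow> 'n \<Rightarrow> 'p) \<Rightarrow> ('m \<times> 's \<Rightarrow> int) set \<Rightarrow> ('n \<times> 's \<Rightarrow> int) set \<Rightarrow> 'p" where
  "ext2 S M N P b X Y = linear_extension M S P (\<lambda>x. linear_extension N S P (b x) Y) X"

context
  fixes S :: "('s, 'y) ring_scheme" and M :: "(int, 'm) module" and N :: "(int, 'n) module"
    and P :: "('s, 'p) module"
  assumes S: "cring S" and M: "module \<Z> M" and N: "module \<Z> N" and P: "module S P"
begin

private lemma inner:
  assumes "biadditive S M N P b" "Y \<in> carrier (base_change N S)"
  shows "(\<lambda>x. linear_extension N S P (b x) Y) \<in> semilinear \<Z> (zhom S) M P"
  by (rule linear_extension_param[OF N S P M zhom_image[OF S] _ _ assms(2)])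
    (use assms(1) in \<open>auto simp: biadditive_def\<close>)

lemma ext2_bilinear:
  assumes "biadditive S M N P b"
  shows "bilinear_map S (base_change M S) (base_change N S) P (ext2 S M N P b)"
  unfolding ext2_def
  by (intro bilinear_mapI linear_extension_linear[OF M S P] inner assms
      linear_extension_param[OF M S P module_base_change[OF N S]] linear_extension_linear[OF N S P])
    (use assms in \<open>auto simp: biadditive_def\<close>)

text \<open>Arbitrary \<open>s\<close> and \<open>t\<close> are allowed because the product on A
  \<otimes> S is specified on all pure tensors, not only on those with second entry 1.\<close>

lemma ext2_btens:
  assumes b: "biadditive S M N P b"
    and x: "x \<in> carrier M" and s: "s \<in> carrier S" and y: "y \<in> carrier N" and t: "t \<in> carrier S"
  shows "ext2 S M N P b (btens M S x s) (btens N S y t) = (s \<otimes>\<^bsub>S\<^esub> t) \<odot>\<^bsub>P\<^esub> b x y"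
proof -
  interpret P: module S P by (rule P)
  have bx: "b x \<in> semilinear \<Z> (zhom S) N P" using b x by (auto simp: biadditive_def)
  show ?thesis
    unfolding ext2_def
    using linear_extension_btens[OF M S P inner[OF b btens_closed[OF N S y t]] x s]
      linear_extension_btens[OF N S P bx y t] s t semilinear_closed[OF bx y]
    by (simp add: P.smult_assoc1)
qed

lemma ext2_btens_one:
  assumes b: "biadditive S M N P b" and x: "x \<in> carrier M" and y: "y \<in> carrier N"
  shows "ext2 S M N P b (btens M S x \<one>\<^bsub>S\<^esub>) (btens N S y \<one>\<^bsub>S\<^esub>) = b x y"
proof -
  interpret P: module S P by (rule P)
  have bx: "b x \<in> semilinear \<Z> (zhom S) N P" using b x by (auto simp: biadditive_def)
  show ?thesis
    using ext2_btens[OF b x P.R.one_closed y P.R.one_closed] semilinear_closed[OF bx y] by simp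
qed

lemma ext2_param:
  assumes Z: "module R0 Z" and h: "h ` carrier R0 \<subseteq> carrier S"
    and b: "\<And>z. z \<in> carrier Z \<Longrightarrow> biadditive S M N P (b z)"
    and z: "\<And>x y. x \<in> carrier M \<Longrightarrow> y \<in> carrier N \<Longrightarrow> (\<lambda>z. b z x y) \<in> semilinear R0 h Z P"
    and X: "X \<in> carrier (base_change M S)" and Y: "Y \<in> carrier (base_change N S)"
  shows "(\<lambda>z. ext2 S M N P (b z) X Y) \<in> semilinear R0 h Z P"
  unfolding ext2_def
  by (intro linear_extension_param[OF M S P Z h _ _ X] linear_extension_param[OF N S P Z h _ _ Y] inner b Y z)
    (use b in \<open>auto simp: biadditive_def\<close>)

end

definition multi4 ::
  "('r, 'x) ring_scheme \<Rightarrow> ('r \<Rightarrow> 's) \<Rightarrow> ('r, 't) module \<Rightarrow> ('r, 'g) module \<Rightarrow> ('s, 'p) module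
    \<Rightarrow> ('t \<Rightarrow> 'g \<Rightarrow> 't \<Rightarrow> 'g \<Rightarrow> 'p) \<Rightarrow> bool" where
  "multi4 R h T G P c \<longleftrightarrow>
     (\<forall>\<alpha>\<in>carrier G. \<forall>y\<in>carrier T. \<forall>\<beta>\<in>carrier G. (\<lambda>x. c x \<alpha> y \<beta>) \<in> semilinear R h T P) \<and>
     (\<forall>x\<in>carrier T. \<forall>y\<in>carrier T. \<forall>\<beta>\<in>carrier G. (\<lambda>\<alpha>. c x \<alpha> y \<beta>) \<in> semilinear R h G P) \<and>
     (\<forall>x\<in>carrier T. \<forall>\<alpha>\<in>carrier G. \<forall>\<beta>\<in>carrier G. (\<lambda>y. c x \<alpha> y \<beta>) \<in> semilinear R h T P) \<and>
     (\<forall>x\<in>carrier T. \<forall>\<alpha>\<in>carrier G. \<forall>y\<in>carrier T. (\<lambda>\<beta>. c x \<alpha> y \<beta>) \<in> semilinear R h G P)"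

lemma multi4I:
  assumes "\<And>\<alpha> y \<beta>. \<alpha> \<in> carrier G \<Longrightarrow> y \<in> carrier T \<Longrightarrow> \<beta> \<in> carrier G \<Longrightarrow> (\<lambda>x. c x \<alpha> y \<beta>) \<in> semilinear R h T P"
    and "\<And>x y \<beta>. x \<in> carrier T \<Longrightarrow> y \<in> carrier T \<Longrightarrow> \<beta> \<in> carrier G \<Longrightarrow> (\<lambda>\<alpha>. c x \<alpha> y \<beta>) \<in> semilinear R h G P"
    and "\<And>x \<alpha> \<beta>. x \<in> carrier T \<Longrightarrow> \<alpha> \<in> carrier G \<Longrightarrow> \<beta> \<in> carrier G \<Longrightarrow> (\<lambda>y. c x \<alpha> y \<beta>) \<in> semilinear R h T P"
    and "\<And>x \<alpha> y. x \<in> carrier T \<Longrightarrow> \<alpha> \<in> carrier G \<Longrightarrow> y \<in> carrier T \<Longrightarrow> (\<lambda>\<beta>. c x \<alpha> y \<beta>) \<in> semilinear R h G P"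
  shows "multi4 R h T G P c"
  using assms by (simp add: multi4_def)

lemma multi4D:
  assumes "multi4 R h T G P c"
  shows "\<alpha> \<in> carrier G \<Longrightarrow> y \<in> carrier T \<Longrightarrow> \<beta> \<in> carrier G \<Longrightarrow> (\<lambda>x. c x \<alpha> y \<beta>) \<in> semilinear R h T P"
    and "x \<in> carrier T \<Longrightarrow> y \<in> carrier T \<Longrightarrow> \<beta> \<in> carrier G \<Longrightarrow> (\<lambda>\<alpha>. c x \<alpha> y \<beta>) \<in> semilinear R h G P"
    and "x \<in> carrier T \<Longrightarrow> \<alpha> \<in> carrier G \<Longrightarrow> \<beta> \<in> carrier G \<Longrightarrow> (\<lambda>y. c x \<alpha> y \<beta>) \<in> semilinear R h T P"
    and "x \<in> carrier T \<Longrightarrow> \<alpha> \<in> carrier G \<Longrightarrow> y \<in> carrier T \<Longrightarrow> (\<lambda>\<beta>. c x \<alpha> y \<beta>) \<in> semilinear R h G P"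
  using assms by (simp_all add: multi4_def)

lemma multi4_closed:
  "multi4 R h T G P c \<Longrightarrow> x \<in> carrier T \<Longrightarrow> \<alpha> \<in> carrier G \<Longrightarrow> y \<in> carrier T \<Longrightarrow> \<beta> \<in> carrier G
    \<Longrightarrow> c x \<alpha> y \<beta> \<in> carrier P"
  using semilinear_closed[OF multi4D(1)] by fast

lemma multi4_linear_comp:
  assumes c: "multi4 R h T G P c" and k: "k \<in> linear_maps S P Q" and h: "h ` carrier R \<subseteq> carrier S"
  shows "multi4 R h T G Q (\<lambda>x \<alpha> y \<beta>. k (c x \<alpha> y \<beta>))"
  by (intro multi4I linear_comp[OF multi4D(1)[OF c] k h] linear_comp[OF multi4D(2)[OF c] k h]
      linear_comp[OF multi4D(3)[OF c] k h] linear_comp[OF multi4D(4)[OF c] k h])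

text \<open>The variables are grouped in pairs, so that two uses of \<open>ext2\<close> replace four
  nested extensions: the last pair is extended with the first pair held fixed.\<close>

definition ext4 ::
  "('s, 'y) ring_scheme \<Rightarrow> (int, 't) module \<Rightarrow> (int, 'g) module \<Rightarrow> ('s, 'p) module
    \<Rightarrow> ('t \<Rightarrow> 'g \<Rightarrow> 't \<Rightarrow> 'g \<Rightarrow> 'p)
    \<Rightarrow> ('t \<times> 's \<Rightarrow> int) set \<Rightarrow> ('g \<times> 's \<Rightarrow> int) set \<Rightarrow> ('t \<times> 's \<Rightarrow> int) set \<Rightarrow> ('g \<times> 's \<Rightarrow> int) set \<Rightarrow> 'p" where
  "ext4 S T G P c X A Y B = ext2 S T G P (\<lambda>x \<alpha>. ext2 S T G P (c x \<alpha>) Y B) X A"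

context
  fixes S :: "('s, 'y) ring_scheme" and T :: "(int, 't) module" and G :: "(int, 'g) module"
    and P :: "('s, 'p) module"
  assumes S: "cring S" and T: "module \<Z> T" and G: "module \<Z> G" and P: "module S P"
begin

private lemma biadd_inner:
  "multi4 \<Z> (zhom S) T G P c \<Longrightarrow> x \<in> carrier T \<Longrightarrow> \<alpha> \<in> carrier G \<Longrightarrow> biadditive S T G P (c x \<alpha>)"
  by (auto simp: biadditive_def multi4_def)

private lemma biadd_outer:
  assumes c: "multi4 \<Z> (zhom S) T G P c"
    and Y: "Y \<in> carrier (base_change T S)" and B: "B \<in> carrier (base_change G S)"
  shows "biadditive S T G P (\<lambda>x \<alpha>. ext2 S T G P (c x \<alpha>) Y B)"
  unfolding biadditive_def
  by (intro conjI ballI ext2_param[OF S T G P T zhom_image[OF S] _ _ Y B] ext2_param[OF S T G P G zhom_image[OF S] _ _ Y B]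
      biadd_inner[OF c] multi4D(1,2)[OF c])

lemma ext4_multi4:
  assumes c: "multi4 \<Z> (zhom S) T G P c"
  shows "multi4 S (\<lambda>r. r) (base_change T S) (base_change G S) P (ext4 S T G P c)"
proof (rule multi4I; unfold ext4_def)
  note b = ext2_bilinear[OF S T G P biadd_outer[OF c]]
  fix A Y B assume "A \<in> carrier (base_change G S)" "Y \<in> carrier (base_change T S)" "B \<in> carrier (base_change G S)"
  then show "(\<lambda>X. ext2 S T G P (\<lambda>x \<alpha>. ext2 S T G P (c x \<alpha>) Y B) X A) \<in> linear_maps S (base_change T S) P"
    using bilinear_mapD(2)[OF b] by blast
next
  note b = ext2_bilinear[OF S T G P biadd_outer[OF c]]
  fix X Y B assume "X \<in> carrier (base_change T S)" "Y \<in> carrier (base_change T S)" "B \<in> carrier (base_change G S)"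
  then show "(\<lambda>A. ext2 S T G P (\<lambda>x \<alpha>. ext2 S T G P (c x \<alpha>) Y B) X A) \<in> linear_maps S (base_change G S) P"
    using bilinear_mapD(1)[OF b] by blast
next
  note b = ext2_bilinear[OF S T G P biadd_inner[OF c]]
  fix X A B assume X: "X \<in> carrier (base_change T S)" "A \<in> carrier (base_change G S)" "B \<in> carrier (base_change G S)"
  then show "(\<lambda>Y. ext2 S T G P (\<lambda>x \<alpha>. ext2 S T G P (c x \<alpha>) Y B) X A) \<in> linear_maps S (base_change T S) P"
    by (intro ext2_param[OF S T G P module_base_change[OF T S]] biadd_outer[OF c] bilinear_mapD(2)[OF b]) auto
next
  note b = ext2_bilinear[OF S T G P biadd_inner[OF c]]
  fix X A Y assume X: "X \<in> carrier (base_change T S)" "A \<in> carrier (base_change G S)" "Y \<in> carrier (base_change T S)"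
  then show "(\<lambda>B. ext2 S T G P (\<lambda>x \<alpha>. ext2 S T G P (c x \<alpha>) Y B) X A) \<in> linear_maps S (base_change G S) P"
    by (intro ext2_param[OF S T G P module_base_change[OF G S]] biadd_outer[OF c] bilinear_mapD(1)[OF b]) auto
qed

lemma ext4_btens_one:
  assumes c: "multi4 \<Z> (zhom S) T G P c"
    and x: "x \<in> carrier T" and \<alpha>: "\<alpha> \<in> carrier G" and y: "y \<in> carrier T" and \<beta>: "\<beta> \<in> carrier G"
  shows "ext4 S T G P c (btens T S x \<one>\<^bsub>S\<^esub>) (btens G S \<alpha> \<one>\<^bsub>S\<^esub>) (btens T S y \<one>\<^bsub>S\<^esub>) (btens G S \<beta> \<one>\<^bsub>S\<^esub>)
    = c x \<alpha> y \<beta>"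
proof -
  have one: "\<one>\<^bsub>S\<^esub> \<in> carrier S" using S by (simp add: cring.cring_simprules)
  show ?thesis
    unfolding ext4_def
    using ext2_btens_one[OF S T G P biadd_outer[OF c btens_closed[OF T S y one] btens_closed[OF G S \<beta> one]] x \<alpha>]
      ext2_btens_one[OF S T G P biadd_inner[OF c x \<alpha>] y \<beta>] by simp
qed

text \<open>A ternary product has five variables. The parameter \<open>z\<close> will be the fifth,
  in which linearity must survive the extension of the other four.\<close>

lemma ext4_param:
  assumes Z: "module R0 Z" and h: "h ` carrier R0 \<subseteq> carrier S"
    and c: "\<And>z. z \<in> carrier Z \<Longrightarrow> multi4 \<Z> (zhom S) T G P (c z)"
    and z: "\<And>x \<alpha> y \<beta>. x \<in> carrier T \<Longrightarrow> \<alpha> \<in> carrier G \<Longrightarrow> y \<in> carrier T \<Longrightarrow> \<beta> \<in> carrier G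
      \<Longrightarrow> (\<lambda>z. c z x \<alpha> y \<beta>) \<in> semilinear R0 h Z P"
    and X: "X \<in> carrier (base_change T S)" and A: "A \<in> carrier (base_change G S)"
    and Y: "Y \<in> carrier (base_change T S)" and B: "B \<in> carrier (base_change G S)"
  shows "(\<lambda>z. ext4 S T G P (c z) X A Y B) \<in> semilinear R0 h Z P"
  unfolding ext4_def
  by (intro ext2_param[OF S T G P Z h _ _ X A] ext2_param[OF S T G P Z h _ _ Y B]
      biadd_outer[OF c Y B] biadd_inner[OF c] z)

end

section \<open>The S-algebra A \<otimes> S\<close>

lemma base_change_alg_simps:
  "carrier (base_change_alg A S) = carrier (base_change A S)"
  "zero (base_change_alg A S) = zero (base_change A S)"
  "add (base_change_alg A S) = add (base_change A S)"
  "smult (base_change_alg A S) = smult (base_change A S)"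
  "one (base_change_alg A S) = btens A S \<one>\<^bsub>A\<^esub> \<one>\<^bsub>S\<^esub>"
  "add_monoid (base_change_alg A S) = add_monoid (base_change A S)"
  by (simp_all add: base_change_alg_def)

text \<open>\<open>base_change_alg\<close> replaces only the product and the unit of the record, so
  notions that depend on the module structure alone can be moved back to
  \<open>base_change\<close>.\<close>

lemma semilinear_base_change_alg:
  "semilinear R h (base_change_alg A S) N = semilinear R h (base_change A S) N"
  "semilinear R' h' N' (base_change_alg A S) = semilinear R' h' N' (base_change A S)"
  by (simp_all add: semilinear_def base_change_alg_simps)

lemma span_of_base_change_alg: "span_of S (base_change_alg A S) X = span_of S (base_change A S) X"
  by (simp add: span_of_def submodule_def submodule_axioms_def base_change_alg_simps)

lemma bilinear_base_change_alg:
  "bilinear_map S (base_change_alg A S) (base_change_alg A S) (base_change_alg A S) b =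
    bilinear_map S (base_change A S) (base_change A S) (base_change A S) b"
  by (simp add: bilinear_map_def semilinear_base_change_alg base_change_alg_simps)

context
  fixes A :: "(int, 'a) module" and S :: "('s, 'y) ring_scheme"
  assumes A: "S_rng \<Z> A" and S: "cring S"
begin

interpretation A: S_rng \<Z> A by (rule A)
interpretation S: cring S by (rule S)

private lemma Am: "module \<Z> A" by (rule A.module_axioms)

private abbreviation (input) "BA \<equiv> base_change_alg A S"

lemma module_base_change_alg: "module S BA"
  by (rule module_transfer[OF module_base_change[OF Am S]]) (simp_all add: base_change_alg_simps)

private lemma mult_biadditive: "biadditive S A A (base_change A S) (\<lambda>x y. btens A S (x \<otimes>\<^bsub>A\<^esub> y) \<one>\<^bsub>S\<^esub>)"
  unfolding biadditive_def
  by (intro conjI ballI semilinear_linear_comp[OF bilinear_mapD(1)[OF A.bilinear_mult] btens_semilinear[OF Am S]]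
      semilinear_linear_comp[OF bilinear_mapD(2)[OF A.bilinear_mult] btens_semilinear[OF Am S]]) auto

text \<open>The product is a choice and has its specified values only once a witness is given; the
  witness is the S-bilinear extension of (x, y) \<mapsto> x y \<otimes> 1.\<close>

private lemma mult_exists:
  "\<exists>m. bilinear_map S (base_change A S) (base_change A S) (base_change A S) m \<and>
     (\<forall>x\<in>carrier A. \<forall>y\<in>carrier A. \<forall>s\<in>carrier S. \<forall>t\<in>carrier S.
        m (btens A S x s) (btens A S y t) = btens A S (x \<otimes>\<^bsub>A\<^esub> y) (s \<otimes>\<^bsub>S\<^esub> t))"
  using ext2_bilinear[OF S Am Am module_base_change[OF Am S] mult_biadditive]
    ext2_btens[OF S Am Am module_base_change[OF Am S] mult_biadditive]
  by (intro exI[of _ "ext2 S A A (base_change A S) (\<lambda>x y. btens A S (x \<otimes>\<^bsub>A\<^esub> y) \<one>\<^bsub>S\<^esub>)"] conjI)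
    (auto simp: base_change_smult_btens[OF Am S])

lemma base_change_alg_bilinear: "bilinear_map S BA BA BA (monoid.mult BA)"
  and base_change_alg_mult: "x \<in> carrier A \<Longrightarrow> y \<in> carrier A \<Longrightarrow> s \<in> carrier S \<Longrightarrow> t \<in> carrier S
    \<Longrightarrow> btens A S x s \<otimes>\<^bsub>BA\<^esub> btens A S y t = btens A S (x \<otimes>\<^bsub>A\<^esub> y) (s \<otimes>\<^bsub>S\<^esub> t)"
  unfolding bilinear_base_change_alg
  using someI_ex[OF mult_exists] unfolding base_change_alg_def by simp_all

lemma span_of_base_change_alg_carrier: "span_of S BA ((\<lambda>x. btens A S x \<one>\<^bsub>S\<^esub>) ` carrier A) = carrier BA"
  using span_of_base_change_carrier[OF Am S] by (simp add: span_of_base_change_alg base_change_alg_simps)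

lemma S_rng_base_change_alg: "S_rng S BA"
  by (rule S_rng_spanI[OF module_base_change_alg base_change_alg_bilinear span_of_base_change_alg_carrier])
    (auto simp: base_change_alg_mult A.mult_assoc)

end

lemma unital_algebraI:
  assumes "S_rng R A" "\<one>\<^bsub>A\<^esub> \<in> carrier A"
    and "\<And>x. x \<in> carrier A \<Longrightarrow> \<one>\<^bsub>A\<^esub> \<otimes>\<^bsub>A\<^esub> x = x" "\<And>x. x \<in> carrier A \<Longrightarrow> x \<otimes>\<^bsub>A\<^esub> \<one>\<^bsub>A\<^esub> = x"
  shows "unital_algebra R A"
proof -
  interpret S_rng R A by fact
  have "ring A"
    by (rule ringI[OF abelian_group_axioms]) (auto intro!: monoidI simp: assms mult_assoc rng_l_distr rng_r_distr)
  then show ?thesis using assms(1) by (simp add: unital_algebra_def)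
qed

lemma unital_algebra_base_change_alg:
  assumes "unital_algebra \<Z> A" "cring S"
  shows "unital_algebra S (base_change_alg A S)"
proof -
  interpret A: unital_algebra \<Z> A by fact
  interpret S: cring S by fact
  note A = A.S_rng_axioms
  note Am = A.module_axioms
  let ?A = "base_change_alg A S"
  note m = module_base_change_alg[OF A assms(2)]
  have one: "\<one>\<^bsub>?A\<^esub> \<in> carrier ?A"
    by (simp add: base_change_alg_simps btens_closed[OF Am assms(2)])
  note b = base_change_alg_bilinear[OF A assms(2)]
  note sp = span_of_base_change_alg_carrier[OF A assms(2)]
  have "\<one>\<^bsub>?A\<^esub> \<otimes>\<^bsub>?A\<^esub> x = x" if "x \<in> carrier ?A" for x
    by (rule semilinear_eqI[OF sp m m bilinear_mapD(1)[OF b one] linear_ident _ that])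
      (auto simp: base_change_alg_mult[OF A assms(2)] base_change_alg_simps)
  moreover have "x \<otimes>\<^bsub>?A\<^esub> \<one>\<^bsub>?A\<^esub> = x" if "x \<in> carrier ?A" for x
    by (rule semilinear_eqI[OF sp m m bilinear_mapD(2)[OF b one] linear_ident _ that])
      (auto simp: base_change_alg_mult[OF A assms(2)] base_change_alg_simps)
  ultimately show ?thesis
    by (intro unital_algebraI S_rng_base_change_alg A assms(2) one)
qed

section \<open>The algebra O of a multilinear ternary product\<close>

text \<open>The nesting mirrors the bracketing of the fourfold tensor product to the right: the
  innermost lift eliminates the last two factors, and each further lift one more.\<close>

definition lift4 ::
  "('r, 'x) ring_scheme \<Rightarrow> ('r, 't) module \<Rightarrow> ('r, 'g) module \<Rightarrow> ('r, 'p) module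
    \<Rightarrow> ('t \<Rightarrow> 'g \<Rightarrow> 't \<Rightarrow> 'g \<Rightarrow> 'p)
    \<Rightarrow> ('t \<times> ('g \<times> ('t \<times> 'g \<Rightarrow> 'r) set \<Rightarrow> 'r) set \<Rightarrow> 'r) set \<Rightarrow> 'p" where
  "lift4 R T G P c = tlift R T (tensor R G (tensor R T G)) P
     (\<lambda>a Y. tlift R G (tensor R T G) P (\<lambda>\<alpha> Z. tlift R T G P (c a \<alpha>) Z) Y)"

context
  fixes R :: "('r, 'x) ring_scheme" and T :: "('r, 't) module" and G :: "('r, 'g) module"
  assumes T: "module R T" and G: "module R G"
begin

private abbreviation (input) "TG \<equiv> tensor R T G"
private abbreviation (input) "W \<equiv> tensor R G TG"

private lemma TG: "module R TG" by (rule module_tensor[OF T G])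
private lemma W: "module R W" by (rule module_tensor[OF G TG])

lemma module_F_module: "module R (F_module R T G)"
  unfolding F_module_def by (rule module_tensor[OF T W])

lemma tens4_multi4: "multi4 R (\<lambda>r. r) T G (F_module R T G) (tens4 R T G)"
  unfolding tens4_def F_module_def
  by (intro multi4I tens_linear_left[OF T W]
      linear_comp[OF tens_linear_left[OF G TG] tens_linear_right[OF T W]]
      linear_comp[OF linear_comp[OF tens_linear_left[OF T G] tens_linear_right[OF G TG]] tens_linear_right[OF T W]]
      linear_comp[OF linear_comp[OF tens_linear_right[OF T G] tens_linear_right[OF G TG]] tens_linear_right[OF T W]]
      tens_closed[OF G TG] tens_closed[OF T G]) auto

lemma span_of_tens4:
  assumes X: "span_of R T X = carrier T" and Y: "span_of R G Y = carrier G"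
  shows "span_of R (F_module R T G)
    {tens4 R T G a \<alpha> b \<beta> | a \<alpha> b \<beta>. a \<in> X \<and> \<alpha> \<in> Y \<and> b \<in> X \<and> \<beta> \<in> Y} = carrier (F_module R T G)"
proof -
  have "{tens4 R T G a \<alpha> b \<beta> | a \<alpha> b \<beta>. a \<in> X \<and> \<alpha> \<in> Y \<and> b \<in> X \<and> \<beta> \<in> Y} =
    {tens R T W a w | a w. a \<in> X \<and> w \<in> {tens R G TG \<alpha> z | \<alpha> z. \<alpha> \<in> Y \<and>
      z \<in> {tens R T G b \<beta> | b \<beta>. b \<in> X \<and> \<beta> \<in> Y}}}"
    unfolding tens4_def by blast
  then show ?thesis
    using span_of_tens[OF T W X span_of_tens[OF G TG Y span_of_tens[OF T G X Y]]]
    by (simp add: F_module_def)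
qed

context
  fixes P :: "('r, 'p) module"
  assumes P: "module R P"
begin

private lemma bil3:
  "multi4 R (\<lambda>r. r) T G P c \<Longrightarrow> a \<in> carrier T \<Longrightarrow> \<alpha> \<in> carrier G \<Longrightarrow> bilinear_map R T G P (c a \<alpha>)"
  by (auto simp: bilinear_map_def multi4_def)

text \<open>Before the next lift can be formed, the lift already made must be linear in the variable
  standing outside it. \<open>tlift_param\<close> provides this here and again one level further
  out.\<close>

private lemma bil2:
  assumes "multi4 R (\<lambda>r. r) T G P c" "a \<in> carrier T"
  shows "bilinear_map R G TG P (\<lambda>\<alpha> Z. tlift R T G P (c a \<alpha>) Z)"
  by (intro bilinear_mapI tlift_linear[OF T G P bil3[OF assms(1)]] tlift_param[OF T G P G _ bil3[OF assms(1)]] multi4D(2)[OF assms(1)] assms) (use assms in auto)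

private lemma bil1:
  assumes "multi4 R (\<lambda>r. r) T G P c"
  shows "bilinear_map R T W P (\<lambda>a Y. tlift R G TG P (\<lambda>\<alpha> Z. tlift R T G P (c a \<alpha>) Z) Y)"
  by (intro bilinear_mapI tlift_linear[OF G TG P bil2[OF assms]] tlift_param[OF G TG P T _ bil2[OF assms]]
      tlift_param[OF T G P T _ bil3[OF assms]] multi4D(1)[OF assms] assms) auto

lemma lift4_linear:
  assumes "multi4 R (\<lambda>r. r) T G P c"
  shows "lift4 R T G P c \<in> linear_maps R (F_module R T G) P"
  unfolding lift4_def F_module_def by (rule tlift_linear[OF T W P bil1[OF assms]])

lemma lift4_tens4:
  assumes "multi4 R (\<lambda>r. r) T G P c"
    and "a \<in> carrier T" "\<alpha> \<in> carrier G" "b \<in> carrier T" "\<beta> \<in> carrier G"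
  shows "lift4 R T G P c (tens4 R T G a \<alpha> b \<beta>) = c a \<alpha> b \<beta>"
  unfolding lift4_def tens4_def
  by (simp add: tlift_tens[OF T W P bil1] tlift_tens[OF G TG P bil2] tlift_tens[OF T G P bil3]
      tens_closed[OF G TG] tens_closed[OF T G] assms)

text \<open>Applied with the vector of \<open>T\<close> on which F(T, \<Gamma>) acts as parameter,
  this makes the action linear in that vector.\<close>

lemma lift4_param:
  assumes Z: "module R0 Z" and h: "h ` carrier R0 \<subseteq> carrier R"
    and c: "\<And>z. z \<in> carrier Z \<Longrightarrow> multi4 R (\<lambda>r. r) T G P (c z)"
    and z: "\<And>a \<alpha> b \<beta>. a \<in> carrier T \<Longrightarrow> \<alpha> \<in> carrier G \<Longrightarrow> b \<in> carrier T \<Longrightarrow> \<beta> \<in> carrier G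
      \<Longrightarrow> (\<lambda>z. c z a \<alpha> b \<beta>) \<in> semilinear R0 h Z P"
    and X: "X \<in> carrier (F_module R T G)"
  shows "(\<lambda>z. lift4 R T G P (c z) X) \<in> semilinear R0 h Z P"
proof (rule semilinear_param[OF span_of_tens4[OF span_of_carrier[OF T] span_of_carrier[OF G]] module_F_module P Z h _ _ X])
  fix x assume "x \<in> {tens4 R T G a \<alpha> b \<beta> | a \<alpha> b \<beta>.
    a \<in> carrier T \<and> \<alpha> \<in> carrier G \<and> b \<in> carrier T \<and> \<beta> \<in> carrier G}"
  then obtain a \<alpha> b \<beta> where x: "x = tens4 R T G a \<alpha> b \<beta>"
    and el: "a \<in> carrier T" "\<alpha> \<in> carrier G" "b \<in> carrier T" "\<beta> \<in> carrier G" by blast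
  show "(\<lambda>z. lift4 R T G P (c z) x) \<in> semilinear R0 h Z P"
    by (rule semilinear_cong[OF z[OF el] Z]) (simp add: x lift4_tens4[OF c] el)
qed (intro lift4_linear c)

end

end

lemma F_alg_simps:
  "carrier (F_alg R T G q) = carrier (F_module R T G)"
  "zero (F_alg R T G q) = zero (F_module R T G)"
  "add (F_alg R T G q) = add (F_module R T G)"
  "smult (F_alg R T G q) = smult (F_module R T G)"
  "add_monoid (F_alg R T G q) = add_monoid (F_module R T G)"
  by (simp_all add: F_alg_def)

lemma semilinear_F_alg:
  "semilinear S h (F_alg R T G q) N = semilinear S h (F_module R T G) N"
  "semilinear S' h' N' (F_alg R T G q) = semilinear S' h' N' (F_module R T G)"
  by (simp_all add: semilinear_def F_alg_simps)

lemma span_of_F_alg: "span_of S (F_alg R T G q) X = span_of S (F_module R T G) X"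
  by (simp add: span_of_def submodule_def submodule_axioms_def F_alg_simps)

lemma bilinear_F_alg:
  "bilinear_map S (F_alg R T G q) (F_alg R T G q) (F_alg R T G q) b =
    bilinear_map S (F_module R T G) (F_module R T G) (F_module R T G) b"
  by (simp add: bilinear_map_def semilinear_F_alg F_alg_simps)

lemma multi4_F_alg: "multi4 R h T G (F_alg R T G q) c = multi4 R h T G (F_module R T G) c"
  by (simp add: multi4_def semilinear_F_alg)

section \<open>The algebra F(T, \<Gamma>) of a multilinear ternary product\<close>

locale ternary_module =
  fixes R :: "('r, 'x) ring_scheme" and T :: "('r, 't) module" and G :: "('r, 'g) module"
    and q :: "('t, 'g) ternary"
  assumes T: "module R T" and G: "module R G" and multilinear: "multilinear5 R T G q"
begin

abbreviation (input) "F \<equiv> F_module R T G"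
abbreviation (input) "t4 \<equiv> tens4 R T G"
abbreviation (input) "FA \<equiv> F_alg R T G q"

lemma q_linear:
  shows "\<alpha> \<in> carrier G \<Longrightarrow> y \<in> carrier T \<Longrightarrow> \<beta> \<in> carrier G \<Longrightarrow> z \<in> carrier T \<Longrightarrow> (\<lambda>x. q x \<alpha> y \<beta> z) \<in> linear_maps R T T"
    and "x \<in> carrier T \<Longrightarrow> y \<in> carrier T \<Longrightarrow> \<beta> \<in> carrier G \<Longrightarrow> z \<in> carrier T \<Longrightarrow> (\<lambda>\<alpha>. q x \<alpha> y \<beta> z) \<in> linear_maps R G T"
    and "x \<in> carrier T \<Longrightarrow> \<alpha> \<in> carrier G \<Longrightarrow> \<beta> \<in> carrier G \<Longrightarrow> z \<in> carrier T \<Longrightarrow> (\<lambda>y. q x \<alpha> y \<beta> z) \<in> linear_maps R T T"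
    and "x \<in> carrier T \<Longrightarrow> \<alpha> \<in> carrier G \<Longrightarrow> y \<in> carrier T \<Longrightarrow> z \<in> carrier T \<Longrightarrow> (\<lambda>\<beta>. q x \<alpha> y \<beta> z) \<in> linear_maps R G T"
    and "x \<in> carrier T \<Longrightarrow> \<alpha> \<in> carrier G \<Longrightarrow> y \<in> carrier T \<Longrightarrow> \<beta> \<in> carrier G \<Longrightarrow> (\<lambda>z. q x \<alpha> y \<beta> z) \<in> linear_maps R T T"
  using multilinear by (simp_all add: multilinear5_def)

lemma q_closed:
  "x \<in> carrier T \<Longrightarrow> \<alpha> \<in> carrier G \<Longrightarrow> y \<in> carrier T \<Longrightarrow> \<beta> \<in> carrier G \<Longrightarrow> z \<in> carrier T \<Longrightarrow> q x \<alpha> y \<beta> z \<in> carrier T"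
  using semilinear_closed[OF q_linear(1)] by fast

lemma q_multi4: "v \<in> carrier T \<Longrightarrow> multi4 R (\<lambda>r. r) T G T (\<lambda>a \<alpha> b \<beta>. q a \<alpha> b \<beta> v)"
  by (intro multi4I q_linear)

lemmas F_module = module_F_module[OF T G]

lemma t4_closed: "a \<in> carrier T \<Longrightarrow> \<alpha> \<in> carrier G \<Longrightarrow> b \<in> carrier T \<Longrightarrow> \<beta> \<in> carrier G \<Longrightarrow> t4 a \<alpha> b \<beta> \<in> carrier F"
  using multi4_closed[OF tens4_multi4[OF T G]] .

lemma F_alg_module: "module R FA"
  by (rule module_transfer[OF F_module]) (simp_all add: F_alg_simps)

text \<open>The multiplication of \<open>F(T, G)\<close> comes from the action of \<open>F(T, G)\<close> on \<open>T\<close> for which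
  \<open>a \<otimes> \<alpha> \<otimes> b \<otimes> \<beta>\<close> maps \<open>v\<close> to \<open>a \<alpha> b \<beta> v\<close>.\<close>

definition act where
  "act X v = lift4 R T G T (\<lambda>a \<alpha> b \<beta>. q a \<alpha> b \<beta> v) X"

lemma act_t4:
  "a \<in> carrier T \<Longrightarrow> \<alpha> \<in> carrier G \<Longrightarrow> b \<in> carrier T \<Longrightarrow> \<beta> \<in> carrier G \<Longrightarrow> v \<in> carrier T \<Longrightarrow>
    act (t4 a \<alpha> b \<beta>) v = q a \<alpha> b \<beta> v"
  unfolding act_def by (rule lift4_tens4[OF T G T q_multi4])

lemma act_bilinear: "bilinear_map R F T T act"
proof (rule bilinear_mapI)
  fix X assume "X \<in> carrier F"
  then show "act X \<in> linear_maps R T T"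
    unfolding act_def by (intro lift4_param[OF T G T T _ q_multi4 q_linear(5)]) auto
next
  fix v assume "v \<in> carrier T"
  then show "(\<lambda>X. act X v) \<in> linear_maps R F T"
    unfolding act_def by (intro lift4_linear[OF T G T q_multi4])
qed

lemma F_mult_exists:
  "\<exists>m. bilinear_map R F F F m \<and>
     (\<forall>a\<in>carrier T. \<forall>\<alpha>\<in>carrier G. \<forall>b\<in>carrier T. \<forall>\<beta>\<in>carrier G.
      \<forall>c\<in>carrier T. \<forall>\<gamma>\<in>carrier G. \<forall>d\<in>carrier T. \<forall>\<delta>\<in>carrier G.
        m (t4 a \<alpha> b \<beta>) (t4 c \<gamma> d \<delta>) = t4 (q a \<alpha> b \<beta> c) \<gamma> d \<delta>)"
proof -
  let ?W = "tensor R G (tensor R T G)"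
  have TG: "module R (tensor R T G)" by (rule module_tensor[OF T G])
  have W: "module R ?W" by (rule module_tensor[OF G TG])
  \<comment> \<open>A product changes only the first tensor factor of its right argument: X times c
    \<otimes> w is (X acting on c) \<otimes> w. Hence \<open>Y\<close> is lifted as a twofold
    tensor, with the last three factors kept together in \<open>?W\<close>.\<close>
  let ?m = "\<lambda>X Y. tlift R T ?W F (\<lambda>c w. tens R T ?W (act X c) w) Y"
  have actc: "act X c \<in> carrier T" if "X \<in> carrier F" "c \<in> carrier T" for X c
    using semilinear_closed[OF bilinear_mapD(1)[OF act_bilinear]] that by auto
  have b: "bilinear_map R T ?W F (\<lambda>c w. tens R T ?W (act X c) w)" if X: "X \<in> carrier F" for X
  proof (rule bilinear_mapI)
    fix w assume "w \<in> carrier ?W"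
    then show "(\<lambda>c. tens R T ?W (act X c) w) \<in> linear_maps R T F"
      using linear_comp[OF bilinear_mapD(1)[OF act_bilinear X] tens_linear_left[OF T W]] by (simp add: F_module_def)
  next
    fix c assume "c \<in> carrier T"
    then show "(\<lambda>w. tens R T ?W (act X c) w) \<in> linear_maps R ?W F"
      using tens_linear_right[OF T W actc[OF X]] by (simp add: F_module_def)
  qed
  have 1: "bilinear_map R F F F ?m"
  proof (rule bilinear_mapI)
    fix X assume "X \<in> carrier F"
    then show "?m X \<in> linear_maps R F F"
      using tlift_linear[OF T W F_module b] by (simp add: F_module_def)
  next
    fix Y assume Y: "Y \<in> carrier F"
    have "(\<lambda>X. tens R T ?W (act X c) w) \<in> linear_maps R F F" if "c \<in> carrier T" "w \<in> carrier ?W" for c w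
      using linear_comp[OF bilinear_mapD(2)[OF act_bilinear] tens_linear_left[OF T W]] that by (simp add: F_module_def)
    then show "(\<lambda>X. ?m X Y) \<in> linear_maps R F F"
      using Y by (intro tlift_param[OF T W F_module F_module _ b]) (auto simp: F_module_def)
  qed
  have 2: "?m (t4 a \<alpha> b \<beta>) (t4 c \<gamma> d \<delta>) = t4 (q a \<alpha> b \<beta> c) \<gamma> d \<delta>"
    if "a \<in> carrier T" "\<alpha> \<in> carrier G" "b \<in> carrier T" "\<beta> \<in> carrier G"
      "c \<in> carrier T" "\<gamma> \<in> carrier G" "d \<in> carrier T" "\<delta> \<in> carrier G" for a \<alpha> b \<beta> c \<gamma> d \<delta>
    using tlift_tens[OF T W F_module b[OF t4_closed]] that act_t4 unfolding tens4_def
    by (simp add: tens_closed[OF G TG] tens_closed[OF T G])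
  show ?thesis by (rule exI[of _ ?m], intro conjI ballI 1 2)
qed

lemma F_mult_bilinear: "bilinear_map R FA FA FA (monoid.mult FA)"
  and F_mult_t4: "a \<in> carrier T \<Longrightarrow> \<alpha> \<in> carrier G \<Longrightarrow> b \<in> carrier T \<Longrightarrow> \<beta> \<in> carrier G \<Longrightarrow>
    c \<in> carrier T \<Longrightarrow> \<gamma> \<in> carrier G \<Longrightarrow> d \<in> carrier T \<Longrightarrow> \<delta> \<in> carrier G \<Longrightarrow>
    t4 a \<alpha> b \<beta> \<otimes>\<^bsub>FA\<^esub> t4 c \<gamma> d \<delta> = t4 (q a \<alpha> b \<beta> c) \<gamma> d \<delta>"
  unfolding bilinear_F_alg
  using someI_ex[OF F_mult_exists] unfolding F_alg_def by simp_all

lemma F_span: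
  assumes "span_of R T X = carrier T" "span_of R G Y = carrier G"
  shows "span_of R FA {t4 a \<alpha> b \<beta> | a \<alpha> b \<beta>. a \<in> X \<and> \<alpha> \<in> Y \<and> b \<in> X \<and> \<beta> \<in> Y} = carrier FA"
  unfolding span_of_F_alg F_alg_simps by (rule span_of_tens4[OF T G assms])

text \<open>Associativity of \<open>q\<close> says that acting by a product is the composite of the
  two actions. In this form there are three linear arguments instead of nine: the two elements of F
  are freed first, the vector last. Only bilinearity of the product of F is used, so the argument is
  available before F is known to be associative.\<close>

lemma assoc_spanI:
  assumes X: "span_of R T X = carrier T" and Y: "span_of R G Y = carrier G"
    and assoc: "\<And>x \<alpha> y \<beta> z \<gamma> u \<delta> v. \<lbrakk>x \<in> X; \<alpha> \<in> Y; y \<in> X; \<beta> \<in> Y; z \<in> X; \<gamma> \<in> Y; u \<in> X; \<delta> \<in> Y; v \<in> X\<rbrakk>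
      \<Longrightarrow> q (q x \<alpha> y \<beta> z) \<gamma> u \<delta> v = q x \<alpha> y \<beta> (q z \<gamma> u \<delta> v)"
    and x: "x \<in> carrier T" "\<alpha> \<in> carrier G" "y \<in> carrier T" "\<beta> \<in> carrier G" "z \<in> carrier T"
      "\<gamma> \<in> carrier G" "u \<in> carrier T" "\<delta> \<in> carrier G" "v \<in> carrier T"
  shows "q (q x \<alpha> y \<beta> z) \<gamma> u \<delta> v = q x \<alpha> y \<beta> (q z \<gamma> u \<delta> v)"
proof -
  have XT: "X \<subseteq> carrier T" using span_of_superset[of X R T] X by simp
  have YG: "Y \<subseteq> carrier G" using span_of_superset[of Y R G] Y by simp
  have act: "bilinear_map R FA T T act"
    using act_bilinear by (simp add: bilinear_map_def semilinear_F_alg F_alg_simps)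
  have 1: "act (A \<otimes>\<^bsub>FA\<^esub> B) v = act A (act B v)"
    if A: "A \<in> carrier FA" and B: "B \<in> carrier FA" and v: "v \<in> X" for A B v
  proof (rule bilinear_eqI[OF F_span[OF X Y] F_span[OF X Y] F_alg_module F_alg_module T _ _ _ A B,
        where b = "\<lambda>A B. act (A \<otimes>\<^bsub>FA\<^esub> B) v" and c = "\<lambda>A B. act A (act B v)"])
    have vT: "v \<in> carrier T" using XT v by auto
    show "bilinear_map R FA FA T (\<lambda>A B. act (A \<otimes>\<^bsub>FA\<^esub> B) v)"
      by (rule bilinear_comp[OF F_mult_bilinear bilinear_mapD(2)[OF act vT]])
    show "bilinear_map R FA FA T (\<lambda>A B. act A (act B v))"
      using bilinear_comp2[OF act linear_ident bilinear_mapD(2)[OF act vT]] .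
    fix A B
    assume "A \<in> {t4 a \<alpha> b \<beta> | a \<alpha> b \<beta>. a \<in> X \<and> \<alpha> \<in> Y \<and> b \<in> X \<and> \<beta> \<in> Y}"
      "B \<in> {t4 a \<alpha> b \<beta> | a \<alpha> b \<beta>. a \<in> X \<and> \<alpha> \<in> Y \<and> b \<in> X \<and> \<beta> \<in> Y}"
    then obtain a \<alpha> b \<beta> c \<gamma> d \<delta> where AB: "A = t4 a \<alpha> b \<beta>" "B = t4 c \<gamma> d \<delta>"
      and gens: "a \<in> X" "\<alpha> \<in> Y" "b \<in> X" "\<beta> \<in> Y" "c \<in> X" "\<gamma> \<in> Y" "d \<in> X" "\<delta> \<in> Y" by blast
    then have "a \<in> carrier T" "\<alpha> \<in> carrier G" "b \<in> carrier T" "\<beta> \<in> carrier G"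
      "c \<in> carrier T" "\<gamma> \<in> carrier G" "d \<in> carrier T" "\<delta> \<in> carrier G" using XT YG by auto
    then show "act (A \<otimes>\<^bsub>FA\<^esub> B) v = act A (act B v)"
      using assoc[OF gens v] vT by (simp add: AB F_mult_t4 act_t4 q_closed)
  qed
  have 2: "act (A \<otimes>\<^bsub>FA\<^esub> B) v = act A (act B v)"
    if A: "A \<in> carrier FA" and B: "B \<in> carrier FA" and v: "v \<in> carrier T" for A B v
  proof (rule semilinear_eqI[OF X T T _ _ _ v])
    have "A \<otimes>\<^bsub>FA\<^esub> B \<in> carrier FA"
      using semilinear_closed[OF bilinear_mapD(1)[OF F_mult_bilinear A] B] .
    then show "act (A \<otimes>\<^bsub>FA\<^esub> B) \<in> linear_maps R T T" by (rule bilinear_mapD(1)[OF act])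
    show "(\<lambda>v. act A (act B v)) \<in> linear_maps R T T"
      by (rule linear_comp[OF bilinear_mapD(1)[OF act B] bilinear_mapD(1)[OF act A]]) auto
  qed (rule 1[OF A B])
  show ?thesis
    using 2[of "t4 x \<alpha> y \<beta>" "t4 z \<gamma> u \<delta>" v] x
    by (simp add: F_alg_simps t4_closed F_mult_t4 act_t4 q_closed)
qed

end

section \<open>The algebra O(T, \<Gamma>) and maps out of it\<close>

locale assoc_ternary_module = ternary_module +
  assumes assoc: "\<lbrakk>x \<in> carrier T; \<alpha> \<in> carrier G; y \<in> carrier T; \<beta> \<in> carrier G; z \<in> carrier T;
      \<gamma> \<in> carrier G; u \<in> carrier T; \<delta> \<in> carrier G; v \<in> carrier T\<rbrakk>
    \<Longrightarrow> q (q x \<alpha> y \<beta> z) \<gamma> u \<delta> v = q x \<alpha> y \<beta> (q z \<gamma> u \<delta> v)"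
begin

abbreviation (input) "J \<equiv> J_ideal R T G q"
abbreviation (input) "OA \<equiv> O_alg R T G q"
abbreviation (input) "og \<equiv> O_gen R T G q"

text \<open>The two bracketings of three pure tensors differ only in the first factor, where they
  are the two sides of \<open>assoc\<close>.\<close>

lemma S_rng_F_alg: "S_rng R FA"
  by (rule S_rng_spanI[OF F_alg_module F_mult_bilinear F_span[OF span_of_carrier[OF T] span_of_carrier[OF G]]])
    (auto simp: F_mult_t4 q_closed assoc)

interpretation FA: S_rng R FA by (rule S_rng_F_alg)

lemma J_two_sided: "two_sided_ideal R FA J"
  unfolding J_ideal_def
  by (rule FA.ideal_gen_by_ideal)
    (auto simp: middle_relations_def F_alg_simps[symmetric] intro!: FA.minus_closed t4_closed[folded F_alg_simps(1)[of _ _ _ q]] q_closed)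

lemma J_submodule: "submodule J R FA"
  using J_two_sided by (simp add: two_sided_ideal_def)

lemma S_rng_O_alg: "S_rng R OA"
  unfolding O_alg_def by (rule FA.S_rng_quot[OF J_two_sided])

interpretation OA: S_rng R OA by (rule S_rng_O_alg)

lemmas O_proj_linear = quot_proj_linear[OF FA.module_axioms J_submodule, folded O_alg_def]

lemma og_multi4: "multi4 R (\<lambda>r. r) T G OA og"
  unfolding O_gen_def
  by (rule multi4_linear_comp[OF tens4_multi4[OF T G, folded multi4_F_alg[of _ _ _ _ q]] O_proj_linear]) simp

lemma og_mult:
  assumes "a \<in> carrier T" "\<alpha> \<in> carrier G" "b \<in> carrier T" "\<beta> \<in> carrier G"
    "c \<in> carrier T" "\<gamma> \<in> carrier G" "d \<in> carrier T" "\<delta> \<in> carrier G"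
  shows "og a \<alpha> b \<beta> \<otimes>\<^bsub>OA\<^esub> og c \<gamma> d \<delta> = og (q a \<alpha> b \<beta> c) \<gamma> d \<delta>"
  unfolding O_gen_def O_alg_def
  using FA.quot_mult[OF J_two_sided, of "t4 a \<alpha> b \<beta>" "t4 c \<gamma> d \<delta>"] assms
  by (simp add: F_alg_simps t4_closed F_mult_t4)

lemma og_middle:
  assumes "a \<in> carrier T" "\<alpha> \<in> carrier G" "b \<in> carrier T" "\<beta> \<in> carrier G"
    "c \<in> carrier T" "\<gamma> \<in> carrier G" "d \<in> carrier T" "\<delta> \<in> carrier G"
  shows "og (q a \<alpha> b \<beta> c) \<gamma> d \<delta> = og a \<alpha> (q b \<beta> c \<gamma> d) \<delta>"
proof -
  have "t4 (q a \<alpha> b \<beta> c) \<gamma> d \<delta> \<ominus>\<^bsub>FA\<^esub> t4 a \<alpha> (q b \<beta> c \<gamma> d) \<delta> \<in> middle_relations R T G q"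
    unfolding middle_relations_def using assms by blast
  then have "t4 (q a \<alpha> b \<beta> c) \<gamma> d \<delta> \<ominus>\<^bsub>FA\<^esub> t4 a \<alpha> (q b \<beta> c \<gamma> d) \<delta> \<in> J"
    unfolding J_ideal_def ideal_gen_by_def by auto
  then show ?thesis
    unfolding O_gen_def using assms
    by (subst coset_eq_iff[OF FA.module_axioms J_submodule]) (auto simp: F_alg_simps intro!: t4_closed q_closed)
qed

lemma O_span:
  assumes "span_of R T X = carrier T" "span_of R G Y = carrier G"
  shows "span_of R OA {og a \<alpha> b \<beta> | a \<alpha> b \<beta>. a \<in> X \<and> \<alpha> \<in> Y \<and> b \<in> X \<and> \<beta> \<in> Y} = carrier OA"
proof -
  have "{og a \<alpha> b \<beta> | a \<alpha> b \<beta>. a \<in> X \<and> \<alpha> \<in> Y \<and> b \<in> X \<and> \<beta> \<in> Y} =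
    (\<lambda>x. J +>\<^bsub>FA\<^esub> x) ` {t4 a \<alpha> b \<beta> | a \<alpha> b \<beta>. a \<in> X \<and> \<alpha> \<in> Y \<and> b \<in> X \<and> \<beta> \<in> Y}"
    unfolding O_gen_def by blast
  then show ?thesis
    using span_of_quot[OF FA.module_axioms J_submodule F_span[OF assms]] by (simp add: O_alg_def)
qed

lemmas O_span_carrier = O_span[OF span_of_carrier[OF T] span_of_carrier[OF G]]

text \<open>Both sides are linear in each of the eight variables. These are freed from generators in
  pairs, beginning with the last pair, so that \<open>bilinear_eqI\<close> applies at each
  stage.\<close>

lemma middle_spanI:
  assumes P: "module R P" and X: "span_of R T X = carrier T" and Y: "span_of R G Y = carrier G"
    and m: "multi4 R (\<lambda>r. r) T G P f"
    and mid: "\<And>a \<alpha> b \<beta> c \<gamma> d \<delta>. \<lbrakk>a \<in> X; \<alpha> \<in> Y; b \<in> X; \<beta> \<in> Y; c \<in> X; \<gamma> \<in> Y; d \<in> X; \<delta> \<in> Y\<rbrakk>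
      \<Longrightarrow> f (q a \<alpha> b \<beta> c) \<gamma> d \<delta> = f a \<alpha> (q b \<beta> c \<gamma> d) \<delta>"
    and el: "a \<in> carrier T" "\<alpha> \<in> carrier G" "b \<in> carrier T" "\<beta> \<in> carrier G"
      "c \<in> carrier T" "\<gamma> \<in> carrier G" "d \<in> carrier T" "\<delta> \<in> carrier G"
  shows "f (q a \<alpha> b \<beta> c) \<gamma> d \<delta> = f a \<alpha> (q b \<beta> c \<gamma> d) \<delta>"
proof -
  have XT: "x \<in> X \<Longrightarrow> x \<in> carrier T" for x using span_of_superset[of X R T] X by auto
  have YG: "x \<in> Y \<Longrightarrow> x \<in> carrier G" for x using span_of_superset[of Y R G] Y by auto
  note eq = bilinear_eqI[OF X Y T G P]
  note f = multi4D[OF m]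
  \<comment> \<open>In a middle relation \<open>q\<close> stands in the first or in the third slot
    of \<open>f\<close>; these are the linearity facts for the variables inside it.\<close>
  note fq1 = q_linear[THEN semilinear_linear_comp, OF _ _ _ _ f(1)]
  note fq3 = q_linear[THEN semilinear_linear_comp, OF _ _ _ _ f(3)]
  note lin = bilinear_mapI fq1 fq3 f q_closed
  have 1: "f (q a \<alpha> b \<beta> c) \<gamma> d \<delta> = f a \<alpha> (q b \<beta> c \<gamma> d) \<delta>"
    if "a \<in> X" "\<alpha> \<in> Y" "b \<in> X" "\<beta> \<in> Y" "c \<in> X" "\<gamma> \<in> Y" "d \<in> carrier T" "\<delta> \<in> carrier G"
    for a \<alpha> b \<beta> c \<gamma> d \<delta>
    by (rule eq[OF _ _ _ that(7,8), where b = "\<lambda>d \<delta>. f (q a \<alpha> b \<beta> c) \<gamma> d \<delta>"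
          and c = "\<lambda>d \<delta>. f a \<alpha> (q b \<beta> c \<gamma> d) \<delta>"])
      (rule lin mid; use that XT YG in \<open>auto intro!: lin mid\<close>)+
  have 2: "f (q a \<alpha> b \<beta> c) \<gamma> d \<delta> = f a \<alpha> (q b \<beta> c \<gamma> d) \<delta>"
    if "a \<in> X" "\<alpha> \<in> Y" "b \<in> X" "\<beta> \<in> Y" "c \<in> carrier T" "\<gamma> \<in> carrier G" "d \<in> carrier T" "\<delta> \<in> carrier G"
    for a \<alpha> b \<beta> c \<gamma> d \<delta>
    by (rule eq[OF _ _ _ that(5,6), where b = "\<lambda>c \<gamma>. f (q a \<alpha> b \<beta> c) \<gamma> d \<delta>"
          and c = "\<lambda>c \<gamma>. f a \<alpha> (q b \<beta> c \<gamma> d) \<delta>"])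
      (rule lin 1; use that XT YG in \<open>auto intro!: lin\<close>)+
  have 3: "f (q a \<alpha> b \<beta> c) \<gamma> d \<delta> = f a \<alpha> (q b \<beta> c \<gamma> d) \<delta>"
    if "a \<in> X" "\<alpha> \<in> Y" "b \<in> carrier T" "\<beta> \<in> carrier G" "c \<in> carrier T" "\<gamma> \<in> carrier G" "d \<in> carrier T" "\<delta> \<in> carrier G"
    for a \<alpha> b \<beta> c \<gamma> d \<delta>
    by (rule eq[OF _ _ _ that(3,4), where b = "\<lambda>b \<beta>. f (q a \<alpha> b \<beta> c) \<gamma> d \<delta>"
          and c = "\<lambda>b \<beta>. f a \<alpha> (q b \<beta> c \<gamma> d) \<delta>"])
      (rule lin 2; use that XT YG in \<open>auto intro!: lin\<close>)+
  show ?thesis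
    by (rule eq[OF _ _ _ el(1,2), where b = "\<lambda>a \<alpha>. f (q a \<alpha> b \<beta> c) \<gamma> d \<delta>"
          and c = "\<lambda>a \<alpha>. f a \<alpha> (q b \<beta> c \<gamma> d) \<delta>"])
      (rule lin 3; use el XT YG in \<open>auto intro!: lin\<close>)+
qed

text \<open>J is generated as an ideal, so vanishing on the middle relations is enough only when the
  kernel of the lift to F is a two-sided ideal. \<open>mult\<close> ensures this by making that lift
  multiplicative, and \<open>mid\<close> puts the relations into the kernel.\<close>

lemma O_lift:
  assumes P: "S_rng R P" and X: "span_of R T X = carrier T" and Y: "span_of R G Y = carrier G"
    and m: "multi4 R (\<lambda>r. r) T G P f"
    and mult: "\<And>a \<alpha> b \<beta> c \<gamma> d \<delta>. \<lbrakk>a \<in> X; \<alpha> \<in> Y; b \<in> X; \<beta> \<in> Y; c \<in> X; \<gamma> \<in> Y; d \<in> X; \<delta> \<in> Y\<rbrakk>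
      \<Longrightarrow> f (q a \<alpha> b \<beta> c) \<gamma> d \<delta> = f a \<alpha> b \<beta> \<otimes>\<^bsub>P\<^esub> f c \<gamma> d \<delta>"
    and mid: "\<And>a \<alpha> b \<beta> c \<gamma> d \<delta>. \<lbrakk>a \<in> X; \<alpha> \<in> Y; b \<in> X; \<beta> \<in> Y; c \<in> X; \<gamma> \<in> Y; d \<in> X; \<delta> \<in> Y\<rbrakk>
      \<Longrightarrow> f (q a \<alpha> b \<beta> c) \<gamma> d \<delta> = f a \<alpha> (q b \<beta> c \<gamma> d) \<delta>"
  obtains k where "k \<in> linear_maps R OA P"
    "\<And>a \<alpha> b \<beta>. \<lbrakk>a \<in> carrier T; \<alpha> \<in> carrier G; b \<in> carrier T; \<beta> \<in> carrier G\<rbrakk> \<Longrightarrow> k (og a \<alpha> b \<beta>) = f a \<alpha> b \<beta>"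
proof -
  interpret P: S_rng R P by (rule P)
  have XT: "x \<in> X \<Longrightarrow> x \<in> carrier T" for x using span_of_superset[of X R T] X by auto
  have YG: "x \<in> Y \<Longrightarrow> x \<in> carrier G" for x using span_of_superset[of Y R G] Y by auto
  define k0 where "k0 = lift4 R T G P f"
  have k0: "k0 \<in> linear_maps R FA P"
    unfolding k0_def semilinear_F_alg by (rule lift4_linear[OF T G P.module_axioms m])
  have k0_t4: "k0 (t4 a \<alpha> b \<beta>) = f a \<alpha> b \<beta>"
    if "a \<in> carrier T" "\<alpha> \<in> carrier G" "b \<in> carrier T" "\<beta> \<in> carrier G" for a \<alpha> b \<beta>
    unfolding k0_def by (rule lift4_tens4[OF T G P.module_axioms m that])
  \<comment> \<open>By bilinearity the factors may be pure tensors with entries in \<open>X\<close>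
    and \<open>Y\<close>, and then this is \<open>mult\<close>.\<close>
  have k0_mult: "k0 (x \<otimes>\<^bsub>FA\<^esub> y) = k0 x \<otimes>\<^bsub>P\<^esub> k0 y" if "x \<in> carrier FA" "y \<in> carrier FA" for x y
    by (rule multiplicative_spanI[OF FA.module_axioms P.module_axioms FA.bilinear_mult P.bilinear_mult k0
          F_span[OF X Y] _ that])
      (auto simp: F_mult_t4 k0_t4 mult XT YG q_closed)
  have ag: "abelian_group FA" "abelian_group P"
    by (rule FA.abelian_group_axioms P.abelian_group_axioms)+
  let ?K = "{x \<in> carrier FA. k0 x \<in> {\<zero>\<^bsub>P\<^esub>}}"
  have "two_sided_ideal R FA ?K"
    unfolding two_sided_ideal_def
  proof (intro conjI ballI)
    show "submodule ?K R FA"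
      by (rule submodule_preimage[OF FA.module_axioms P.module_axioms k0])
        (auto intro!: P.submoduleI simp: P.a_inv_zero)
  qed (auto simp: k0_mult P.rng_l_null P.rng_r_null semilinear_closed[OF k0])
  moreover have "middle_relations R T G q \<subseteq> ?K"
  proof
    fix u assume "u \<in> middle_relations R T G q"
    then obtain a \<alpha> b \<beta> c \<gamma> d \<delta> where u: "u = t4 (q a \<alpha> b \<beta> c) \<gamma> d \<delta> \<ominus>\<^bsub>FA\<^esub> t4 a \<alpha> (q b \<beta> c \<gamma> d) \<delta>"
      and el: "a \<in> carrier T" "\<alpha> \<in> carrier G" "b \<in> carrier T" "\<beta> \<in> carrier G"
        "c \<in> carrier T" "\<gamma> \<in> carrier G" "d \<in> carrier T" "\<delta> \<in> carrier G"
      unfolding middle_relations_def by blast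
    have cl: "t4 (q a \<alpha> b \<beta> c) \<gamma> d \<delta> \<in> carrier FA" "t4 a \<alpha> (q b \<beta> c \<gamma> d) \<delta> \<in> carrier FA"
      using el by (simp_all add: F_alg_simps t4_closed q_closed)
    have "k0 u = f (q a \<alpha> b \<beta> c) \<gamma> d \<delta> \<ominus>\<^bsub>P\<^esub> f a \<alpha> (q b \<beta> c \<gamma> d) \<delta>"
      using el by (simp add: u semilinear_minus[OF k0 ag cl] k0_t4 q_closed)
    also have "\<dots> = \<zero>\<^bsub>P\<^esub>"
      using middle_spanI[OF P.module_axioms X Y m mid el] multi4_closed[OF m] el
      by (simp add: P.minus_eq_zero_iff q_closed)
    finally show "u \<in> ?K" using FA.minus_closed[OF cl] by (simp add: u)
  qed
  ultimately have "J \<subseteq> ?K" unfolding J_ideal_def ideal_gen_by_def by blast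
  then have "k0 x = \<zero>\<^bsub>P\<^esub>" if "x \<in> J" for x using that by auto
  from quot_lift[OF FA.module_axioms J_submodule P.module_axioms k0 this] obtain k
    where k: "k \<in> linear_maps R (quot FA J) P" "\<And>x. x \<in> carrier FA \<Longrightarrow> k (J +>\<^bsub>FA\<^esub> x) = k0 x"
    by blast
  show ?thesis
    by (rule that[of k]) (use k in \<open>auto simp: O_alg_def O_gen_def F_alg_simps t4_closed k0_t4\<close>)
qed

text \<open>Formulated for any linear map with the given values on generators, because it is applied
  to the chosen map \<open>O_map\<close> and not to the map constructed in
  \<open>O_lift\<close>.\<close>

lemma O_multiplicative:
  assumes P: "S_rng R P" and X: "span_of R T X = carrier T" and Y: "span_of R G Y = carrier G"
    and k: "k \<in> linear_maps R OA P"
    and kf: "\<And>a \<alpha> b \<beta>. \<lbrakk>a \<in> carrier T; \<alpha> \<in> carrier G; b \<in> carrier T; \<beta> \<in> carrier G\<rbrakk> \<Longrightarrow> k (og a \<alpha> b \<beta>) = f a \<alpha> b \<beta>"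
    and mult: "\<And>a \<alpha> b \<beta> c \<gamma> d \<delta>. \<lbrakk>a \<in> X; \<alpha> \<in> Y; b \<in> X; \<beta> \<in> Y; c \<in> X; \<gamma> \<in> Y; d \<in> X; \<delta> \<in> Y\<rbrakk>
      \<Longrightarrow> f (q a \<alpha> b \<beta> c) \<gamma> d \<delta> = f a \<alpha> b \<beta> \<otimes>\<^bsub>P\<^esub> f c \<gamma> d \<delta>"
    and xy: "x \<in> carrier OA" "y \<in> carrier OA"
  shows "k (x \<otimes>\<^bsub>OA\<^esub> y) = k x \<otimes>\<^bsub>P\<^esub> k y"
proof -
  have XT: "x \<in> X \<Longrightarrow> x \<in> carrier T" for x using span_of_superset[of X R T] X by auto
  have YG: "x \<in> Y \<Longrightarrow> x \<in> carrier G" for x using span_of_superset[of Y R G] Y by auto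
  show ?thesis
    by (rule multiplicative_spanI[OF OA.module_axioms S_rng_module[OF P] OA.bilinear_mult S_rng.bilinear_mult[OF P] k
          O_span[OF X Y] _ xy])
      (auto simp: og_mult kf mult XT YG q_closed)
qed

end

section \<open>Functoriality of O along semilinear maps\<close>

context
  fixes R :: "('r, 'x) ring_scheme" and T :: "('r, 't) module" and G :: "('r, 'g) module" and q
    and R' :: "('r2, 'x2) ring_scheme" and T' :: "('r2, 't2) module" and G' :: "('r2, 'g2) module" and q'
    and h f g X Y
  assumes A: "assoc_ternary_module R T G q" and A': "assoc_ternary_module R' T' G' q'"
    and h: "h \<in> ring_hom R R'" and f: "f \<in> semilinear R h T T'" and g: "g \<in> semilinear R h G G'"
    and X: "span_of R T X = carrier T" and Y: "span_of R G Y = carrier G"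
    and hom: "\<And>x \<alpha> y \<beta> z. \<lbrakk>x \<in> X; \<alpha> \<in> Y; y \<in> X; \<beta> \<in> Y; z \<in> X\<rbrakk>
      \<Longrightarrow> f (q x \<alpha> y \<beta> z) = q' (f x) (g \<alpha>) (f y) (g \<beta>) (f z)"
begin

interpretation A: assoc_ternary_module R T G q by (rule A)
interpretation A': assoc_ternary_module R' T' G' q' by (rule A')

private lemma XT: "x \<in> X \<Longrightarrow> x \<in> carrier T" using span_of_superset[of X R T] X by auto
private lemma YG: "x \<in> Y \<Longrightarrow> x \<in> carrier G" using span_of_superset[of Y R G] Y by auto

private abbreviation (input) "c \<equiv> (\<lambda>a \<alpha> b \<beta>. A'.og (f a) (g \<alpha>) (f b) (g \<beta>))"

private lemma c_multi4: "multi4 R (\<lambda>r. r) T G (res_scalars h A'.OA) c"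
proof -
  note fc = semilinear_closed[OF f] and gc = semilinear_closed[OF g]
  note o = multi4D[OF A'.og_multi4]
  show ?thesis
    by (intro multi4I; unfold linear_maps_res_scalars;
        intro linear_comp[OF f o(1)] linear_comp[OF g o(2)] linear_comp[OF f o(3)] linear_comp[OF g o(4)] ring_hom_image h fc gc)
qed

private lemma c_mult:
  assumes "a \<in> X" "\<alpha> \<in> Y" "b \<in> X" "\<beta> \<in> Y" "e \<in> X" "\<gamma> \<in> Y" "d \<in> X" "\<delta> \<in> Y"
  shows "c (q a \<alpha> b \<beta> e) \<gamma> d \<delta> = c a \<alpha> b \<beta> \<otimes>\<^bsub>res_scalars h A'.OA\<^esub> c e \<gamma> d \<delta>"
    and "c (q a \<alpha> b \<beta> e) \<gamma> d \<delta> = c a \<alpha> (q b \<beta> e \<gamma> d) \<delta>"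
  using A'.og_mult[of "f a" "g \<alpha>" "f b" "g \<beta>" "f e" "g \<gamma>" "f d" "g \<delta>"]
    A'.og_middle[of "f a" "g \<alpha>" "f b" "g \<beta>" "f e" "g \<gamma>" "f d" "g \<delta>"] assms
  by (simp_all add: hom XT YG semilinear_closed[OF f] semilinear_closed[OF g])

private lemma P: "S_rng R (res_scalars h A'.OA)"
  by (rule S_rng_res_scalars[OF module_cring[OF A.T] A'.S_rng_O_alg h])

text \<open>Restricting the target along \<open>h\<close> turns the semilinear problem into an
  instance of \<open>O_lift\<close>. Compatibility with the ternary products is asked for on
  spanning sets only, since over \<open>S\<close> the extended product is explicitly known just on
  the elements a \<otimes> 1.\<close>

lemma O_map_exists:
  "\<exists>k. k \<in> semilinear R h A.OA A'.OA \<and>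
    (\<forall>a\<in>carrier T. \<forall>\<alpha>\<in>carrier G. \<forall>b\<in>carrier T. \<forall>\<beta>\<in>carrier G.
      k (A.og a \<alpha> b \<beta>) = A'.og (f a) (g \<alpha>) (f b) (g \<beta>))"
proof -
  obtain k where "k \<in> semilinear R h A.OA A'.OA"
    "\<And>a \<alpha> b \<beta>. \<lbrakk>a \<in> carrier T; \<alpha> \<in> carrier G; b \<in> carrier T; \<beta> \<in> carrier G\<rbrakk> \<Longrightarrow> k (A.og a \<alpha> b \<beta>) = c a \<alpha> b \<beta>"
    using A.O_lift[OF P X Y c_multi4 c_mult, of thesis] unfolding linear_maps_res_scalars by blast
  then show ?thesis by (intro exI[of _ k] conjI ballI)
qed

lemma O_map_semilinear: "O_map R T G q R' T' G' q' h f g \<in> semilinear R h A.OA A'.OA"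
  and O_map_gen: "a \<in> carrier T \<Longrightarrow> \<alpha> \<in> carrier G \<Longrightarrow> b \<in> carrier T \<Longrightarrow> \<beta> \<in> carrier G \<Longrightarrow>
    O_map R T G q R' T' G' q' h f g (A.og a \<alpha> b \<beta>) = A'.og (f a) (g \<alpha>) (f b) (g \<beta>)"
  using someI_ex[OF O_map_exists] unfolding O_map_def by auto

lemma O_map_mult:
  assumes "x \<in> carrier A.OA" "y \<in> carrier A.OA"
  shows "O_map R T G q R' T' G' q' h f g (x \<otimes>\<^bsub>A.OA\<^esub> y) =
    O_map R T G q R' T' G' q' h f g x \<otimes>\<^bsub>A'.OA\<^esub> O_map R T G q R' T' G' q' h f g y"
  using A.O_multiplicative[OF P X Y _ O_map_gen c_mult(1) assms] O_map_semilinear by simp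

end

lemma ring_hom_ident: "(\<lambda>x. x) \<in> ring_hom R R"
  by (rule ring_hom_memI) auto

lemma hom_linear_zmod:
  assumes "abelian_group A" "abelian_group B" "f \<in> hom (add_monoid A) (add_monoid B)"
  shows "f \<in> linear_maps \<Z> (zmod A) (zmod B)"
  by (rule hom_semilinear_int[OF module_zmod[OF assms(1)] module_zmod[OF assms(2)] ring_hom_ident])
    (use assms(3) in \<open>simp add: hom_def\<close>)

text \<open>Initiality of \<int>. It identifies semilinearity along \<int> \<rightarrow> S
  \<rightarrow> S' with semilinearity along \<int> \<rightarrow> S' in the naturality
  squares.\<close>

lemma ring_hom_zhom:
  assumes "cring S" "cring S'" "h \<in> ring_hom S S'"
  shows "h (zhom S k) = zhom S' k"
proof -
  interpret S: cring S by fact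
  interpret S': cring S' by fact
  have "h \<in> hom (add_monoid S) (add_monoid S')"
    using assms(3) by (auto simp: ring_hom_def hom_def)
  from hom_int_pow[OF this _ S.a_group S'.a_group, of "\<one>\<^bsub>S\<^esub>" k] show ?thesis
    using assms(3) by (simp add: add_pow_def ring_hom_one)
qed

section \<open>Semidirect products\<close>

lemma semidirect_simps:
  "carrier (semidirect R A) = carrier R \<times> carrier A"
  "(n, r) \<otimes>\<^bsub>semidirect R A\<^esub> (m, s) =
     (n \<otimes>\<^bsub>R\<^esub> m, n \<odot>\<^bsub>A\<^esub> s \<oplus>\<^bsub>A\<^esub> m \<odot>\<^bsub>A\<^esub> r \<oplus>\<^bsub>A\<^esub> r \<otimes>\<^bsub>A\<^esub> s)"
  "one (semidirect R A) = (\<one>\<^bsub>R\<^esub>, \<zero>\<^bsub>A\<^esub>)" "zero (semidirect R A) = (\<zero>\<^bsub>R\<^esub>, \<zero>\<^bsub>A\<^esub>)"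
  "(n, r) \<oplus>\<^bsub>semidirect R A\<^esub> (m, s) = (n \<oplus>\<^bsub>R\<^esub> m, r \<oplus>\<^bsub>A\<^esub> s)"
  "k \<odot>\<^bsub>semidirect R A\<^esub> (n, r) = (k \<otimes>\<^bsub>R\<^esub> n, k \<odot>\<^bsub>A\<^esub> r)"
  by (simp_all add: semidirect_def)

context
  fixes R :: "('r, 'x) ring_scheme" and A :: "('r, 'a) module"
  assumes A: "S_rng R A"
begin

interpretation A: S_rng R A by (rule A)

lemma module_semidirect: "module R (semidirect R A)"
proof -
  have "abelian_group (semidirect R A)"
  proof (rule abelian_groupI)
    fix x assume "x \<in> carrier (semidirect R A)"
    then show "\<exists>y\<in>carrier (semidirect R A). y \<oplus>\<^bsub>semidirect R A\<^esub> x = \<zero>\<^bsub>semidirect R A\<^esub>"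
      by (intro bexI[of _ "(\<ominus>\<^bsub>R\<^esub> fst x, \<ominus>\<^bsub>A\<^esub> snd x)"]) (auto simp: semidirect_simps A.R.l_neg A.M.l_neg)
  qed (auto simp: semidirect_simps A.R.a_ac A.M.a_ac)
  then show ?thesis
    by (intro moduleI A.R.is_cring)
      (auto simp: semidirect_simps A.R.l_distr A.R.r_distr A.R.m_assoc A.smult_l_distr A.smult_r_distr A.smult_assoc1)
qed

lemma S_rng_semidirect: "S_rng R (semidirect R A)"
proof (intro S_rngI bilinear_mapI semilinearI module_semidirect)
  fix x y z
  assume "x \<in> carrier (semidirect R A)" "y \<in> carrier (semidirect R A)" "z \<in> carrier (semidirect R A)"
  then show "x \<otimes>\<^bsub>semidirect R A\<^esub> y \<otimes>\<^bsub>semidirect R A\<^esub> z =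
      x \<otimes>\<^bsub>semidirect R A\<^esub> (y \<otimes>\<^bsub>semidirect R A\<^esub> z)"
    by (auto simp: semidirect_simps A.R.m_ac A.smult_r_distr A.smult_assoc1[symmetric] A.rng_l_distr A.rng_r_distr
        A.rng_smult_l A.rng_smult_r A.mult_assoc A.M.a_ac)
qed (auto simp: semidirect_simps A.R.l_distr A.R.r_distr A.R.m_ac A.smult_l_distr A.smult_r_distr
      A.smult_assoc1[symmetric] A.rng_l_distr A.rng_r_distr A.rng_smult_l A.rng_smult_r A.M.a_ac)

lemma unital_algebra_semidirect: "unital_algebra R (semidirect R A)"
  by (rule unital_algebraI[OF S_rng_semidirect]) (auto simp: semidirect_simps A.rng_l_null A.rng_r_null)

lemma semidirect_incl_linear: "(\<lambda>r. (\<zero>\<^bsub>R\<^esub>, r)) \<in> linear_maps R A (semidirect R A)"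
  by (rule semilinearI) (auto simp: semidirect_simps)

end

lemma map_prod_semilinear:
  assumes "h \<in> ring_hom R R'" "k \<in> semilinear R h A A'"
  shows "map_prod h k \<in> semilinear R h (semidirect R A) (semidirect R' A')"
  using ring_hom_memE[OF assms(1)]
  by (intro semilinearI)
    (auto simp: semidirect_simps semilinear_closed[OF assms(2)] semilinear_add[OF assms(2)] semilinear_smult[OF assms(2)])

text \<open>Multiplicativity of \<open>k\<close> settles the term r s; for the mixed terms n s and m
  r semilinearity of \<open>k\<close> is what matters, as it turns the scalars \<open>n\<close> and
  \<open>m\<close> into their images under \<open>h\<close>.\<close>

lemma map_prod_mult:
  assumes A: "S_rng R A" and A': "S_rng R' A'" and h: "h \<in> ring_hom R R'" and k: "k \<in> semilinear R h A A'"
    and mult: "\<And>x y. x \<in> carrier A \<Longrightarrow> y \<in> carrier A \<Longrightarrow> k (x \<otimes>\<^bsub>A\<^esub> y) = k x \<otimes>\<^bsub>A'\<^esub> k y"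
    and x: "x \<in> carrier (semidirect R A)" and y: "y \<in> carrier (semidirect R A)"
  shows "map_prod h k (x \<otimes>\<^bsub>semidirect R A\<^esub> y) = map_prod h k x \<otimes>\<^bsub>semidirect R' A'\<^esub> map_prod h k y"
proof -
  interpret A: S_rng R A by (rule A)
  show ?thesis
    using x y ring_hom_memE[OF h]
    by (auto simp: semidirect_simps semilinear_add[OF k] semilinear_smult[OF k] mult)
qed

section \<open>Functoriality of the extension of scalars\<close>

text \<open>The elements x \<otimes> 1 span, and on them the extension takes the values of
  \<open>i\<close>, so multiplicativity of \<open>i\<close> is all that has to be known.\<close>

lemma linear_extension_mult:
  assumes A: "S_rng \<Z> A" and S: "cring S" and N: "S_rng S N"
    and i: "i \<in> semilinear \<Z> (zhom S) A N"
    and mult: "\<And>x y. x \<in> carrier A \<Longrightarrow> y \<in> carrier A \<Longrightarrow> i (x \<otimes>\<^bsub>A\<^esub> y) = i x \<otimes>\<^bsub>N\<^esub> i y"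
    and x: "x \<in> carrier (base_change_alg A S)" and y: "y \<in> carrier (base_change_alg A S)"
  shows "linear_extension A S N i (x \<otimes>\<^bsub>base_change_alg A S\<^esub> y) =
    linear_extension A S N i x \<otimes>\<^bsub>N\<^esub> linear_extension A S N i y"
proof -
  interpret A: S_rng \<Z> A by (rule A)
  interpret S: cring S by (rule S)
  note Am = A.module_axioms and Nm = S_rng_module[OF N]
  show ?thesis
    by (rule multiplicative_spanI[OF module_base_change_alg[OF A S] Nm base_change_alg_bilinear[OF A S]
          S_rng.bilinear_mult[OF N] _ span_of_base_change_alg_carrier[OF A S] _ x y])
      (auto simp: semilinear_base_change_alg linear_extension_linear[OF Am S Nm i] base_change_alg_mult[OF A S]
        linear_extension_btens_one[OF Am S Nm i] mult)
qed

context
  fixes M :: "(int, 'm) module" and S :: "('s, 'y) ring_scheme"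
    and M' :: "(int, 'm2) module" and S' :: "('s2, 'y2) ring_scheme" and f h
  assumes M: "module \<Z> M" and S: "cring S" and M': "module \<Z> M'" and S': "cring S'"
    and f: "f \<in> linear_maps \<Z> M M'" and h: "h \<in> ring_hom S S'"
begin

interpretation S: cring S by (rule S)
interpretation S': cring S' by (rule S')

private lemma Zm: "module \<Z> (zmod S)" "module \<Z> (zmod S')"
  by (rule module_zmod S.abelian_group_axioms S'.abelian_group_axioms)+

private lemma h_linear: "h \<in> linear_maps \<Z> (zmod S) (zmod S')"
  by (rule hom_linear_zmod[OF S.abelian_group_axioms S'.abelian_group_axioms])
    (use h in \<open>auto simp: ring_hom_def hom_def\<close>)

private lemma k_linear: "base_change_map M S M' S' f h \<in> linear_maps \<Z> (tensor \<Z> M (zmod S)) (tensor \<Z> M' (zmod S'))"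
  unfolding base_change_map_def by (rule tensor_map_linear[OF M Zm(1) M' Zm(2) f h_linear])

lemma base_change_map_btens:
  "x \<in> carrier M \<Longrightarrow> s \<in> carrier S \<Longrightarrow>
    base_change_map M S M' S' f h (btens M S x s) = btens M' S' (f x) (h s)"
  unfolding base_change_map_def by (rule tensor_map_tens[OF M Zm(1) M' Zm(2) f h_linear]) auto

text \<open>As a tensor product of additive maps this map is only additive. On pure tensors its
  compatibility with scalars is multiplicativity of \<open>h\<close>, and an additive comparison
  then covers all tensors.\<close>

lemma base_change_map_semilinear:
  "base_change_map M S M' S' f h \<in> semilinear S h (base_change M S) (base_change M' S')"
proof (rule semilinearI)
  note hc = ring_hom_memE(1)[OF h]
  fix s X assume s: "s \<in> carrier S" and X: "X \<in> carrier (base_change M S)"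
  show "base_change_map M S M' S' f h (s \<odot>\<^bsub>base_change M S\<^esub> X) =
    h s \<odot>\<^bsub>base_change M' S'\<^esub> base_change_map M S M' S' f h X"
  proof (rule semilinear_eqI[OF span_of_pure_tensors[OF M Zm(1)] module_tensor[OF M Zm(1)] module_tensor[OF M' Zm(2)]])
    show "(\<lambda>X. base_change_map M S M' S' f h (s \<odot>\<^bsub>base_change M S\<^esub> X)) \<in>
        linear_maps \<Z> (tensor \<Z> M (zmod S)) (tensor \<Z> M' (zmod S'))"
      by (rule semilinear_linear_comp[OF base_change_smult_linear_int[OF M S s] k_linear])
    show "(\<lambda>X. h s \<odot>\<^bsub>base_change M' S'\<^esub> base_change_map M S M' S' f h X) \<in>
        linear_maps \<Z> (tensor \<Z> M (zmod S)) (tensor \<Z> M' (zmod S'))"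
      by (rule semilinear_linear_comp[OF k_linear base_change_smult_linear_int[OF M' S' hc[OF s]]])
    show "X \<in> carrier (tensor \<Z> M (zmod S))" using X by (simp add: base_change_simps)
    fix Y assume "Y \<in> {tens \<Z> M (zmod S) x y | x y. x \<in> carrier M \<and> y \<in> carrier (zmod S)}"
    then show "base_change_map M S M' S' f h (s \<odot>\<^bsub>base_change M S\<^esub> Y) =
        h s \<odot>\<^bsub>base_change M' S'\<^esub> base_change_map M S M' S' f h Y"
      using s by (auto simp: base_change_smult_btens[OF M S] base_change_smult_btens[OF M' S'] base_change_map_btens
          hc semilinear_closed[OF f] ring_hom_memE(2)[OF h])
  qed
qed (use semilinear_closed[OF k_linear] semilinear_add[OF k_linear] in \<open>auto simp: base_change_simps\<close>)

text \<open>Both paths of the square are semilinear along \<open>h\<close>, so it commutes once it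
  does on the elements x \<otimes> 1, where it is the hypothesis \<open>eq\<close>. The squares for
  O and for A are both instances.\<close>

lemma linear_extension_natural:
  assumes N: "module S N" and N': "module S' N'"
    and i: "i \<in> semilinear \<Z> (zhom S) M N" and i': "i' \<in> semilinear \<Z> (zhom S') M' N'"
    and k: "k \<in> semilinear S h N N'" and eq: "\<And>x. x \<in> carrier M \<Longrightarrow> k (i x) = i' (f x)"
    and X: "X \<in> carrier (base_change M S)"
  shows "linear_extension M' S' N' i' (base_change_map M S M' S' f h X) = k (linear_extension M S N i X)"
proof (rule semilinear_eqI[OF span_of_base_change_carrier[OF M S] module_base_change[OF M S] N' _ _ _ X])
  show "(\<lambda>X. linear_extension M' S' N' i' (base_change_map M S M' S' f h X)) \<in> semilinear S h (base_change M S) N'"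
    by (rule linear_comp[OF base_change_map_semilinear linear_extension_linear[OF M' S' N' i'] ring_hom_image[OF h]])
  show "(\<lambda>X. k (linear_extension M S N i X)) \<in> semilinear S h (base_change M S) N'"
    by (rule semilinear_linear_comp[OF linear_extension_linear[OF M S N i] k])
qed (auto simp: base_change_map_btens ring_hom_one[OF h] linear_extension_btens_one[OF M S N i]
    linear_extension_btens_one[OF M' S' N' i'] semilinear_closed[OF f] eq)

end

section \<open>The comparison isomorphisms\<close>

lemma bij_betw_linear_inverse:
  assumes "c \<in> linear_maps S M N" "\<psi> \<in> linear_maps S N M"
    "\<And>X. X \<in> carrier M \<Longrightarrow> \<psi> (c X) = X" "\<And>Y. Y \<in> carrier N \<Longrightarrow> c (\<psi> Y) = Y"
  shows "bij_betw c (carrier M) (carrier N)"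
  by (rule bij_betw_byWitness[where f' = \<psi>])
    (use assms(3,4) semilinear_closed[OF assms(1)] semilinear_closed[OF assms(2)] in auto)

lemma ternary_gamma_ring_module:
  assumes "ternary_gamma_ring T G tp"
  shows "assoc_ternary_module \<Z> (zmod T) (zmod G) tp"
proof -
  interpret ternary_gamma_ring T G tp by fact
  note ag = T.abelian_group_axioms G.abelian_group_axioms
  note lin = hom_linear_zmod[OF ag(1) ag(1)] hom_linear_zmod[OF ag(2) ag(1)]
  have "multilinear5 \<Z> (zmod T) (zmod G) tp"
    unfolding multilinear5_def
    by (intro conjI ballI lin additive1 additive2 additive3 additive4 additive5; simp)
  then have 1: "ternary_module \<Z> (zmod T) (zmod G) tp"
    by (intro ternary_module.intro module_zmod ag)
  show ?thesis
    by (intro assoc_ternary_module.intro 1 assoc_ternary_module_axioms.intro)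
      (simp add: ternary_assoc[THEN conjunct1] ternary_assoc[THEN conjunct2])
qed

section \<open>The ternary product on \<open>T\<^sub>S\<close> and
  \<open>\<Gamma>\<^sub>S\<close>\<close>

locale scalar_extension =
  fixes T :: "('t, 'x) ring_scheme" and G :: "('g, 'y) ring_scheme" and tp :: "('t, 'g) ternary"
    and S :: "('s, 'z) ring_scheme"
  assumes tgr: "ternary_gamma_ring T G tp" and S: "cring S"
begin

abbreviation (input) "TS \<equiv> base_change (zmod T) S"
abbreviation (input) "GS \<equiv> base_change (zmod G) S"
abbreviation (input) "tpS \<equiv> ternary_ext (zmod T) (zmod G) tp S"
abbreviation (input) bT where "bT x \<equiv> btens (zmod T) S x \<one>\<^bsub>S\<^esub>"
abbreviation (input) bG where "bG x \<equiv> btens (zmod G) S x \<one>\<^bsub>S\<^esub>"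
abbreviation (input) "ogZ \<equiv> O_gen \<Z> (zmod T) (zmod G) tp"
abbreviation (input) "ogS \<equiv> O_gen S TS GS tpS"

lemma integral_ternary: "assoc_ternary_module \<Z> (zmod T) (zmod G) tp"
  by (rule ternary_gamma_ring_module[OF tgr])

interpretation Z: assoc_ternary_module \<Z> "zmod T" "zmod G" tp by (rule integral_ternary)
interpretation S: cring S by (rule S)

lemmas TS_module = module_base_change[OF Z.T S]
lemmas GS_module = module_base_change[OF Z.G S]
lemmas TS_span = span_of_base_change_carrier[OF Z.T S, simplified]
lemmas GS_span = span_of_base_change_carrier[OF Z.G S, simplified]

lemma bT_semilinear: "bT \<in> semilinear \<Z> (zhom S) (zmod T) TS" and bG_semilinear: "bG \<in> semilinear \<Z> (zhom S) (zmod G) GS"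
  using btens_semilinear[OF Z.T S] btens_semilinear[OF Z.G S] by auto

lemma bT_closed: "x \<in> carrier T \<Longrightarrow> bT x \<in> carrier TS" and bG_closed: "\<alpha> \<in> carrier G \<Longrightarrow> bG \<alpha> \<in> carrier GS"
  using btens_closed[OF Z.T S] btens_closed[OF Z.G S] by auto

lemma ternary_ext_exists:
  "\<exists>q. multilinear5 S TS GS q \<and>
     (\<forall>x\<in>carrier (zmod T). \<forall>\<alpha>\<in>carrier (zmod G). \<forall>y\<in>carrier (zmod T). \<forall>\<beta>\<in>carrier (zmod G). \<forall>z\<in>carrier (zmod T).
        q (bT x) (bG \<alpha>) (bT y) (bG \<beta>) (bT z) = bT (tp x \<alpha> y \<beta> z))"
proof -
  \<comment> \<open>\<open>?E\<close> extends the last variable while the other four stay in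
    \<open>T\<close> and \<open>G\<close>. It is additive in those four, so \<open>ext4\<close>
    extends them with \<open>Z\<close> as a parameter, and \<open>ext4_param\<close> keeps linearity
    in \<open>Z\<close>.\<close>
  let ?E = "\<lambda>Z x \<alpha> y \<beta>. linear_extension (zmod T) S TS (\<lambda>z. bT (tp x \<alpha> y \<beta> z)) Z"
  let ?q = "\<lambda>X A Y B Z. ext4 S (zmod T) (zmod G) TS (?E Z) X A Y B"
  note lin = Z.q_linear[THEN semilinear_linear_comp, OF _ _ _ _ bT_semilinear]
  have E: "multi4 \<Z> (zhom S) (zmod T) (zmod G) TS (?E Z)" if "Z \<in> carrier TS" for Z
    by (intro multi4I linear_extension_param[OF Z.T S TS_module Z.T zhom_image[OF S] _ _ that]
        linear_extension_param[OF Z.T S TS_module Z.G zhom_image[OF S] _ _ that] lin)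
  have E5: "(\<lambda>Z. ?E Z x \<alpha> y \<beta>) \<in> linear_maps S TS TS"
    if "x \<in> carrier (zmod T)" "\<alpha> \<in> carrier (zmod G)" "y \<in> carrier (zmod T)" "\<beta> \<in> carrier (zmod G)" for x \<alpha> y \<beta>
    by (rule linear_extension_linear[OF Z.T S TS_module lin(5)[OF that]])
  note q4 = multi4D[OF ext4_multi4[OF S Z.T Z.G TS_module E]]
  have q5: "(\<lambda>Z. ?q X A Y B Z) \<in> linear_maps S TS TS"
    if "X \<in> carrier TS" "A \<in> carrier GS" "Y \<in> carrier TS" "B \<in> carrier GS" for X A Y B
    by (rule ext4_param[OF S Z.T Z.G TS_module TS_module _ E E5 that]) auto
  have "multilinear5 S TS GS ?q"
    unfolding multilinear5_def by (intro conjI ballI q4 q5)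
  moreover have "?q (bT x) (bG \<alpha>) (bT y) (bG \<beta>) (bT z) = bT (tp x \<alpha> y \<beta> z)"
    if el: "x \<in> carrier (zmod T)" "\<alpha> \<in> carrier (zmod G)" "y \<in> carrier (zmod T)" "\<beta> \<in> carrier (zmod G)" "z \<in> carrier (zmod T)"
    for x \<alpha> y \<beta> z
    using ext4_btens_one[OF S Z.T Z.G TS_module E[OF bT_closed], of z x \<alpha> y \<beta>]
      linear_extension_btens_one[OF Z.T S TS_module lin(5)[OF el(1-4)] el(5)] el by simp
  ultimately show ?thesis by blast
qed

lemma tpS_multilinear: "multilinear5 S TS GS tpS"
  and tpS_bT: "x \<in> carrier T \<Longrightarrow> \<alpha> \<in> carrier G \<Longrightarrow> y \<in> carrier T \<Longrightarrow> \<beta> \<in> carrier G \<Longrightarrow> z \<in> carrier T \<Longrightarrow>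
    tpS (bT x) (bG \<alpha>) (bT y) (bG \<beta>) (bT z) = bT (tp x \<alpha> y \<beta> z)"
  using someI_ex[OF ternary_ext_exists] unfolding ternary_ext_def by simp_all

lemmas tp_closed = Z.q_closed[simplified]

text \<open>On the spanning elements a \<otimes> 1 and \<alpha> \<otimes> 1 the extended product is
  computed by \<open>tp\<close>, so \<open>assoc_spanI\<close> transfers associativity from the
  integral product.\<close>

lemma extended_ternary: "assoc_ternary_module S TS GS tpS"
proof -
  have E: "ternary_module S TS GS tpS"
    by (intro ternary_module.intro TS_module GS_module tpS_multilinear)
  show ?thesis
  proof (intro assoc_ternary_module.intro E assoc_ternary_module_axioms.intro)
    fix x \<alpha> y \<beta> z \<gamma> u \<delta> v
    assume el: "x \<in> carrier TS" "\<alpha> \<in> carrier GS" "y \<in> carrier TS" "\<beta> \<in> carrier GS" "z \<in> carrier TS"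
      "\<gamma> \<in> carrier GS" "u \<in> carrier TS" "\<delta> \<in> carrier GS" "v \<in> carrier TS"
    show "tpS (tpS x \<alpha> y \<beta> z) \<gamma> u \<delta> v = tpS x \<alpha> y \<beta> (tpS z \<gamma> u \<delta> v)"
      by (rule ternary_module.assoc_spanI[OF E TS_span GS_span _ el]) (use Z.assoc in \<open>auto simp: tpS_bT tp_closed\<close>)
  qed
qed

interpretation E: assoc_ternary_module S TS GS tpS by (rule extended_ternary)

section \<open>The comparison map for O\<close>

abbreviation (input) "OZr \<equiv> OZ T G tp"
abbreviation (input) "OSr \<equiv> OS T G tp S"
abbreviation (input) "AZr \<equiv> AZ T G tp"
abbreviation (input) "ASr \<equiv> AS T G tp S"
abbreviation (input) "iO \<equiv> O_map \<Z> (zmod T) (zmod G) tp S TS GS tpS (zhom S) bT bG"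
abbreviation (input) "iA \<equiv> A_map \<Z> (zmod T) (zmod G) tp S TS GS tpS (zhom S) bT bG"
abbreviation (input) "cO \<equiv> O_comparison T G tp S"
abbreviation (input) "cA \<equiv> A_comparison T G tp S"

lemma OZ_S_rng: "S_rng \<Z> OZr" unfolding OZ_def by (rule Z.S_rng_O_alg)
lemma OS_S_rng: "S_rng S OSr" unfolding OS_def by (rule E.S_rng_O_alg)
lemmas OZ_module = S_rng_module[OF OZ_S_rng]
lemmas OS_module = S_rng_module[OF OS_S_rng]

lemma AZ_semidirect: "AZr = semidirect \<Z> OZr" by (simp add: AZ_def A_alg_def OZ_def)
lemma AS_semidirect: "ASr = semidirect S OSr" by (simp add: AS_def A_alg_def OS_def)

lemma AZ_unital: "unital_algebra \<Z> AZr"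
  unfolding AZ_semidirect by (rule unital_algebra_semidirect[OF OZ_S_rng])
lemma AS_unital: "unital_algebra S ASr"
  unfolding AS_semidirect by (rule unital_algebra_semidirect[OF OS_S_rng])
lemma AZ_S_rng: "S_rng \<Z> AZr"
  unfolding AZ_semidirect by (rule S_rng_semidirect[OF OZ_S_rng])
lemma AS_S_rng: "S_rng S ASr"
  unfolding AS_semidirect by (rule S_rng_semidirect[OF OS_S_rng])
lemmas AZ_module = S_rng_module[OF AZ_S_rng]
lemmas AS_module = S_rng_module[OF AS_S_rng]

lemma iO_hom: "\<lbrakk>x \<in> carrier (zmod T); \<alpha> \<in> carrier (zmod G); y \<in> carrier (zmod T); \<beta> \<in> carrier (zmod G); z \<in> carrier (zmod T)\<rbrakk>
  \<Longrightarrow> bT (tp x \<alpha> y \<beta> z) = tpS (bT x) (bG \<alpha>) (bT y) (bG \<beta>) (bT z)"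
  by (simp add: tpS_bT)

lemmas iO_rules = integral_ternary extended_ternary zhom_ring_hom[OF S] bT_semilinear bG_semilinear span_of_carrier[OF Z.T] span_of_carrier[OF Z.G]

lemma iO_semilinear: "iO \<in> semilinear \<Z> (zhom S) OZr OSr"
  unfolding OZ_def OS_def by (rule O_map_semilinear[OF iO_rules, OF iO_hom])

lemma iO_gen: "a \<in> carrier T \<Longrightarrow> \<alpha> \<in> carrier G \<Longrightarrow> b \<in> carrier T \<Longrightarrow> \<beta> \<in> carrier G \<Longrightarrow>
    iO (ogZ a \<alpha> b \<beta>) = ogS (bT a) (bG \<alpha>) (bT b) (bG \<beta>)"
  by (rule O_map_gen[OF iO_rules, OF iO_hom]) auto

lemma iO_mult: "x \<in> carrier OZr \<Longrightarrow> y \<in> carrier OZr \<Longrightarrow> iO (x \<otimes>\<^bsub>OZr\<^esub> y) = iO x \<otimes>\<^bsub>OSr\<^esub> iO y"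
  unfolding OZ_def OS_def by (rule O_map_mult[OF iO_rules, OF iO_hom])

lemma cO_linear: "cO \<in> linear_maps S (base_change OZr S) OSr"
  unfolding O_comparison_def by (rule linear_extension_linear[OF OZ_module S OS_module iO_semilinear])

lemma cO_btens: "x \<in> carrier OZr \<Longrightarrow> cO (btens OZr S x \<one>\<^bsub>S\<^esub>) = iO x"
  unfolding O_comparison_def by (rule linear_extension_btens_one[OF OZ_module S OS_module iO_semilinear])

text \<open>The inverse is provided together with its linearity, rather than bijectivity alone,
  because the inverse of the comparison map for A is assembled from it.\<close>

lemma cO_inverse:
  obtains \<psi> where "\<psi> \<in> linear_maps S OSr (base_change OZr S)"
    "\<And>X. X \<in> carrier (base_change OZr S) \<Longrightarrow> \<psi> (cO X) = X" "\<And>Y. Y \<in> carrier OSr \<Longrightarrow> cO (\<psi> Y) = Y"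
proof -
  let ?B = "base_change_alg OZr S"
  let ?b = "\<lambda>a \<alpha> b \<beta>. btens OZr S (ogZ a \<alpha> b \<beta>) \<one>\<^bsub>S\<^esub>"
  define f where "f = ext4 S (zmod T) (zmod G) ?B ?b"
  note Bm = module_base_change_alg[OF OZ_S_rng S]
  have og: "multi4 \<Z> (\<lambda>r. r) (zmod T) (zmod G) OZr ogZ" unfolding OZ_def by (rule Z.og_multi4)
  note bs = btens_semilinear[OF OZ_module S S.one_closed]
  note ogm = multi4D[OF og] and ogc = multi4_closed[OF og, simplified]
  have b: "multi4 \<Z> (zhom S) (zmod T) (zmod G) ?B ?b"
    unfolding multi4_def semilinear_base_change_alg
    by (intro conjI ballI semilinear_linear_comp[OF ogm(1) bs] semilinear_linear_comp[OF ogm(2) bs]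
        semilinear_linear_comp[OF ogm(3) bs] semilinear_linear_comp[OF ogm(4) bs])
  have fm: "multi4 S (\<lambda>r. r) TS GS ?B f"
    unfolding f_def by (rule ext4_multi4[OF S Z.T Z.G Bm b])
  have fb: "f (bT a) (bG \<alpha>) (bT b) (bG \<beta>) = ?b a \<alpha> b \<beta>"
    if "a \<in> carrier T" "\<alpha> \<in> carrier G" "b \<in> carrier T" "\<beta> \<in> carrier G" for a \<alpha> b \<beta>
    unfolding f_def using ext4_btens_one[OF S Z.T Z.G Bm b] that by simp
  \<comment> \<open>On entries of the form a \<otimes> 1 and \<alpha> \<otimes> 1 both identities
    are the product formula and the middle relation of the integral algebra, tensored with
    1.\<close>
  have mult: "f (tpS a \<alpha> b \<beta> c) \<gamma> d \<delta> = f a \<alpha> b \<beta> \<otimes>\<^bsub>?B\<^esub> f c \<gamma> d \<delta>"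
    and mid: "f (tpS a \<alpha> b \<beta> c) \<gamma> d \<delta> = f a \<alpha> (tpS b \<beta> c \<gamma> d) \<delta>"
    if "a \<in> bT ` carrier T" "\<alpha> \<in> bG ` carrier G" "b \<in> bT ` carrier T" "\<beta> \<in> bG ` carrier G"
      "c \<in> bT ` carrier T" "\<gamma> \<in> bG ` carrier G" "d \<in> bT ` carrier T" "\<delta> \<in> bG ` carrier G" for a \<alpha> b \<beta> c \<gamma> d \<delta>
    using that Z.og_mult Z.og_middle
    by (auto simp: fb tpS_bT tp_closed base_change_alg_mult[OF OZ_S_rng S] ogc OZ_def[symmetric])
  obtain \<psi> where \<psi>: "\<psi> \<in> linear_maps S OSr ?B"
    and \<psi>og: "\<And>a \<alpha> b \<beta>. \<lbrakk>a \<in> carrier TS; \<alpha> \<in> carrier GS; b \<in> carrier TS; \<beta> \<in> carrier GS\<rbrakk>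
      \<Longrightarrow> \<psi> (ogS a \<alpha> b \<beta>) = f a \<alpha> b \<beta>"
    using E.O_lift[OF S_rng_base_change_alg[OF OZ_S_rng S] TS_span GS_span fm mult mid, of thesis]
    unfolding OS_def by blast
  note \<psi>' = \<psi>[unfolded semilinear_base_change_alg]
  show ?thesis
  proof (rule that[OF \<psi>'])
    fix X assume X: "X \<in> carrier (base_change OZr S)"
    show "\<psi> (cO X) = X"
      by (rule semilinear_eqI[OF span_of_base_change[OF OZ_module S Z.O_span_carrier[folded OZ_def]]
            module_base_change[OF OZ_module S] module_base_change[OF OZ_module S]
            semilinear_linear_comp[OF cO_linear \<psi>'] linear_ident _ X])
        (auto simp: cO_btens ogc iO_gen \<psi>og bT_closed bG_closed fb)
  next
    fix Y assume Y: "Y \<in> carrier OSr"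
    show "cO (\<psi> Y) = Y"
      by (rule semilinear_eqI[OF E.O_span[OF TS_span GS_span, folded OS_def] OS_module OS_module
            semilinear_linear_comp[OF \<psi>' cO_linear] linear_ident _ Y])
        (auto simp: cO_btens ogc iO_gen \<psi>og bT_closed bG_closed fb)
  qed
qed

lemma cO_iso: "S_rng_iso S (base_change_alg OZr S) OSr cO"
proof -
  have "bij_betw cO (carrier (base_change OZr S)) (carrier OSr)"
    using cO_inverse bij_betw_linear_inverse[OF cO_linear] by metis
  moreover have "cO (x \<otimes>\<^bsub>base_change_alg OZr S\<^esub> y) = cO x \<otimes>\<^bsub>OSr\<^esub> cO y"
    if "x \<in> carrier (base_change_alg OZr S)" "y \<in> carrier (base_change_alg OZr S)" for x y
    unfolding O_comparison_def
    by (rule linear_extension_mult[OF OZ_S_rng S OS_S_rng iO_semilinear iO_mult that])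
  ultimately show ?thesis
    unfolding S_rng_iso_def
    using S_rng_base_change_alg[OF OZ_S_rng S] OS_S_rng cO_linear
    by (simp add: semilinear_base_change_alg base_change_alg_simps)
qed

section \<open>The comparison map for A\<close>

lemma iA_eq: "iA = map_prod (zhom S) iO"
  by (simp add: A_map_def)

lemma iA_semilinear: "iA \<in> semilinear \<Z> (zhom S) AZr ASr"
  unfolding iA_eq AZ_semidirect AS_semidirect by (rule map_prod_semilinear[OF zhom_ring_hom[OF S] iO_semilinear])

lemma cA_linear: "cA \<in> linear_maps S (base_change AZr S) ASr"
  unfolding A_comparison_def by (rule linear_extension_linear[OF AZ_module S AS_module iA_semilinear])

lemma cA_btens: "x \<in> carrier AZr \<Longrightarrow> cA (btens AZr S x \<one>\<^bsub>S\<^esub>) = iA x"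
  unfolding A_comparison_def by (rule linear_extension_btens_one[OF AZ_module S AS_module iA_semilinear])

text \<open>As an S-module A \<otimes> S consists of the multiples of the unit and the image of O
  \<otimes> S. Accordingly the inverse uses the unit on the summand \<open>S\<close> and the known
  inverse for O on the other summand.\<close>

lemma cA_bij: "bij_betw cA (carrier (base_change AZr S)) (carrier ASr)"
proof -
  let ?B = "base_change AZr S"
  obtain \<psi> where \<psi>: "\<psi> \<in> linear_maps S OSr (base_change OZr S)"
    "\<And>X. X \<in> carrier (base_change OZr S) \<Longrightarrow> \<psi> (cO X) = X" "\<And>Y. Y \<in> carrier OSr \<Longrightarrow> cO (\<psi> Y) = Y"
    using cO_inverse by blast
  interpret OZ: S_rng \<Z> OZr by (rule OZ_S_rng)
  interpret OS: S_rng S OSr by (rule OS_S_rng)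
  interpret B: module S ?B by (rule module_base_change[OF AZ_module S])
  interpret AS: module S ASr by (rule AS_module)
  \<comment> \<open>\<open>?u\<close> carries the copy of \<open>S\<close>; \<open>?j\<close> is the
    inclusion of O into A followed by x \<mapsto> x \<otimes> 1, and its extension \<open>L\<close>
    embeds the part coming from O.\<close>
  let ?u = "btens AZr S (1, \<zero>\<^bsub>OZr\<^esub>) \<one>\<^bsub>S\<^esub>"
  let ?j = "\<lambda>r. btens AZr S (0, r) \<one>\<^bsub>S\<^esub>"
  have AZc: "(n, r) \<in> carrier AZr \<longleftrightarrow> r \<in> carrier OZr" for n r
    by (simp add: AZ_semidirect semidirect_simps)
  have u: "?u \<in> carrier ?B" by (simp add: btens_closed[OF AZ_module S] AZc)
  have j: "?j \<in> semilinear \<Z> (zhom S) OZr ?B"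
    using semilinear_linear_comp[OF semidirect_incl_linear[OF OZ_S_rng]
        btens_semilinear[OF AZ_module S, unfolded AZ_semidirect]] by (simp add: AZ_semidirect)
  define L where "L = linear_extension OZr S ?B ?j"
  have L: "L \<in> linear_maps S (base_change OZr S) ?B"
    unfolding L_def by (rule linear_extension_linear[OF OZ_module S B.module_axioms j])
  have L_btens: "L (btens OZr S r \<one>\<^bsub>S\<^esub>) = ?j r" if "r \<in> carrier OZr" for r
    unfolding L_def by (rule linear_extension_btens_one[OF OZ_module S B.module_axioms j that])
  define \<phi> where "\<phi> y = fst y \<odot>\<^bsub>?B\<^esub> ?u \<oplus>\<^bsub>?B\<^esub> L (\<psi> (snd y))" for y
  note L\<psi> = semilinear_linear_comp[OF \<psi>(1) L]
  have \<phi>: "\<phi> \<in> linear_maps S ASr ?B"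
    unfolding \<phi>_def AS_semidirect
    by (rule semilinearI)
      (auto simp: semidirect_simps u semilinear_closed[OF L\<psi>] semilinear_add[OF L\<psi>] semilinear_smult[OF L\<psi>]
        B.smult_l_distr B.smult_r_distr B.smult_assoc1 B.a_ac)
  have \<phi>cA: "\<phi> (cA X) = X" if X: "X \<in> carrier ?B" for X
  proof (rule semilinear_eqI[OF span_of_base_change_carrier[OF AZ_module S] B.module_axioms B.module_axioms
        semilinear_linear_comp[OF cA_linear \<phi>] linear_ident _ X])
    fix Y assume "Y \<in> (\<lambda>x. btens AZr S x \<one>\<^bsub>S\<^esub>) ` carrier AZr"
    then obtain n r where Y: "Y = btens AZr S (n, r) \<one>\<^bsub>S\<^esub>" and r: "r \<in> carrier OZr"
      by (auto simp: AZ_semidirect semidirect_simps)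
    note bs = btens_semilinear[OF AZ_module S S.one_closed]
    have "\<psi> (iO r) = btens OZr S r \<one>\<^bsub>S\<^esub>"
      using \<psi>(2)[OF btens_closed[OF OZ_module S r S.one_closed]] by (simp add: cO_btens r)
    then have "\<phi> (cA Y) = zhom S n \<odot>\<^bsub>?B\<^esub> ?u \<oplus>\<^bsub>?B\<^esub> ?j r"
      by (simp add: Y cA_btens AZc r iA_eq \<phi>_def L_btens)
    \<comment> \<open>Since x \<mapsto> x \<otimes> 1 is semilinear along \<int> \<rightarrow> S, a
      scalar that comes from an integer can be moved inside the tensor.\<close>
    also have "zhom S n \<odot>\<^bsub>?B\<^esub> ?u = btens AZr S (n, \<zero>\<^bsub>OZr\<^esub>) \<one>\<^bsub>S\<^esub>"
      using semilinear_smult[OF bs, of n "(1, \<zero>\<^bsub>OZr\<^esub>)"] by (simp add: AZ_semidirect semidirect_simps)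
    also have "btens AZr S (n, \<zero>\<^bsub>OZr\<^esub>) \<one>\<^bsub>S\<^esub> \<oplus>\<^bsub>?B\<^esub> ?j r = Y"
      using semilinear_add[OF bs, of "(n, \<zero>\<^bsub>OZr\<^esub>)" "(0, r)"] r by (simp add: AZ_semidirect semidirect_simps Y)
    finally show "\<phi> (cA Y) = Y" .
  qed
  \<comment> \<open>On the part coming from O the map \<open>cA\<close> restricts to
    \<open>cO\<close>, followed by the inclusion of the second summand.\<close>
  have cAL: "cA (L X) = (\<zero>\<^bsub>S\<^esub>, cO X)" if X: "X \<in> carrier (base_change OZr S)" for X
    by (rule semilinear_eqI[OF span_of_base_change_carrier[OF OZ_module S] module_base_change[OF OZ_module S] AS_module
          semilinear_linear_comp[OF L cA_linear]
          semilinear_linear_comp[OF cO_linear semidirect_incl_linear[OF OS_S_rng], folded AS_semidirect] _ X])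
      (auto simp: L_btens cA_btens cO_btens AZc iA_eq S.add_pow_rules)
  have iO0: "iO \<zero>\<^bsub>OZr\<^esub> = \<zero>\<^bsub>OSr\<^esub>"
    by (rule semilinear_zero[OF iO_semilinear OZ.abelian_group_axioms OS.abelian_group_axioms])
  have cA\<phi>: "cA (\<phi> Y) = Y" if Y: "Y \<in> carrier ASr" for Y
  proof -
    obtain s y where sy: "Y = (s, y)" "s \<in> carrier S" "y \<in> carrier OSr"
      using Y by (auto simp: AS_semidirect semidirect_simps)
    have "cA (\<phi> Y) = s \<odot>\<^bsub>ASr\<^esub> cA ?u \<oplus>\<^bsub>ASr\<^esub> cA (L (\<psi> y))"
      using sy u semilinear_closed[OF L\<psi>, of y]
      by (simp add: \<phi>_def semilinear_add[OF cA_linear] semilinear_smult[OF cA_linear])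
    also have "\<dots> = s \<odot>\<^bsub>ASr\<^esub> (\<one>\<^bsub>S\<^esub>, \<zero>\<^bsub>OSr\<^esub>) \<oplus>\<^bsub>ASr\<^esub> (\<zero>\<^bsub>S\<^esub>, y)"
      using sy by (simp add: cA_btens AZc iA_eq iO0 S.add_pow_rules cAL semilinear_closed[OF \<psi>(1)] \<psi>(3))
    also have "\<dots> = Y"
      using sy by (simp add: AS_semidirect semidirect_simps)
    finally show ?thesis .
  qed
  show ?thesis by (rule bij_betw_linear_inverse[OF cA_linear \<phi> \<phi>cA cA\<phi>])
qed

lemma cA_iso: "unital_algebra_iso S (base_change_alg AZr S) ASr cA"
proof -
  have iA_mult: "iA (x \<otimes>\<^bsub>AZr\<^esub> y) = iA x \<otimes>\<^bsub>ASr\<^esub> iA y" if "x \<in> carrier AZr" "y \<in> carrier AZr" for x y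
    unfolding iA_eq AZ_semidirect AS_semidirect
    by (rule map_prod_mult[OF OZ_S_rng OS_S_rng zhom_ring_hom[OF S] iO_semilinear iO_mult])
      (use that in \<open>simp_all add: AZ_semidirect\<close>)
  have "cA (x \<otimes>\<^bsub>base_change_alg AZr S\<^esub> y) = cA x \<otimes>\<^bsub>ASr\<^esub> cA y"
    if "x \<in> carrier (base_change_alg AZr S)" "y \<in> carrier (base_change_alg AZr S)" for x y
    unfolding A_comparison_def
    by (rule linear_extension_mult[OF AZ_S_rng S AS_S_rng iA_semilinear iA_mult that])
  \<comment> \<open>The unit is (1, 0) \<otimes> 1, so its image is the value of \<open>iA\<close>
    at (1, 0), whose second entry vanishes because \<open>iO\<close> preserves zero.\<close>
  moreover have "cA (btens AZr S \<one>\<^bsub>AZr\<^esub> \<one>\<^bsub>S\<^esub>) = \<one>\<^bsub>ASr\<^esub>"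
  proof -
    interpret OZ: S_rng \<Z> OZr by (rule OZ_S_rng)
    interpret OS: S_rng S OSr by (rule OS_S_rng)
    have "iO \<zero>\<^bsub>OZr\<^esub> = \<zero>\<^bsub>OSr\<^esub>"
      by (rule semilinear_zero[OF iO_semilinear OZ.abelian_group_axioms OS.abelian_group_axioms])
    then show ?thesis
      by (subst cA_btens) (simp_all add: iA_eq AZ_semidirect AS_semidirect semidirect_simps S.add_pow_rules)
  qed
  ultimately show ?thesis
    unfolding unital_algebra_iso_def S_rng_iso_def
    using unital_algebra_base_change_alg[OF AZ_unital S] AS_unital S_rng_base_change_alg[OF AZ_S_rng S] AS_S_rng cA_linear cA_bij
    by (simp add: semilinear_base_change_alg base_change_alg_simps)
qed

end

section \<open>Naturality\<close>

context
  fixes T :: "('t, 'x) ring_scheme" and G :: "('g, 'y) ring_scheme"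
    and tp :: "('t, 'g) ternary" and S :: "('s, 'z) ring_scheme"
    and T' :: "('t2, 'x2) ring_scheme" and G' :: "('g2, 'y2) ring_scheme"
    and tp' :: "('t2, 'g2) ternary" and S' :: "('s2, 'z2) ring_scheme" and f g h
  assumes tgr: "ternary_gamma_ring T G tp" and S: "cring S"
    and tgr': "ternary_gamma_ring T' G' tp'" and S': "cring S'"
    and fg: "ternary_gamma_hom T G tp T' G' tp' f g" and h: "h \<in> ring_hom S S'"
begin

interpretation E: scalar_extension T G tp S by (rule scalar_extension.intro[OF tgr S])
interpretation E': scalar_extension T' G' tp' S' by (rule scalar_extension.intro[OF tgr' S'])
interpretation Z: assoc_ternary_module \<Z> "zmod T" "zmod G" tp by (rule E.integral_ternary)
interpretation Z': assoc_ternary_module \<Z> "zmod T'" "zmod G'" tp' by (rule E'.integral_ternary)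

private lemma f: "f \<in> linear_maps \<Z> (zmod T) (zmod T')" and g: "g \<in> linear_maps \<Z> (zmod G) (zmod G')"
  using tgr tgr' fg by (auto intro!: hom_linear_zmod simp: ternary_gamma_ring_def ternary_gamma_hom_def)

private lemma fc: "x \<in> carrier T \<Longrightarrow> f x \<in> carrier T'" and gc: "\<alpha> \<in> carrier G \<Longrightarrow> g \<alpha> \<in> carrier G'"
  using semilinear_closed[OF f] semilinear_closed[OF g] by auto

private lemma f_tp:
  "\<lbrakk>x \<in> carrier (zmod T); \<alpha> \<in> carrier (zmod G); y \<in> carrier (zmod T); \<beta> \<in> carrier (zmod G); z \<in> carrier (zmod T)\<rbrakk>
    \<Longrightarrow> f (tp x \<alpha> y \<beta> z) = tp' (f x) (g \<alpha>) (f y) (g \<beta>) (f z)"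
  using fg by (auto simp: ternary_gamma_hom_def)

private abbreviation (input) "fS \<equiv> base_change_map (zmod T) S (zmod T') S' f h"
private abbreviation (input) "gS \<equiv> base_change_map (zmod G) S (zmod G') S' g h"

private lemma fS_bT: "x \<in> carrier T \<Longrightarrow> fS (E.bT x) = E'.bT (f x)"
  using base_change_map_btens[OF Z.T S Z'.T S' f h, of x "\<one>\<^bsub>S\<^esub>"] S by (simp add: ring_hom_one[OF h] cring.cring_simprules)

private lemma gS_bG: "x \<in> carrier G \<Longrightarrow> gS (E.bG x) = E'.bG (g x)"
  using base_change_map_btens[OF Z.G S Z'.G S' g h, of x "\<one>\<^bsub>S\<^esub>"] S by (simp add: ring_hom_one[OF h] cring.cring_simprules)

text \<open>Checked only on elements a \<otimes> 1 and \<alpha> \<otimes> 1, where both ternary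
  products are explicit; these spanning sets are all that \<open>O_map\<close> asks for.\<close>

private lemma fS_tpS:
  "\<lbrakk>x \<in> E.bT ` carrier T; \<alpha> \<in> E.bG ` carrier G; y \<in> E.bT ` carrier T; \<beta> \<in> E.bG ` carrier G; z \<in> E.bT ` carrier T\<rbrakk>
    \<Longrightarrow> fS (E.tpS x \<alpha> y \<beta> z) = E'.tpS (fS x) (gS \<alpha>) (fS y) (gS \<beta>) (fS z)"
  by (auto simp: E.tpS_bT E'.tpS_bT fS_bT gS_bG E.tp_closed fc gc f_tp)

private abbreviation (input) "\<phi> \<equiv> O_map \<Z> (zmod T) (zmod G) tp \<Z> (zmod T') (zmod G') tp' (\<lambda>k. k) f g"
private abbreviation (input) "\<kappa> \<equiv> OS_map T G tp S T' G' tp' S' f g h"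

private lemmas \<phi>_rules = E.integral_ternary E'.integral_ternary ring_hom_ident f g span_of_carrier[OF Z.T] span_of_carrier[OF Z.G]

private lemmas \<kappa>_rules = E.extended_ternary E'.extended_ternary h base_change_map_semilinear[OF Z.T S Z'.T S' f h]
  base_change_map_semilinear[OF Z.G S Z'.G S' g h] E.TS_span E.GS_span

private lemma \<phi>_linear: "\<phi> \<in> linear_maps \<Z> E.OZr E'.OZr"
  unfolding OZ_def by (rule O_map_semilinear[OF \<phi>_rules, OF f_tp])

private lemma \<kappa>_semilinear: "\<kappa> \<in> semilinear S h E.OSr E'.OSr"
  unfolding OS_map_def OS_def by (rule O_map_semilinear[OF \<kappa>_rules, OF fS_tpS])

text \<open>This is the naturality square before extension of scalars. The two paths meet on
  generators because the base change of \<open>f\<close> sends a \<otimes> 1 to f a \<otimes> 1, and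
  likewise for \<open>g\<close>.\<close>

private lemma \<kappa>_iO:
  assumes x: "x \<in> carrier E.OZr"
  shows "\<kappa> (E.iO x) = E'.iO (\<phi> x)"
proof (rule semilinear_eqI[OF Z.O_span_carrier[folded OZ_def] E.OZ_module E'.OS_module _ _ _ x])
  show "(\<lambda>x. E'.iO (\<phi> x)) \<in> semilinear \<Z> (zhom S') E.OZr E'.OSr"
    by (rule semilinear_linear_comp[OF \<phi>_linear E'.iO_semilinear])
  \<comment> \<open>This composite is at first semilinear along \<int> \<rightarrow> S \<rightarrow>
    S'; \<open>ring_hom_zhom\<close> rewrites it to \<int> \<rightarrow> S', so that both paths lie
    over the same map of scalars.\<close>
  show "(\<lambda>x. \<kappa> (E.iO x)) \<in> semilinear \<Z> (zhom S') E.OZr E'.OSr"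
    using semilinear_comp[OF E.iO_semilinear \<kappa>_semilinear zhom_image[OF S]] by (simp add: ring_hom_zhom[OF S S' h])
  fix y assume "y \<in> {E.ogZ a \<alpha> b \<beta> | a \<alpha> b \<beta>. a \<in> carrier (zmod T) \<and> \<alpha> \<in> carrier (zmod G) \<and>
    b \<in> carrier (zmod T) \<and> \<beta> \<in> carrier (zmod G)}"
  then obtain a \<alpha> b \<beta> where y: "y = E.ogZ a \<alpha> b \<beta>"
    and el: "a \<in> carrier T" "\<alpha> \<in> carrier G" "b \<in> carrier T" "\<beta> \<in> carrier G" by auto
  have "\<kappa> (E.iO y) = E'.ogS (fS (E.bT a)) (gS (E.bG \<alpha>)) (fS (E.bT b)) (gS (E.bG \<beta>))"
    unfolding y E.iO_gen[OF el] OS_map_def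
    by (rule O_map_gen[OF \<kappa>_rules, OF fS_tpS]) (simp_all add: el E.bT_closed E.bG_closed)
  also have "\<dots> = E'.iO (E'.ogZ (f a) (g \<alpha>) (f b) (g \<beta>))"
    by (simp add: fS_bT gS_bG E'.iO_gen fc gc el)
  also have "E'.ogZ (f a) (g \<alpha>) (f b) (g \<beta>) = \<phi> y"
    unfolding y by (rule O_map_gen[OF \<phi>_rules, OF f_tp, symmetric]) (simp_all add: el)
  finally show "\<kappa> (E.iO y) = E'.iO (\<phi> y)" .
qed

lemma O_comparison_natural:
  assumes "X \<in> carrier (base_change_alg E.OZr S)"
  shows "E'.cO (OZ_base_change_map T G tp S T' G' tp' S' f g h X) = \<kappa> (E.cO X)"
  unfolding O_comparison_def OZ_base_change_map_def
  by (rule linear_extension_natural[OF E.OZ_module S E'.OZ_module S' \<phi>_linear h E.OS_module E'.OS_module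
        E.iO_semilinear E'.iO_semilinear \<kappa>_semilinear, OF \<kappa>_iO])
    (use assms in \<open>auto simp: base_change_alg_simps\<close>)

lemma A_comparison_natural:
  assumes "X \<in> carrier (base_change_alg E.AZr S)"
  shows "E'.cA (AZ_base_change_map T G tp S T' G' tp' S' f g h X) = AS_map T G tp S T' G' tp' S' f g h (E.cA X)"
  unfolding A_comparison_def AZ_base_change_map_def
proof (rule linear_extension_natural[OF E.AZ_module S E'.AZ_module S' _ h E.AS_module E'.AS_module
        E.iA_semilinear E'.iA_semilinear])
  show "A_map \<Z> (zmod T) (zmod G) tp \<Z> (zmod T') (zmod G') tp' (\<lambda>k. k) f g \<in> linear_maps \<Z> E.AZr E'.AZr"
    unfolding A_map_def E.AZ_semidirect E'.AZ_semidirect by (rule map_prod_semilinear[OF ring_hom_ident \<phi>_linear])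
  have AS_map: "AS_map T G tp S T' G' tp' S' f g h = map_prod h \<kappa>"
    by (simp add: AS_map_def A_map_def OS_map_def)
  show "AS_map T G tp S T' G' tp' S' f g h \<in> semilinear S h E.ASr E'.ASr"
    unfolding AS_map E.AS_semidirect E'.AS_semidirect by (rule map_prod_semilinear[OF h \<kappa>_semilinear])
  \<comment> \<open>All maps here act separately on the two summands, so the square splits into
    initiality of \<int> on scalars and \<open>\<kappa>_iO\<close> on O.\<close>
  show "AS_map T G tp S T' G' tp' S' f g h (E.iA x) =
      E'.iA (A_map \<Z> (zmod T) (zmod G) tp \<Z> (zmod T') (zmod G') tp' (\<lambda>k. k) f g x)" if "x \<in> carrier E.AZr" for x
    using that unfolding AS_map E.iA_eq E'.iA_eq
    by (auto simp: A_map_def E.AZ_semidirect semidirect_simps \<kappa>_iO ring_hom_zhom[OF S S' h])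
qed (use assms in \<open>auto simp: base_change_alg_simps\<close>)

end

theorem theorem5p4:
  fixes T :: "('t, 'x) ring_scheme" and G :: "('g, 'y) ring_scheme"
    and tp :: "('t, 'g) ternary" and S :: "('s, 'z) ring_scheme"
  assumes "ternary_gamma_ring T G tp" and "cring S"
  shows "S_rng_iso S (base_change_alg (OZ T G tp) S) (OS T G tp S) (O_comparison T G tp S) \<and>
    unital_algebra_iso S (base_change_alg (AZ T G tp) S) (AS T G tp S) (A_comparison T G tp S) \<and>
    (\<forall>(T' :: ('t2, 'x2) ring_scheme) (G' :: ('g2, 'y2) ring_scheme) (tp' :: ('t2, 'g2) ternary)
      (S' :: ('s2, 'z2) ring_scheme) f g h.
      ternary_gamma_ring T' G' tp' \<and> cring S' \<and>
      ternary_gamma_hom T G tp T' G' tp' f g \<and> h \<in> ring_hom S S' \<longrightarrow>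
        (\<forall>X \<in> carrier (base_change_alg (OZ T G tp) S).
          O_comparison T' G' tp' S' (OZ_base_change_map T G tp S T' G' tp' S' f g h X) =
          OS_map T G tp S T' G' tp' S' f g h (O_comparison T G tp S X)) \<and>
        (\<forall>X \<in> carrier (base_change_alg (AZ T G tp) S).
          A_comparison T' G' tp' S' (AZ_base_change_map T G tp S T' G' tp' S' f g h X) =
          AS_map T G tp S T' G' tp' S' f g h (A_comparison T G tp S X)))"
proof -
  interpret scalar_extension T G tp S by (rule scalar_extension.intro[OF assms])
  show ?thesis
    using cO_iso cA_iso O_comparison_natural[OF assms] A_comparison_natural[OF assms] by blast
qed

end
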